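(* Let $T$ be a complete first-order theory with monster model $\mathfrak{C}$, let $A$ be a set, and let $p$ be a global type which is NIP and generically stable over $A$. Then $p\restriction A$ is NIP and $\mathrm{dpr}(p\restriction A)=\mathrm{dpr}(p)$.
   Context: $T$ is a complete first-order theory in a language $\mathcal{L}$ and $\mathfrak{C}$ is its monster model; $A$ is a small subset of $\mathfrak{C}$. A global type is a type over $\mathfrak{C}$ (its realizations live in a larger monster model). For a property $t$, $\varphi^{(t)}$ is $\varphi$ if $t$ holds and $\neg\varphi$ otherwise. A partial type $\pi(x)$ has IP if there are a formula $\varphi(x,y)\in\mathcal{L}$ and a sequence $(a_i)_{i<\omega}$ of realizations of $\pi$ such that for every $s\subseteq\omega$ the set $\{\varphi(a_i,y)^{(i\in s)} : i<\omega\}$ is consistent; $\pi$ is NIP if it does not have IP. Morley sequences: for a linear order $(X,<)$, a sequence $(a_i)_{i\in X}$ is generated by $p$ over $A$ if $a_i\models p\restriction Aa_{<i}$ for all $i\in X$. A Morley sequence over $A$ is an $A$-indiscernible sequence $(a_i)_{i\in X}$ such that $\mathrm{tp}(a_i/Aa_{<i})$ does not fork over $A$ for every $i\in X$. A Morley sequence generated by $p$ over $A$ is a sequence generated by $p$ over $A$ which is Morley over $A$. A global type $p$ is generically stable over $A$ if it is $A$-invariant (invariant under automorphisms of $\mathfrak{C}$ fixing $A$ pointwise) and for every ordinal $\alpha$, every formula $\varphi(x)$ with parameters in the monster model and every Morley sequence $(a_i)_{i<\alpha}$ generated by $p$ over $A$, the set $\{i<\alpha : {}\models\varphi(a_i)\}$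 is finite or cofinite. dp-rank: for a partial type $\Sigma(x)$ over $A$ and a cardinal $\kappa$, $\mathrm{dpr}(\Sigma)<\kappa$ if for every family $(I_\alpha)_{\alpha<\kappa}$ of $A$-mutually indiscernible infinite sequences and every $b\models\Sigma$ there is $\beta<\kappa$ such that $I_\beta$ is indiscernible over $bA$; otherwise $\mathrm{dpr}(\Sigma)\ge\kappa$. (This does not depend on the set $A$ containing the parameters of $\Sigma$.) $\mathrm{dpr}(\Sigma)=\mathrm{dpr}(\Sigma')$ means that for every cardinal $\kappa$, $\mathrm{dpr}(\Sigma)<\kappa$ iff $\mathrm{dpr}(\Sigma')<\kappa$. *)

theory Defs
  imports Main
begin

unbundle cardinal_syntax


section \<open>First-order languages, structures and formulas\<close>

text \<open>
  A symbol is a name together with an arity.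
\<close>

record ('f, 'r) lang =
  funs :: "('f \<times> nat) set"
  rels :: "('r \<times> nat) set"

datatype 'f tm = Var nat | Fn 'f "'f tm list"

datatype ('f, 'r) fm =
    Eq "'f tm" "'f tm"
  | Rel 'r "'f tm list"
  | Neg "('f, 'r) fm"
  | And "('f, 'r) fm" "('f, 'r) fm"
  | Ex nat "('f, 'r) fm"

fun fv_tm :: "'f tm \<Rightarrow> nat set" where
  "fv_tm (Var x) = {x}"
| "fv_tm (Fn f ts) = (\<Union>t \<in> set ts. fv_tm t)"

fun fv :: "('f, 'r) fm \<Rightarrow> nat set" where
  "fv (Eq s t) = fv_tm s \<union> fv_tm t"
| "fv (Rel R ts) = (\<Union>t \<in> set ts. fv_tm t)"
| "fv (Neg \<phi>) = fv \<phi>"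
| "fv (And \<phi> \<psi>) = fv \<phi> \<union> fv \<psi>"
| "fv (Ex x \<phi>) = fv \<phi> - {x}"

fun wf_tm :: "('f, 'r) lang \<Rightarrow> 'f tm \<Rightarrow> bool" where
  "wf_tm L (Var x) = True"
| "wf_tm L (Fn f ts) = ((f, length ts) \<in> funs L \<and> (\<forall>t \<in> set ts. wf_tm L t))"

fun wf_fm :: "('f, 'r) lang \<Rightarrow> ('f, 'r) fm \<Rightarrow> bool" where
  "wf_fm L (Eq s t) = (wf_tm L s \<and> wf_tm L t)"
| "wf_fm L (Rel R ts) = ((R, length ts) \<in> rels L \<and> (\<forall>t \<in> set ts. wf_tm L t))"
| "wf_fm L (Neg \<phi>) = wf_fm L \<phi>"
| "wf_fm L (And \<phi> \<psi>) = (wf_fm L \<phi> \<and> wf_fm L \<psi>)"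
| "wf_fm L (Ex x \<phi>) = wf_fm L \<phi>"

definition fms :: "('f, 'r) lang \<Rightarrow> nat \<Rightarrow> ('f, 'r) fm set" where
  "fms L n = {\<phi>. wf_fm L \<phi> \<and> fv \<phi> \<subseteq> {..<n}}"

record ('f, 'r, 'a) struct =
  univ :: "'a set"
  fn_int :: "'f \<Rightarrow> 'a list \<Rightarrow> 'a"
  rel_int :: "'r \<Rightarrow> 'a list \<Rightarrow> bool"

definition is_struct :: "('f, 'r) lang \<Rightarrow> ('f, 'r, 'a) struct \<Rightarrow> bool" where
  "is_struct L M \<longleftrightarrow> univ M \<noteq> {} \<and>
     (\<forall>(f, k) \<in> funs L. \<forall>as. length as = k \<and> set as \<subseteq> univ M \<longrightarrow> fn_int M f as \<in> univ M)"

fun eval :: "('f, 'r, 'a) struct \<Rightarrow> (nat \<Rightarrow> 'a) \<Rightarrow> 'f tm \<Rightarrow> 'a" where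
  "eval M e (Var x) = e x"
| "eval M e (Fn f ts) = fn_int M f (map (eval M e) ts)"

fun sat :: "('f, 'r, 'a) struct \<Rightarrow> (nat \<Rightarrow> 'a) \<Rightarrow> ('f, 'r) fm \<Rightarrow> bool" where
  "sat M e (Eq s t) = (eval M e s = eval M e t)"
| "sat M e (Rel R ts) = rel_int M R (map (eval M e) ts)"
| "sat M e (Neg \<phi>) = (\<not> sat M e \<phi>)"
| "sat M e (And \<phi> \<psi>) = (sat M e \<phi> \<and> sat M e \<psi>)"
| "sat M e (Ex x \<phi>) = (\<exists>a \<in> univ M. sat M (e(x := a)) \<phi>)"

text \<open>
  \<open>holds M \<phi> as\<close> evaluates the variables \<open>0, 1, \<dots>\<close> at the entries of the tuple \<open>as\<close>.
  It is only used for \<open>\<phi> \<in> fms L (length as)\<close>, so the value of \<open>as ! i\<close> for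
  \<open>i \<ge> length as\<close> is irrelevant.
\<close>

definition holds :: "('f, 'r, 'a) struct \<Rightarrow> ('f, 'r) fm \<Rightarrow> 'a list \<Rightarrow> bool" where
  "holds M \<phi> as \<longleftrightarrow> sat M (\<lambda>i. as ! i) \<phi>"

definition is_model :: "('f, 'r) lang \<Rightarrow> ('f, 'r) fm set \<Rightarrow> ('f, 'r, 'a) struct \<Rightarrow> bool" where
  "is_model L T M \<longleftrightarrow> is_struct L M \<and> (\<forall>\<sigma> \<in> T. holds M \<sigma> [])"

text \<open>
  By the downward Loewenheim-Skolem theorem, a satisfiable set of sentences has a model of
  cardinality at most that of the set of formulas. So nothing is lost by letting only
  structures on sets of formulas occur in the definition of entailment.
\<close>

definition entails :: "('f, 'r) lang \<Rightarrow> ('f, 'r) fm set \<Rightarrow> ('f, 'r) fm \<Rightarrow> bool" where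
  "entails L T \<sigma> \<longleftrightarrow>
     (\<forall>M :: ('f, 'r, ('f, 'r) fm) struct. is_model L T M \<longrightarrow> holds M \<sigma> [])"

definition complete_theory :: "('f, 'r) lang \<Rightarrow> ('f, 'r) fm set \<Rightarrow> bool" where
  "complete_theory L T \<longleftrightarrow> T \<subseteq> fms L 0 \<and>
     (\<exists>M :: ('f, 'r, ('f, 'r) fm) struct. is_model L T M) \<and>
     (\<forall>\<sigma> \<in> fms L 0. entails L T \<sigma> \<or> entails L T (Neg \<sigma>))"

definition elem_sub ::
    "('f, 'r) lang \<Rightarrow> ('f, 'r, 'a) struct \<Rightarrow> ('f, 'r, 'a) struct \<Rightarrow> bool" where
  "elem_sub L M N \<longleftrightarrow> is_struct L M \<and> is_struct L N \<and> univ M \<subseteq> univ N \<and>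
     (\<forall>as \<phi>. set as \<subseteq> univ M \<and> \<phi> \<in> fms L (length as) \<longrightarrow> (holds M \<phi> as \<longleftrightarrow> holds N \<phi> as))"

definition automorphism :: "('f, 'r) lang \<Rightarrow> ('f, 'r, 'a) struct \<Rightarrow> ('a \<Rightarrow> 'a) \<Rightarrow> bool" where
  "automorphism L M \<sigma> \<longleftrightarrow> bij_betw \<sigma> (univ M) (univ M) \<and>
     (\<forall>(f, k) \<in> funs L. \<forall>as. length as = k \<and> set as \<subseteq> univ M \<longrightarrow>
        \<sigma> (fn_int M f as) = fn_int M f (map \<sigma> as)) \<and>
     (\<forall>(R, k) \<in> rels L. \<forall>as. length as = k \<and> set as \<subseteq> univ M \<longrightarrow>
        (rel_int M R as \<longleftrightarrow> rel_int M R (map \<sigma> as)))"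


section \<open>Types\<close>

text \<open>
  A formula \<open>\<phi>(x, b)\<close> in an \<open>n\<close>-tuple \<open>x\<close> of variables with parameters in \<open>B\<close> is a pair
  \<open>(\<phi>, b)\<close>: the variables \<open>0, \<dots>, n - 1\<close> of \<open>\<phi>\<close> form the tuple \<open>x\<close>, and the variables from \<open>n\<close>
  on stand for the entries of \<open>b\<close>.
\<close>

type_synonym ('f, 'r, 'a) pfm = "('f, 'r) fm \<times> 'a list"

definition pfms :: "('f, 'r) lang \<Rightarrow> nat \<Rightarrow> 'a set \<Rightarrow> ('f, 'r, 'a) pfm set" where
  "pfms L n B = {(\<phi>, b). set b \<subseteq> B \<and> \<phi> \<in> fms L (n + length b)}"

definition tuples :: "('f, 'r, 'a) struct \<Rightarrow> nat \<Rightarrow> 'a list set" where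
  "tuples M n = {a. length a = n \<and> set a \<subseteq> univ M}"

definition realizes ::
    "('f, 'r, 'a) struct \<Rightarrow> nat \<Rightarrow> ('f, 'r, 'a) pfm set \<Rightarrow> 'a list \<Rightarrow> bool" where
  "realizes M n \<Sigma> a \<longleftrightarrow> a \<in> tuples M n \<and> (\<forall>(\<phi>, b) \<in> \<Sigma>. holds M \<phi> (a @ b))"

definition consistent :: "('f, 'r, 'a) struct \<Rightarrow> nat \<Rightarrow> ('f, 'r, 'a) pfm set \<Rightarrow> bool" where
  "consistent M n \<Sigma> \<longleftrightarrow> (\<forall>F. finite F \<and> F \<subseteq> \<Sigma> \<longrightarrow> (\<exists>a. realizes M n F a))"

definition complete_types ::
    "('f, 'r) lang \<Rightarrow> ('f, 'r, 'a) struct \<Rightarrow> nat \<Rightarrow> 'a set \<Rightarrow> ('f, 'r, 'a) pfm set set" where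
  "complete_types L M n B = {p. p \<subseteq> pfms L n B \<and> consistent M n p \<and>
     (\<forall>(\<phi>, b) \<in> pfms L n B. (\<phi>, b) \<in> p \<or> (Neg \<phi>, b) \<in> p)}"

definition tp ::
    "('f, 'r) lang \<Rightarrow> ('f, 'r, 'a) struct \<Rightarrow> 'a list \<Rightarrow> 'a set \<Rightarrow> ('f, 'r, 'a) pfm set" where
  "tp L M a B = {(\<phi>, b) \<in> pfms L (length a) B. holds M \<phi> (a @ b)}"

definition restrict_type :: "('f, 'r, 'a) pfm set \<Rightarrow> 'a set \<Rightarrow> ('f, 'r, 'a) pfm set" where
  "restrict_type p B = {(\<phi>, b) \<in> p. set b \<subseteq> B}"


section \<open>Monster models\<close>

text \<open>
  Cardinals are cardinal orders in the sense of \<^const>\<open>Card_order\<close>. The set of all formulas of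
  \<open>L\<close> has cardinality \<open>|L| + \<aleph>\<^sub>0\<close>.
\<close>

definition saturated ::
    "('f, 'r) lang \<Rightarrow> 'k rel \<Rightarrow> ('f, 'r, 'a) struct \<Rightarrow> bool" where
  "saturated L \<kappa> M \<longleftrightarrow> (\<forall>B n p. B \<subseteq> univ M \<and> |B| <o \<kappa> \<and> p \<in> complete_types L M n B \<longrightarrow>
     (\<exists>a. realizes M n p a))"

definition strongly_homogeneous ::
    "('f, 'r) lang \<Rightarrow> 'k rel \<Rightarrow> ('f, 'r, 'a) struct \<Rightarrow> bool" where
  "strongly_homogeneous L \<kappa> M \<longleftrightarrow> (\<forall>B g. B \<subseteq> univ M \<and> |B| <o \<kappa> \<and> g ` B \<subseteq> univ M \<and>
     (\<forall>as \<phi>. set as \<subseteq> B \<and> \<phi> \<in> fms L (length as) \<longrightarrow>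
        (holds M \<phi> as \<longleftrightarrow> holds M \<phi> (map g as))) \<longrightarrow>
     (\<exists>\<sigma>. automorphism L M \<sigma> \<and> (\<forall>b \<in> B. \<sigma> b = g b)))"

text \<open>
  A set is small with respect to a monster model \<open>M\<close> if its cardinality is less than the
  cardinal \<open>\<kappa>\<close> below.
\<close>

definition monster_model ::
    "('f, 'r) lang \<Rightarrow> ('f, 'r) fm set \<Rightarrow> 'k rel \<Rightarrow> ('f, 'r, 'a) struct \<Rightarrow> bool" where
  "monster_model L T \<kappa> M \<longleftrightarrow> Card_order \<kappa> \<and> |{\<phi>. wf_fm L \<phi>}| <o \<kappa> \<and> is_model L T M \<and>
     saturated L \<kappa> M \<and> strongly_homogeneous L \<kappa> M"


section \<open>Sequences and indiscernibility\<close>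

text \<open>
  A sequence of \<open>n\<close>-tuples is given by a reflexive linear order \<open>r\<close> and a function that matters
  only on \<^term>\<open>Field r\<close>. Where sequences are quantified over, the index set is a set of tuples
  of elements; this allows every linear order of cardinality at most \<open>\<aleph>\<^sub>0 + |M|\<close> up to
  isomorphism.
\<close>

definition is_seq :: "('f, 'r, 'a) struct \<Rightarrow> nat \<Rightarrow> 'i rel \<Rightarrow> ('i \<Rightarrow> 'a list) \<Rightarrow> bool" where
  "is_seq M n r a \<longleftrightarrow> Linear_order r \<and> (\<forall>i \<in> Field r. a i \<in> tuples M n)"

definition increasing :: "'i rel \<Rightarrow> 'i list \<Rightarrow> bool" where
  "increasing r is \<longleftrightarrow> set is \<subseteq> Field r \<and> sorted_wrt (\<lambda>i j. (i, j) \<in> r \<and> i \<noteq> j) is"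

definition entries :: "('i \<Rightarrow> 'a list) \<Rightarrow> 'i set \<Rightarrow> 'a set" where
  "entries a X = (\<Union>i \<in> X. set (a i))"

definition below :: "'i rel \<Rightarrow> 'i \<Rightarrow> 'i set" where
  "below r i = {j. (j, i) \<in> r \<and> j \<noteq> i}"

definition indiscernible ::
    "('f, 'r) lang \<Rightarrow> ('f, 'r, 'a) struct \<Rightarrow> 'a set \<Rightarrow> 'i rel \<Rightarrow> ('i \<Rightarrow> 'a list) \<Rightarrow> bool" where
  "indiscernible L M B r a \<longleftrightarrow> (\<forall>is js. increasing r is \<and> increasing r js \<and>
     length is = length js \<longrightarrow> tp L M (concat (map a is)) B = tp L M (concat (map a js)) B)"

definition mutually_indiscernible ::
    "('f, 'r) lang \<Rightarrow> ('f, 'r, 'a) struct \<Rightarrow> 'a set \<Rightarrow> 'k set \<Rightarrow>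
     ('k \<Rightarrow> 'i rel) \<Rightarrow> ('k \<Rightarrow> 'i \<Rightarrow> 'a list) \<Rightarrow> bool" where
  "mutually_indiscernible L M B K r I \<longleftrightarrow> (\<forall>\<alpha> \<in> K.
     indiscernible L M (B \<union> (\<Union>\<beta> \<in> K - {\<alpha>}. entries (I \<beta>) (Field (r \<beta>)))) (r \<alpha>) (I \<alpha>))"


section \<open>Forking, Morley sequences and generic stability\<close>

definition divides ::
    "('f, 'r) lang \<Rightarrow> ('f, 'r, 'a) struct \<Rightarrow> nat \<Rightarrow> 'a set \<Rightarrow> ('f, 'r, 'a) pfm \<Rightarrow> bool" where
  "divides L M n A = (\<lambda>(\<phi>, b). \<exists>(c :: nat \<Rightarrow> 'a list) k.
     (\<forall>i. c i \<in> tuples M (length b) \<and> tp L M (c i) A = tp L M b A) \<and>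
     (\<forall>F. finite F \<and> card F = k \<longrightarrow> \<not> consistent M n {(\<phi>, c i) | i. i \<in> F}))"

text \<open>
  A partial type \<open>\<Sigma>\<close> forks over \<open>A\<close> if it implies the disjunction of a finite set \<open>\<Delta>\<close> of
  formulas, with arbitrary parameters, that divide over \<open>A\<close>.
\<close>

definition forks ::
    "('f, 'r) lang \<Rightarrow> ('f, 'r, 'a) struct \<Rightarrow> nat \<Rightarrow> 'a set \<Rightarrow> ('f, 'r, 'a) pfm set \<Rightarrow> bool" where
  "forks L M n A \<Sigma> \<longleftrightarrow> (\<exists>\<Delta>. finite \<Delta> \<and> \<Delta> \<subseteq> pfms L n (univ M) \<and>
     (\<forall>\<delta> \<in> \<Delta>. divides L M n A \<delta>) \<and>
     \<not> consistent M n (\<Sigma> \<union> {(Neg \<phi>, b) | \<phi> b. (\<phi>, b) \<in> \<Delta>}))"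

definition generated_by ::
    "('f, 'r, 'a) struct \<Rightarrow> nat \<Rightarrow> ('f, 'r, 'a) pfm set \<Rightarrow> 'a set \<Rightarrow>
     'i rel \<Rightarrow> ('i \<Rightarrow> 'a list) \<Rightarrow> bool" where
  "generated_by M n p A r a \<longleftrightarrow>
     (\<forall>i \<in> Field r. realizes M n (restrict_type p (A \<union> entries a (below r i))) (a i))"

definition Morley_seq ::
    "('f, 'r) lang \<Rightarrow> ('f, 'r, 'a) struct \<Rightarrow> nat \<Rightarrow> 'a set \<Rightarrow> 'i rel \<Rightarrow> ('i \<Rightarrow> 'a list) \<Rightarrow> bool" where
  "Morley_seq L M n A r a \<longleftrightarrow> is_seq M n r a \<and> indiscernible L M A r a \<and>
     (\<forall>i \<in> Field r. \<not> forks L M n A (tp L M (a i) (A \<union> entries a (below r i))))"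

definition invariant_type ::
    "('f, 'r) lang \<Rightarrow> ('f, 'r, 'a) struct \<Rightarrow> nat \<Rightarrow> 'a set \<Rightarrow> ('f, 'r, 'a) pfm set \<Rightarrow> bool" where
  "invariant_type L M n A p \<longleftrightarrow> (\<forall>\<sigma>. automorphism L M \<sigma> \<and> (\<forall>a \<in> A. \<sigma> a = a) \<longrightarrow>
     (\<forall>(\<phi>, b) \<in> pfms L n (univ M). (\<phi>, b) \<in> p \<longleftrightarrow> (\<phi>, map \<sigma> b) \<in> p))"

definition generically_stable ::
    "('f, 'r) lang \<Rightarrow> ('f, 'r, 'a) struct \<Rightarrow> nat \<Rightarrow> 'a set \<Rightarrow> ('f, 'r, 'a) pfm set \<Rightarrow> bool" where
  "generically_stable L M n A p \<longleftrightarrow> invariant_type L M n A p \<and>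
     (\<forall>(r :: 'a list rel) a. Well_order r \<and> Morley_seq L M n A r a \<and> generated_by M n p A r a \<longrightarrow>
        (\<forall>(\<phi>, c) \<in> pfms L n (univ M).
           finite {i \<in> Field r. holds M \<phi> (a i @ c)} \<or>
           finite {i \<in> Field r. \<not> holds M \<phi> (a i @ c)}))"


section \<open>The independence property and dp-rank\<close>

text \<open>
  In the formula \<open>\<phi>(x, y)\<close> the \<open>m\<close> variables \<open>y\<close> are listed first, so that \<open>\<phi>(a, y)\<close> is the
  pair \<open>(\<phi>, a)\<close>. The model \<open>M\<close> must be a monster model in which the parameters of
  the partial type \<open>\<Sigma>\<close> form a small set; for a global type it is an extension of the ambient
  monster model. The same applies to \<open>dpr_less\<close>.
\<close>

definition has_IP ::
    "('f, 'r) lang \<Rightarrow> ('f, 'r, 'a) struct \<Rightarrow> nat \<Rightarrow> ('f, 'r, 'a) pfm set \<Rightarrow> bool" where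
  "has_IP L M n \<Sigma> \<longleftrightarrow> (\<exists>m. \<exists>\<phi> \<in> fms L (m + n). \<exists>a :: nat \<Rightarrow> 'a list.
     (\<forall>i. realizes M n \<Sigma> (a i)) \<and>
     (\<forall>s. consistent M m (range (\<lambda>i. (if i \<in> s then \<phi> else Neg \<phi>, a i)))))"

definition NIP ::
    "('f, 'r) lang \<Rightarrow> ('f, 'r, 'a) struct \<Rightarrow> nat \<Rightarrow> ('f, 'r, 'a) pfm set \<Rightarrow> bool" where
  "NIP L M n \<Sigma> \<longleftrightarrow> \<not> has_IP L M n \<Sigma>"

text \<open>
  \<open>dpr_less L M n B \<Sigma> \<kappa>\<close> says \<open>dpr(\<Sigma>) < \<kappa>\<close>, for a partial type \<open>\<Sigma>\<close> over the set \<open>B\<close>. The sequences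
  in a family may consist of tuples of different lengths.
\<close>

definition dpr_less ::
    "('f, 'r) lang \<Rightarrow> ('f, 'r, 'a) struct \<Rightarrow> nat \<Rightarrow> 'a set \<Rightarrow> ('f, 'r, 'a) pfm set \<Rightarrow>
     'k rel \<Rightarrow> bool" where
  "dpr_less L M n B \<Sigma> \<kappa> \<longleftrightarrow>
     (\<forall>(m :: 'k \<Rightarrow> nat) (r :: 'k \<Rightarrow> 'a list rel) I.
        (\<forall>\<alpha> \<in> Field \<kappa>. is_seq M (m \<alpha>) (r \<alpha>) (I \<alpha>) \<and> infinite (Field (r \<alpha>))) \<and>
        mutually_indiscernible L M B (Field \<kappa>) r I \<longrightarrow>
        (\<forall>b. realizes M n \<Sigma> b \<longrightarrow>
           (\<exists>\<beta> \<in> Field \<kappa>. indiscernible L M (B \<union> set b) (r \<beta>) (I \<beta>))))"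

end

theory Submission
  imports Defs "HOL-Library.Ramsey" "HOL-Library.Countable_Set"
begin

text \<open>
  Generic stability enters through the sequences that \<open>p\<close> generates over \<open>A\<close>: a formula with
  arbitrary parameters that holds at infinitely many members of such a sequence of order type
  \<open>\<omega>\<close> belongs to \<open>p\<close> (\<open>average\<close>). As usual this makes independence between realizations
  of \<open>p\<close> symmetric (\<open>generic_symmetric\<close>). The heart of the proof is \<open>covered_by_conjugates\<close>:
  if \<open>\<theta>(x, d)\<close> belongs to \<open>p\<close>, then finitely many conjugates of \<open>\<theta>(x, d)\<close> over \<open>A\<close> cover all
  realizations of \<open>p\<close> restricted to \<open>A\<close>. Otherwise one could choose realizations
  \<open>b\<^sub>0, b\<^sub>1, \<dots>\<close> of \<open>p\<close>, each over \<open>A\<close> and its predecessors, that all violate \<open>\<theta>(x, d)\<close>; that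
  the construction never gets stuck is \<open>covers_without_generic\<close>. So, up to finitely many cases and
  an automorphism over \<open>A\<close>, a realization of the restriction to \<open>A\<close> realizes any given finite
  part of \<open>p\<close>.

  Suppose that a sequence of realizations of the restriction is shattered by a formula. By the
  pigeonhole principle infinitely many members satisfy the same conjugate of \<open>\<theta>(x, d)\<close>, and
  moving them by an automorphism yields a shattered sequence of realizations of \<open>\<theta>(x, d)\<close>. By
  compactness in the larger monster model \<open>p\<close> has IP. Hence the restriction is NIP
  (\<open>NIP_restrict\<close>).

  For a cardinal \<open>\<kappa>\<close> greater than the number of formulas, NIP alone bounds both dp-ranks
  (\<open>dpr_less_of_NIP\<close>). For the other \<open>\<kappa>\<close> a family of sequences that shows that a dp-rank is at
  least \<open>\<kappa>\<close> may be taken to be small. Given such a family for \<open>p\<close>, in the larger monster model, one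
  appends to each sequence the finitely many parameters that its failure of indiscernibility over \<open>b\<close>
  involves and realizes the type over \<open>A\<close> of the result in \<open>C\<close> (\<open>not_dpr_less_restrict\<close>).

  The converse, \<open>not_dpr_less_extension\<close>, has to produce sequences that are mutually indiscernible
  over all of \<open>C\<close> together with a realization of \<open>p\<close>. By compactness it suffices to realize one
  formula \<open>\<theta>(x, d)\<close> of \<open>p\<close> and finitely many instances of indiscernibility, whose parameters may be
  assumed to occur in \<open>d\<close>. Let \<open>d\<^sub>1, \<dots>, d\<^sub>k\<close> be conjugates of \<open>d\<close> that cover. Ramsey's theorem
  gives finite subsequences that satisfy these instances with each \<open>d\<^sub>j\<close> in place of \<open>d\<close>. By mutual
  indiscernibility they are conjugate over \<open>A\<close> to the subsequences that were given; the same
  automorphism takes \<open>b\<close> to a realization of some \<open>\<theta>(x, d\<^sub>j)\<close>, and it remains to move \<open>d\<^sub>j\<close> back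
  to \<open>d\<close> (\<open>finite_part_realized\<close>).
\<close>

section \<open>Definable predicates\<close>

fun rename_tm :: "(nat \<Rightarrow> nat) \<Rightarrow> 'f tm \<Rightarrow> 'f tm" where
  "rename_tm f (Var x) = Var (f x)"
| "rename_tm f (Fn g ts) = Fn g (map (rename_tm f) ts)"

text \<open>
  Bound variables are renamed along with the free ones; this is harmless when \<open>f\<close> is injective.
\<close>

primrec rename :: "(nat \<Rightarrow> nat) \<Rightarrow> ('f, 'r) fm \<Rightarrow> ('f, 'r) fm" where
  "rename f (Eq s t) = Eq (rename_tm f s) (rename_tm f t)"
| "rename f (Rel R ts) = Rel R (map (rename_tm f) ts)"
| "rename f (Neg \<phi>) = Neg (rename f \<phi>)"
| "rename f (And \<phi> \<psi>) = And (rename f \<phi>) (rename f \<psi>)"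
| "rename f (Ex x \<phi>) = Ex (f x) (rename f \<phi>)"

lemma eval_rename: "eval M e (rename_tm f t) = eval M (e \<circ> f) t"
  by (induction t) (auto intro!: arg_cong[of _ _ "fn_int M _"])

lemma sat_rename: "inj f \<Longrightarrow> sat M e (rename f \<phi>) = sat M (e \<circ> f) \<phi>"
proof (induction \<phi> arbitrary: e)
  case (Ex x \<phi>)
  have "e(f x := a) \<circ> f = (e \<circ> f)(x := a)" for a
    using Ex.prems by (auto simp: fun_eq_iff inj_eq)
  then show ?case
    using Ex.IH[OF Ex.prems] by (simp only: sat.simps rename.simps)
qed (auto simp: eval_rename comp_def)

lemma wf_rename_tm: "wf_tm L (rename_tm f t) = wf_tm L t"
  by (induction t) auto

lemma wf_rename: "wf_fm L (rename f \<phi>) = wf_fm L \<phi>"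
  by (induction \<phi>) (auto simp: wf_rename_tm)

lemma fv_rename_tm: "fv_tm (rename_tm f t) = f ` fv_tm t"
  by (induction t) auto

lemma fv_rename: "inj f \<Longrightarrow> fv (rename f \<phi>) = f ` fv \<phi>"
  by (induction \<phi>) (auto simp: fv_rename_tm inj_eq)

lemma eval_cong: "(\<And>x. x \<in> fv_tm t \<Longrightarrow> e x = e' x) \<Longrightarrow> eval M e t = eval M e' t"
proof (induction t)
  case (Fn g ts)
  then have "map (eval M e) ts = map (eval M e') ts" by auto
  then show ?case by (simp only: eval.simps)
qed simp

lemma sat_cong: "(\<And>x. x \<in> fv \<phi> \<Longrightarrow> e x = e' x) \<Longrightarrow> sat M e \<phi> = sat M e' \<phi>"
proof (induction \<phi> arbitrary: e e')
  case (Eq s t)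
  then show ?case using eval_cong[of s e e' M] eval_cong[of t e e' M] by simp
next
  case (Rel R ts)
  have "map (eval M e) ts = map (eval M e') ts"
    using Rel by (intro map_cong refl eval_cong) auto
  then show ?case by (simp only: sat.simps)
next
  case (And \<phi> \<psi>)
  have "sat M e \<phi> = sat M e' \<phi>" "sat M e \<psi> = sat M e' \<psi>"
    by (rule And.IH; use And.prems in auto)+
  then show ?case by simp
next
  case (Ex x \<phi>)
  have "sat M (e(x := a)) \<phi> = sat M (e'(x := a)) \<phi>" for a
    using Ex.prems by (intro Ex.IH) auto
  then show ?case by simp
next
  case (Neg \<phi>)
  have "sat M e \<phi> = sat M e' \<phi>"
    by (rule Neg.IH) (use Neg.prems in auto)
  then show ?case by simp
qed

lemma holds_sat:
  assumes "\<phi> \<in> fms L (length as)" "\<And>i. i < length as \<Longrightarrow> e i = as ! i"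
  shows "holds M \<phi> as = sat M e \<phi>"
  unfolding holds_def using assms by (intro sat_cong) (auto simp: fms_def)

fun exs :: "nat \<Rightarrow> nat \<Rightarrow> ('f, 'r) fm \<Rightarrow> ('f, 'r) fm" where
  "exs N 0 \<phi> = \<phi>"
| "exs N (Suc k) \<phi> = Ex N (exs (Suc N) k \<phi>)"

lemma tuples_Suc: "ys \<in> tuples M (Suc k) \<longleftrightarrow> (\<exists>a zs. ys = a # zs \<and> a \<in> univ M \<and> zs \<in> tuples M k)"
  by (cases ys) (auto simp: tuples_def)

lemma sat_exs:
  "sat M e (exs N k \<phi>) \<longleftrightarrow>
    (\<exists>ys \<in> tuples M k. sat M (\<lambda>i. if N \<le> i \<and> i < N + k then ys ! (i - N) else e i) \<phi>)"
proof (induction k arbitrary: e N)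
  case 0
  have "(\<lambda>i. if N \<le> i \<and> i < N + 0 then ys ! (i - N) else e i) = e" for ys
    by (auto simp: fun_eq_iff)
  moreover have "tuples M 0 = {[]}" by (auto simp: tuples_def)
  ultimately show ?case by simp
next
  case (Suc k)
  have *: "(\<lambda>i. if Suc N \<le> i \<and> i < Suc N + k then ys ! (i - Suc N) else (e(N := a)) i)
     = (\<lambda>i. if N \<le> i \<and> i < N + Suc k then (a # ys) ! (i - N) else e i)" for a ys
  proof
    fix i
    have "i < N \<or> i = N \<or> i = Suc N + (i - Suc N)" by linarith
    then consider "i < N" | "i = N" | j where "i = Suc N + j" by blast
    then show "(if Suc N \<le> i \<and> i < Suc N + k then ys ! (i - Suc N) else (e(N := a)) i)
      = (if N \<le> i \<and> i < N + Suc k then (a # ys) ! (i - N) else e i)"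
      by cases (auto simp: Suc_diff_le)
  qed
  show ?case
  proof -
    have "sat M e (exs N (Suc k) \<phi>) \<longleftrightarrow> (\<exists>a \<in> univ M. \<exists>ys \<in> tuples M k.
        sat M (\<lambda>i. if N \<le> i \<and> i < N + Suc k then (a # ys) ! (i - N) else e i) \<phi>)"
      by (simp only: exs.simps sat.simps Suc.IH *)
    also have "\<dots> \<longleftrightarrow> (\<exists>ys \<in> tuples M (Suc k).
        sat M (\<lambda>i. if N \<le> i \<and> i < N + Suc k then ys ! (i - N) else e i) \<phi>)"
    proof -
      have "(\<exists>a \<in> univ M. \<exists>ys \<in> tuples M k. P (a # ys)) \<longleftrightarrow> (\<exists>ys \<in> tuples M (Suc k). P ys)" for P
        unfolding tuples_Suc Bex_def by blast
      then show ?thesis by (rule trans[rotated]) (rule refl)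
    qed
    finally show ?thesis .
  qed
qed

lemma fv_exs: "fv (exs N k \<phi>) = fv \<phi> - {N..<N + k}"
  by (induction k arbitrary: N) auto

lemma wf_exs: "wf_fm L (exs N k \<phi>) = wf_fm L \<phi>"
  by (induction k arbitrary: N) auto

lemma Ex_fms_exists_tuple:
  assumes "\<phi> \<in> fms L (N + m)"
  shows "\<exists>\<psi> \<in> fms L N. \<forall>(M :: ('f, 'r, 'a) struct) as. as \<in> tuples M N \<longrightarrow>
    (holds M \<psi> as \<longleftrightarrow> (\<exists>ys \<in> tuples M m. holds M \<phi> (as @ ys)))"
proof (intro bexI allI impI)
  show "exs N m \<phi> \<in> fms L N"
    using assms by (auto simp: fms_def fv_exs wf_exs)
  fix M :: "('f, 'r, 'a) struct" and as
  assume as: "as \<in> tuples M N"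
  have "holds M \<phi> (as @ ys) \<longleftrightarrow>
      sat M (\<lambda>i. if N \<le> i \<and> i < N + m then ys ! (i - N) else as ! i) \<phi>" if "ys \<in> tuples M m" for ys
    using assms as that by (intro holds_sat) (auto simp: tuples_def nth_append)
  then show "holds M (exs N m \<phi>) as \<longleftrightarrow> (\<exists>ys \<in> tuples M m. holds M \<phi> (as @ ys))"
    by (auto simp: holds_def[of M "exs N m \<phi>"] sat_exs)
qed

lemma sat_conjs: "sat M e (foldr And \<phi>s \<psi>) \<longleftrightarrow> (\<forall>\<phi> \<in> set \<phi>s. sat M e \<phi>) \<and> sat M e \<psi>"
  by (induction \<phi>s) auto

lemma fv_conjs: "fv (foldr And \<phi>s \<psi>) = (\<Union>\<phi> \<in> set \<phi>s. fv \<phi>) \<union> fv \<psi>"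
  by (induction \<phi>s) auto

lemma wf_conjs: "wf_fm L (foldr And \<phi>s \<psi>) \<longleftrightarrow> (\<forall>\<phi> \<in> set \<phi>s. wf_fm L \<phi>) \<and> wf_fm L \<psi>"
  by (induction \<phi>s) auto

text \<open>
  Naive substitution would risk capture. Instead the formula is moved by an injective renaming
  to variables beyond \<open>N\<close>, and these are then existentially quantified and tied by equations
  to the variables that they should be.
\<close>

lemma Ex_fms_reindex:
  assumes "\<phi> \<in> fms L (length ks)" "set ks \<subseteq> {..<N}"
  shows "\<exists>\<psi> \<in> fms L N. \<forall>(M :: ('f, 'r, 'a) struct) as. as \<in> tuples M N \<longrightarrow>
    (holds M \<psi> as \<longleftrightarrow> holds M \<phi> (map ((!) as) ks))"
proof -
  define k where "k = length ks"
  define \<psi> where "\<psi> = foldr And (map (\<lambda>j. Eq (Var (N + j)) (Var (ks ! j))) [0..<k]) (rename ((+) N) \<phi>)"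
  have wf: "wf_fm L \<psi>"
    using assms by (auto simp: \<psi>_def wf_conjs wf_rename fms_def)
  have "fv (rename ((+) N) \<phi>) \<subseteq> {..<N + k}"
    using assms by (auto simp: fv_rename fms_def k_def)
  moreover have "ks ! j < N" if "j < k" for j
    using that assms nth_mem[of j ks] unfolding k_def by blast
  ultimately have fv: "fv \<psi> \<subseteq> {..<N + k}"
    by (fastforce simp: \<psi>_def fv_conjs)
  then obtain \<chi> where \<chi>: "\<chi> \<in> fms L N" and
    holds: "\<And>(M :: ('f, 'r, 'a) struct) as. as \<in> tuples M N \<Longrightarrow>
      holds M \<chi> as \<longleftrightarrow> (\<exists>ys \<in> tuples M k. holds M \<psi> (as @ ys))"
    using Ex_fms_exists_tuple[of \<psi> L N k] wf unfolding fms_def by blast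
  have "holds M \<chi> as \<longleftrightarrow> holds M \<phi> (map ((!) as) ks)"
    if as: "as \<in> tuples M N" for M :: "('f, 'r, 'a) struct" and as
  proof -
    have *: "holds M \<psi> (as @ ys) \<longleftrightarrow> ys = map ((!) as) ks \<and> holds M \<phi> ys"
      if ys: "ys \<in> tuples M k" for ys
    proof -
      have "(\<forall>j<k. (as @ ys) ! (N + j) = (as @ ys) ! (ks ! j)) \<longleftrightarrow> ys = map ((!) as) ks"
        using as ys assms(2) unfolding list_eq_iff_nth_eq
        by (auto simp: tuples_def nth_append k_def subset_eq)
      moreover have "sat M (\<lambda>i. (as @ ys) ! i) (rename ((+) N) \<phi>) \<longleftrightarrow> holds M \<phi> ys"
        using as ys assms(1) unfolding sat_rename[OF inj_on_add]
        by (intro holds_sat[symmetric]) (auto simp: tuples_def nth_append k_def)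
      ultimately show ?thesis
        unfolding holds_def[of M \<psi>] by (auto simp: \<psi>_def sat_conjs)
    qed
    have "map ((!) as) ks \<in> tuples M k"
      using as assms(2) by (fastforce simp: tuples_def k_def)
    with * show ?thesis
      unfolding holds[OF as] by blast
  qed
  with \<chi> show ?thesis by blast
qed

text \<open>
  The variables are drawn from an arbitrary set \<open>V\<close>, so that one notion serves for tuples,
  families of sequences, and parameters, which are variables whose value is prescribed. A defining
  formula is uniform in the structure; this is what transfers existential statements between a
  structure and its elementary extensions.
\<close>

definition definable ::
    "('f, 'r) lang \<Rightarrow> 'v set \<Rightarrow> (('f, 'r, 'a) struct \<Rightarrow> ('v \<Rightarrow> 'a) \<Rightarrow> bool) \<Rightarrow> bool" where
  "definable L V P \<longleftrightarrow> (\<exists>\<phi> zs. set zs \<subseteq> V \<and> \<phi> \<in> fms L (length zs) \<and>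
     (\<forall>M e. e ` V \<subseteq> univ M \<and> is_struct L M \<longrightarrow> (P M e \<longleftrightarrow> holds M \<phi> (map e zs))))"

lemma definableE:
  assumes "definable L V P"
  obtains \<phi> zs where "set zs \<subseteq> V" "\<phi> \<in> fms L (length zs)"
    "\<And>M e. e ` V \<subseteq> univ M \<Longrightarrow> is_struct L M \<Longrightarrow> P M e \<longleftrightarrow> holds M \<phi> (map e zs)"
  using assms unfolding definable_def by blast

lemma fms_recode:
  assumes "\<phi> \<in> fms L (length zs)" "set zs \<subseteq> set ws"
  shows "\<exists>\<psi> \<in> fms L (length ws). \<forall>(M :: ('f, 'r, 'a) struct) e. e ` set ws \<subseteq> univ M \<longrightarrow>
    (holds M \<psi> (map e ws) \<longleftrightarrow> holds M \<phi> (map e zs))"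
proof -
  have "\<forall>z \<in> set zs. \<exists>k. k < length ws \<and> ws ! k = z"
    using assms(2) by (auto simp: in_set_conv_nth subset_eq)
  then obtain k where k: "\<And>z. z \<in> set zs \<Longrightarrow> k z < length ws \<and> ws ! k z = z"
    by metis
  obtain \<psi> where "\<psi> \<in> fms L (length ws)" and
    *: "\<And>(M :: ('f, 'r, 'a) struct) as. as \<in> tuples M (length ws) \<Longrightarrow>
      holds M \<psi> as \<longleftrightarrow> holds M \<phi> (map ((!) as) (map k zs))"
    using Ex_fms_reindex[of \<phi> L "map k zs" "length ws"] assms(1) k by auto
  moreover have "map ((!) (map e ws)) (map k zs) = map e zs" for e :: "_ \<Rightarrow> 'a"
    using k by auto
  moreover have "map e ws \<in> tuples M (length ws)"
    if "e ` set ws \<subseteq> univ M" for e and M :: "('f, 'r, 'a) struct"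
    using that by (auto simp: tuples_def)
  ultimately show ?thesis by metis
qed

lemma definable_holds:
  "\<phi> \<in> fms L (length zs) \<Longrightarrow> set zs \<subseteq> V \<Longrightarrow> definable L V (\<lambda>M e. holds M \<phi> (map e zs))"
  unfolding definable_def by blast

lemma definable_cong:
  assumes "definable L V P"
    and "\<And>M e. e ` V \<subseteq> univ M \<Longrightarrow> is_struct L M \<Longrightarrow> P M e = Q M e"
  shows "definable L V Q"
  using assms unfolding definable_def by metis

lemma definable_not: "definable L V P \<Longrightarrow> definable L V (\<lambda>M e. \<not> P M e)"
proof (erule definableE)
  fix \<phi> zs
  assume "set zs \<subseteq> V" "\<phi> \<in> fms L (length zs)"
    and eq: "\<And>M e. e ` V \<subseteq> univ M \<Longrightarrow> is_struct L M \<Longrightarrow> P M e \<longleftrightarrow> holds M \<phi> (map e zs)"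
  then have "definable L V (\<lambda>M e. holds M (Neg \<phi>) (map e zs))"
    by (intro definable_holds) (auto simp: fms_def)
  then show ?thesis
    by (rule definable_cong) (simp add: eq holds_def)
qed

lemma definable_and:
  assumes "definable L V P" "definable L V Q"
  shows "definable L V (\<lambda>M e. P M e \<and> Q M e)"
proof -
  obtain \<phi> zs where \<phi>: "set zs \<subseteq> V" "\<phi> \<in> fms L (length zs)"
    and P: "\<And>M e. e ` V \<subseteq> univ M \<Longrightarrow> is_struct L M \<Longrightarrow> P M e \<longleftrightarrow> holds M \<phi> (map e zs)"
    using assms(1) by (rule definableE) (rule that)
  obtain \<psi> ws where \<psi>: "set ws \<subseteq> V" "\<psi> \<in> fms L (length ws)"
    and Q: "\<And>M e. e ` V \<subseteq> univ M \<Longrightarrow> is_struct L M \<Longrightarrow> Q M e \<longleftrightarrow> holds M \<psi> (map e ws)"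
    using assms(2) by (rule definableE) (rule that)
  obtain \<phi>' where \<phi>': "\<phi>' \<in> fms L (length (zs @ ws))"
    "\<And>(M :: ('a, 'b, 'd) struct) e. e ` set (zs @ ws) \<subseteq> univ M \<Longrightarrow>
      holds M \<phi>' (map e (zs @ ws)) \<longleftrightarrow> holds M \<phi> (map e zs)"
    using fms_recode[of \<phi> L zs "zs @ ws"] \<phi> by auto
  obtain \<psi>' where \<psi>': "\<psi>' \<in> fms L (length (zs @ ws))"
    "\<And>(M :: ('a, 'b, 'd) struct) e. e ` set (zs @ ws) \<subseteq> univ M \<Longrightarrow>
      holds M \<psi>' (map e (zs @ ws)) \<longleftrightarrow> holds M \<psi> (map e ws)"
    using fms_recode[of \<psi> L ws "zs @ ws"] \<psi> by auto
  have "definable L V (\<lambda>M e. holds M (And \<phi>' \<psi>') (map e (zs @ ws)))"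
    using \<phi> \<psi> \<phi>' \<psi>' by (intro definable_holds) (auto simp: fms_def)
  then show ?thesis
  proof (rule definable_cong)
    fix M :: "('a, 'b, 'd) struct" and e
    assume e: "e ` V \<subseteq> univ M" "is_struct L M"
    then have "e ` set (zs @ ws) \<subseteq> univ M"
      using \<phi>(1) \<psi>(1) by auto
    with e show "holds M (And \<phi>' \<psi>') (map e (zs @ ws)) \<longleftrightarrow> P M e \<and> Q M e"
      using \<phi>'(2) \<psi>'(2) P Q by (simp add: holds_def)
  qed
qed

lemma definable_True: "definable L V (\<lambda>M e. True)"
proof -
  have "definable L V (\<lambda>M e. holds M (Ex 0 (Eq (Var 0) (Var 0))) (map e []))"
    by (intro definable_holds) (auto simp: fms_def)
  then show ?thesis
    by (rule definable_cong) (auto simp: holds_def is_struct_def)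
qed

lemma definable_Ball:
  assumes "finite I" "\<And>i. i \<in> I \<Longrightarrow> definable L V (P i)"
  shows "definable L V (\<lambda>M e. \<forall>i \<in> I. P i M e)"
  using assms by (induction I) (auto simp: definable_True intro: definable_and)

lemma definable_iff:
  assumes "definable L V P" "definable L V Q"
  shows "definable L V (\<lambda>M e. P M e \<longleftrightarrow> Q M e)"
proof -
  have "definable L V (\<lambda>M e. \<not> (P M e \<and> \<not> Q M e) \<and> \<not> (Q M e \<and> \<not> P M e))"
    using assms by (intro definable_and definable_not)
  then show ?thesis by (rule definable_cong) auto
qed

text \<open>
  The quantified tuple is a block of variables of its own, the right summand of the index type. Its
  length is fixed, so the quantifier is a finite string of first-order quantifiers.
\<close>

lemma definable_exists_tuple:
  assumes "definable L (V <+> {..<m}) P"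
  shows "definable L V (\<lambda>M e. \<exists>y \<in> tuples M m. P M (case_sum e ((!) y)))"
proof -
  obtain \<phi> zs where \<phi>: "set zs \<subseteq> V <+> {..<m}" "\<phi> \<in> fms L (length zs)"
    and P: "\<And>M e. e ` (V <+> {..<m}) \<subseteq> univ M \<Longrightarrow> is_struct L M \<Longrightarrow> P M e \<longleftrightarrow> holds M \<phi> (map e zs)"
    using assms by (rule definableE) (rule that)
  define ws where "ws = concat (map (case_sum (\<lambda>v. [v]) (\<lambda>_. [])) zs)"
  have ws: "set ws \<subseteq> V"
    using \<phi>(1) by (fastforce simp: ws_def split: sum.splits)
  have "x \<in> Inl ` set ws \<union> Inr ` {..<m}" if "x \<in> set zs" for x
    using that \<phi>(1) by (cases x) (force simp: ws_def)+
  then have "set zs \<subseteq> set (map Inl ws @ map Inr [0..<m])"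
    by (auto simp: atLeast0LessThan)
  then obtain \<psi> where \<psi>: "\<psi> \<in> fms L (length ws + m)"
    "\<And>(M :: ('a, 'b, 'd) struct) e. e ` set (map Inl ws @ map Inr [0..<m]) \<subseteq> univ M \<Longrightarrow>
      holds M \<psi> (map e (map Inl ws @ map Inr [0..<m])) \<longleftrightarrow> holds M \<phi> (map e zs)"
    using fms_recode[of \<phi> L zs "map Inl ws @ map Inr [0..<m]"] \<phi>(2) by auto
  obtain \<chi> where \<chi>: "\<chi> \<in> fms L (length ws)" "\<And>(M :: ('a, 'b, 'd) struct) as. as \<in> tuples M (length ws) \<Longrightarrow>
      holds M \<chi> as \<longleftrightarrow> (\<exists>ys \<in> tuples M m. holds M \<psi> (as @ ys))"
    using Ex_fms_exists_tuple[OF \<psi>(1)] by blast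
  have "definable L V (\<lambda>M e. holds M \<chi> (map e ws))"
    using \<chi>(1) ws by (rule definable_holds)
  then show ?thesis
  proof (rule definable_cong)
    fix M :: "('a, 'b, 'd) struct" and e
    assume e: "e ` V \<subseteq> univ M" "is_struct L M"
    have "holds M \<psi> (map e ws @ ys) \<longleftrightarrow> P M (case_sum e ((!) ys))" if ys: "ys \<in> tuples M m" for ys
    proof -
      have im: "case_sum e ((!) ys) ` (V <+> {..<m}) \<subseteq> univ M"
        using e(1) ys by (force simp: tuples_def)
      have "map (case_sum e ((!) ys)) (map Inl ws @ map Inr [0..<m]) = map e ws @ ys"
        using ys by (auto simp: tuples_def comp_def map_nth)
      moreover have "set (map Inl ws @ map Inr [0..<m]) \<subseteq> V <+> {..<m}"
        using ws by auto
      ultimately show ?thesis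
        using \<psi>(2)[of "case_sum e ((!) ys)" M] P[OF im e(2)] im by (smt (verit) image_mono order_trans)
    qed
    moreover have "map e ws \<in> tuples M (length ws)"
      using e ws by (auto simp: tuples_def)
    ultimately show "holds M \<chi> (map e ws) \<longleftrightarrow> (\<exists>y \<in> tuples M m. P M (case_sum e ((!) y)))"
      using \<chi>(2) by blast
  qed
qed

text \<open>
  A predicate of a tuple and of further variables is turned into a formula with parameters, in the
  format that types use.
\<close>

lemma definable_prefixE:
  assumes "definable L ({..<n} <+> V) P"
  obtains \<phi> zs where "set zs \<subseteq> V" "\<phi> \<in> fms L (n + length zs)"
    "\<And>M x e. e ` V \<subseteq> univ M \<Longrightarrow> is_struct L M \<Longrightarrow> x \<in> tuples M n \<Longrightarrow>
       P M (case_sum ((!) x) e) \<longleftrightarrow> holds M \<phi> (x @ map e zs)"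
proof -
  obtain \<phi> zs where \<phi>: "set zs \<subseteq> {..<n} <+> V" "\<phi> \<in> fms L (length zs)"
    and P: "\<And>M e. e ` ({..<n} <+> V) \<subseteq> univ M \<Longrightarrow> is_struct L M \<Longrightarrow> P M e \<longleftrightarrow> holds M \<phi> (map e zs)"
    using assms by (rule definableE) (rule that)
  define ws where "ws = concat (map (case_sum (\<lambda>_. []) (\<lambda>v. [v])) zs)"
  have ws: "set ws \<subseteq> V"
    using \<phi>(1) by (fastforce simp: ws_def split: sum.splits)
  have "x \<in> Inr ` set ws \<union> Inl ` {..<n}" if "x \<in> set zs" for x
    using that \<phi>(1) by (cases x) (force simp: ws_def)+
  then have "set zs \<subseteq> set (map Inl [0..<n] @ map Inr ws)"
    by (auto simp: atLeast0LessThan)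
  then obtain \<psi> where \<psi>: "\<psi> \<in> fms L (n + length ws)"
    "\<And>(M :: ('a, 'b, 'd) struct) e. e ` set (map Inl [0..<n] @ map Inr ws) \<subseteq> univ M \<Longrightarrow>
      holds M \<psi> (map e (map Inl [0..<n] @ map Inr ws)) \<longleftrightarrow> holds M \<phi> (map e zs)"
    using fms_recode[of \<phi> L zs "map Inl [0..<n] @ map Inr ws"] \<phi>(2) by auto
  show thesis
  proof (rule that[OF ws \<psi>(1)])
    fix M :: "('a, 'b, 'd) struct" and x e
    assume e: "e ` V \<subseteq> univ M" "is_struct L M" and x: "x \<in> tuples M n"
    have im: "case_sum ((!) x) e ` ({..<n} <+> V) \<subseteq> univ M"
      using e(1) x by (force simp: tuples_def)
    have "map (case_sum ((!) x) e) (map Inl [0..<n] @ map Inr ws) = x @ map e ws"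
      using x by (auto simp: tuples_def comp_def map_nth)
    moreover have "set (map Inl [0..<n] @ map Inr ws) \<subseteq> {..<n} <+> V"
      using ws by auto
    ultimately show "P M (case_sum ((!) x) e) \<longleftrightarrow> holds M \<psi> (x @ map e ws)"
      using \<psi>(2)[of "case_sum ((!) x) e" M] P[OF im e(2)] im by (smt (verit) image_mono order_trans)
  qed
qed

section \<open>Compactness in saturated structures\<close>

text \<open>
  By Zorn's lemma there is a maximal family with the finite intersection property, and maximality
  decides every set.
\<close>

lemma ultrafilter_extending:
  assumes fip: "\<And>\<F>. finite \<F> \<Longrightarrow> \<F> \<subseteq> \<B> \<Longrightarrow> \<Inter> \<F> \<noteq> {}"
  obtains \<U> where "\<B> \<subseteq> \<U>" "\<And>\<F>. finite \<F> \<Longrightarrow> \<F> \<subseteq> \<U> \<Longrightarrow> \<Inter> \<F> \<noteq> {}" "\<And>X. X \<in> \<U> \<or> - X \<in> \<U>"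
proof -
  define \<A> where "\<A> = {\<U>. \<B> \<subseteq> \<U> \<and> (\<forall>\<F>. finite \<F> \<and> \<F> \<subseteq> \<U> \<longrightarrow> \<Inter> \<F> \<noteq> {})}"
  have "\<exists>\<U>\<in>\<A>. \<forall>X\<in>\<A>. \<U> \<subseteq> X \<longrightarrow> X = \<U>"
  proof (rule subset_Zorn_nonempty)
    show "\<A> \<noteq> {}"
      using fip by (auto simp: \<A>_def)
    fix \<C>
    assume C: "\<C> \<noteq> {}" "subset.chain \<A> \<C>"
    have "\<Inter> \<F> \<noteq> {}" if F: "finite \<F>" "\<F> \<subseteq> \<Union> \<C>" for \<F>
    proof -
      obtain \<U> where "\<U> \<in> \<C>" "\<F> \<subseteq> \<U>"
        by (rule finite_subset_Union_chain[OF F C])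
      moreover have "\<U> \<in> \<A>"
        using C(2) \<open>\<U> \<in> \<C>\<close> unfolding subset_chain_def by blast
      ultimately show ?thesis
        using F(1) unfolding \<A>_def by blast
    qed
    moreover have "\<B> \<subseteq> \<Union> \<C>"
      using C unfolding \<A>_def subset_chain_def by blast
    ultimately show "\<Union> \<C> \<in> \<A>"
      unfolding \<A>_def by simp
  qed
  then obtain \<U> where U: "\<U> \<in> \<A>" and max: "\<And>X. X \<in> \<A> \<Longrightarrow> \<U> \<subseteq> X \<Longrightarrow> X = \<U>"
    by blast
  have ex: "\<exists>\<F>. finite \<F> \<and> \<F> \<subseteq> \<U> \<and> \<Inter> \<F> \<inter> X = {}" if "X \<notin> \<U>" for X
  proof (rule ccontr)
    assume none: "\<nexists>\<F>. finite \<F> \<and> \<F> \<subseteq> \<U> \<and> \<Inter> \<F> \<inter> X = {}"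
    have "\<Inter> \<F> \<noteq> {}" if "finite \<F>" "\<F> \<subseteq> insert X \<U>" for \<F>
    proof -
      have "finite (\<F> - {X})" "\<F> - {X} \<subseteq> \<U>" using that by auto
      with none have "\<Inter> (\<F> - {X}) \<inter> X \<noteq> {}" by blast
      then show ?thesis by blast
    qed
    then have "insert X \<U> \<in> \<A>"
      using U by (auto simp: \<A>_def)
    with max[of "insert X \<U>"] that show False by blast
  qed
  have "X \<in> \<U> \<or> - X \<in> \<U>" for X
  proof (rule ccontr)
    assume "\<not> ?thesis"
    then obtain \<F> \<F>' where "finite \<F>" "\<F> \<subseteq> \<U>" "\<Inter> \<F> \<inter> X = {}" "finite \<F>'" "\<F>' \<subseteq> \<U>" "\<Inter> \<F>' \<inter> - X = {}"
      using ex[of X] ex[of "- X"] by blast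
    then have "finite (\<F> \<union> \<F>')" "\<F> \<union> \<F>' \<subseteq> \<U>" "\<Inter> (\<F> \<union> \<F>') = {}" by blast+
    with U show False unfolding \<A>_def by blast
  qed
  with U that show thesis by (auto simp: \<A>_def)
qed

locale monster =
  fixes L :: "('f, 'r) lang" and T :: "('f, 'r) fm set" and \<mu> :: "'k rel"
    and M :: "('f, 'r, 'a) struct"
  assumes monster: "monster_model L T \<mu> M"
begin

lemma is_struct: "is_struct L M"
  and saturated: "saturated L \<mu> M"
  and homogeneous: "strongly_homogeneous L \<mu> M"
  and Card_order: "Card_order \<mu>"
  and formulas_small: "|{\<phi>. wf_fm L \<phi>}| <o \<mu>"
  using monster by (auto simp: monster_model_def is_model_def)

text \<open>
  Saturation provides realizations of complete types in finitely many variables. Here it yields values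
  for fewer than \<open>\<mu>\<close> variables at once, some of them prescribed. By finite satisfiability there is an
  ultrafilter on the assignments that contains the set of solutions of every condition. The values are
  then chosen one variable at a time, in such a way that every formula that is true for almost all
  assignments remains true of the chosen values.
\<close>

theorem compactness:
  fixes V W :: "'v set" and F :: "(('f, 'r, 'a) struct \<Rightarrow> ('v \<Rightarrow> 'a) \<Rightarrow> bool) set"
  assumes small: "|V| <o \<mu>" and W: "W \<subseteq> V" "w ` W \<subseteq> univ M"
    and def: "\<And>Q. Q \<in> F \<Longrightarrow> definable L V Q"
    and fin: "\<And>F0. finite F0 \<Longrightarrow> F0 \<subseteq> F \<Longrightarrow>
      \<exists>e. e ` V \<subseteq> univ M \<and> (\<forall>v \<in> W. e v = w v) \<and> (\<forall>Q \<in> F0. Q M e)"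
  shows "\<exists>e. e ` V \<subseteq> univ M \<and> (\<forall>v \<in> W. e v = w v) \<and> (\<forall>Q \<in> F. Q M e)"
proof -
  define S where "S = {e. e ` V \<subseteq> univ M \<and> (\<forall>v \<in> W. e v = w v)}"
  obtain \<U> where U: "insert S ((\<lambda>Q. {e. Q M e}) ` F) \<subseteq> \<U>"
    and fip: "\<And>\<F>. finite \<F> \<Longrightarrow> \<F> \<subseteq> \<U> \<Longrightarrow> \<Inter> \<F> \<noteq> {}" and ultra: "\<And>X. X \<in> \<U> \<or> - X \<in> \<U>"
  proof (rule ultrafilter_extending)
    fix \<F>
    assume F: "finite \<F>" "\<F> \<subseteq> insert S ((\<lambda>Q. {e. Q M e}) ` F)"
    then have "finite (\<F> - {S})" "\<F> - {S} \<subseteq> (\<lambda>Q. {e. Q M e}) ` F" by auto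
    then obtain F0 where F0: "F0 \<subseteq> F" "finite F0" "\<F> - {S} = (\<lambda>Q. {e. Q M e}) ` F0"
      by (meson finite_subset_image)
    have "\<exists>e. e \<in> S \<and> (\<forall>Q \<in> F0. Q M e)"
      unfolding S_def using fin[OF F0(2,1)] by simp
    then obtain e where "e \<in> S" "\<forall>Q \<in> F0. Q M e" by blast
    then have "e \<in> X" if "X \<in> \<F>" for X
      using F0(3) that by (cases "X = S") auto
    then show "\<Inter> \<F> \<noteq> {}" by blast
  qed (rule that)
  have SU: "S \<in> \<U>" using U by blast
  have upward: "Y \<in> \<U>" if "X \<in> \<U>" "X \<inter> S \<subseteq> Y" for X Y
    using fip[of "{X, S, - Y}"] ultra[of Y] that SU by auto
  have inhabited: "\<exists>e \<in> S. e \<in> X" if "X \<in> \<U>" for X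
    using fip[of "{X, S}"] that SU by auto
  have Int: "\<Inter> \<F> \<in> \<U>" if "finite \<F>" "\<F> \<subseteq> \<U>" for \<F>
    using fip[of "insert (- \<Inter> \<F>) \<F>"] ultra[of "\<Inter> \<F>"] that by auto
  \<comment> \<open>A partial assignment is a graph. It is kept true to the ultrafilter, which makes it a function.\<close>
  define \<G> where "\<G> = {G. (\<lambda>v. (v, w v)) ` W \<subseteq> G \<and> G \<subseteq> V \<times> univ M \<and>
    (\<forall>\<phi> gs. set gs \<subseteq> G \<and> \<phi> \<in> fms L (length gs) \<and> {e. holds M \<phi> (map (e \<circ> fst) gs)} \<in> \<U> \<longrightarrow>
       holds M \<phi> (map snd gs))}"
  have "\<exists>G\<in>\<G>. \<forall>X\<in>\<G>. G \<subseteq> X \<longrightarrow> X = G"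
  proof (rule subset_Zorn_nonempty)
    have "holds M \<phi> (map snd gs)" if gs: "set gs \<subseteq> (\<lambda>v. (v, w v)) ` W"
      and gsU: "{e. holds M \<phi> (map (e \<circ> fst) gs)} \<in> \<U>" for \<phi> gs
    proof -
      obtain e where e: "e \<in> S" "holds M \<phi> (map (e \<circ> fst) gs)"
        using inhabited[OF gsU] by blast
      have "map (e \<circ> fst) gs = map snd gs"
        using e(1) gs by (auto simp: S_def)
      with e show ?thesis by simp
    qed
    then have "(\<lambda>v. (v, w v)) ` W \<in> \<G>"
      using W by (auto simp: \<G>_def)
    then show "\<G> \<noteq> {}" by blast
    fix \<C>
    assume C: "\<C> \<noteq> {}" "subset.chain \<G> \<C>"
    have "holds M \<phi> (map snd gs)" if gs: "set gs \<subseteq> \<Union> \<C>" "\<phi> \<in> fms L (length gs)"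
      "{e. holds M \<phi> (map (e \<circ> fst) gs)} \<in> \<U>" for \<phi> gs
    proof -
      obtain G where G: "G \<in> \<C>" "set gs \<subseteq> G"
        by (rule finite_subset_Union_chain[OF finite_set gs(1) C])
      then have "G \<in> \<G>" using C by (auto simp: subset_chain_def)
      with G gs show ?thesis unfolding \<G>_def by blast
    qed
    moreover have sub: "(\<lambda>v. (v, w v)) ` W \<subseteq> G" "G \<subseteq> V \<times> univ M" if "G \<in> \<C>" for G
    proof -
      have "G \<in> \<G>" using that C(2) by (auto simp: subset_chain_def)
      then show "(\<lambda>v. (v, w v)) ` W \<subseteq> G" "G \<subseteq> V \<times> univ M"
        unfolding \<G>_def by blast+
    qed
    moreover have "(\<lambda>v. (v, w v)) ` W \<subseteq> \<Union> \<C>"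
      using C(1) sub(1) by (metis Union_upper equals0I subset_trans)
    moreover have "\<Union> \<C> \<subseteq> V \<times> univ M"
      using sub(2) by (rule Union_least)
    ultimately show "\<Union> \<C> \<in> \<G>"
      unfolding \<G>_def by blast
  qed
  then obtain G where G: "G \<in> \<G>" and max: "\<And>X. X \<in> \<G> \<Longrightarrow> G \<subseteq> X \<Longrightarrow> X = G"
    by blast
  have GV: "G \<subseteq> V \<times> univ M" and GW: "\<And>v. v \<in> W \<Longrightarrow> (v, w v) \<in> G"
    and Gtrue: "\<And>\<phi> gs. set gs \<subseteq> G \<Longrightarrow> \<phi> \<in> fms L (length gs) \<Longrightarrow>
      {e. holds M \<phi> (map (e \<circ> fst) gs)} \<in> \<U> \<Longrightarrow> holds M \<phi> (map snd gs)"
    using G unfolding \<G>_def by blast+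
  have fstG: "fst g \<in> V" and sndG: "snd g \<in> univ M" if "g \<in> G" for g
    using that GV by auto
  have functional: "a = b" if "(v, a) \<in> G" "(v, b) \<in> G" for v a b
  proof -
    have "holds M (Eq (Var 0) (Var 1)) (map snd [(v, a), (v, b)])"
    proof (rule Gtrue)
      show "{e. holds M (Eq (Var 0) (Var 1)) (map (e \<circ> fst) [(v, a), (v, b)])} \<in> \<U>"
        by (rule upward[OF SU]) (simp add: holds_def)
    qed (use that in \<open>auto simp: fms_def\<close>)
    then show ?thesis by (simp add: holds_def)
  qed
  have dom: "v \<in> Domain G" if v: "v \<in> V" for v
  proof (rule ccontr)
    assume "v \<notin> Domain G"
    define B where "B = snd ` G"
    \<comment> \<open>The type that the value at \<open>v\<close> has to realize over the values chosen so far.\<close>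
    define q where "q = {(\<phi>, map snd gs) | \<phi> gs. set gs \<subseteq> G \<and> \<phi> \<in> fms L (1 + length gs) \<and>
      {e. holds M \<phi> (e v # map (e \<circ> fst) gs)} \<in> \<U>}"
    have "inj_on fst G"
      using functional by (auto simp: inj_on_def)
    then have "|G| \<le>o |V|"
      using GV by (intro card_of_ordLeqI) auto
    then have "|B| <o \<mu>"
      using small card_of_image[of snd G] unfolding B_def by (meson ordLeq_ordLess_trans)
    moreover have "B \<subseteq> univ M"
      using GV by (auto simp: B_def)
    moreover have "q \<in> complete_types L M 1 B"
      unfolding complete_types_def
    proof (intro CollectI conjI ballI)
      show "q \<subseteq> pfms L 1 B"
        unfolding B_def by (force simp: q_def pfms_def)
      show "consistent M 1 q"
        unfolding consistent_def
      proof (intro allI impI)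
        fix q0
        assume "finite q0 \<and> q0 \<subseteq> q"
        moreover have "q = (\<lambda>(\<phi>, gs). (\<phi>, map snd gs)) ` {(\<phi>, gs). set gs \<subseteq> G \<and>
             \<phi> \<in> fms L (1 + length gs) \<and> {e. holds M \<phi> (e v # map (e \<circ> fst) gs)} \<in> \<U>}" (is "_ = ?f ` ?X")
          unfolding q_def by auto
        ultimately obtain P0 where "P0 \<subseteq> ?X" "finite P0" "q0 = ?f ` P0"
          by (meson finite_subset_image)
        then have P0: "finite P0" "q0 = (\<lambda>(\<phi>, gs). (\<phi>, map snd gs)) ` P0"
          "\<And>\<phi> gs. (\<phi>, gs) \<in> P0 \<Longrightarrow> set gs \<subseteq> G \<and> \<phi> \<in> fms L (1 + length gs) \<and>
            {e. holds M \<phi> (e v # map (e \<circ> fst) gs)} \<in> \<U>"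
          by auto
        define Q where "Q = (\<lambda>(M :: ('f, 'r, 'a) struct) (e :: _ \<Rightarrow> 'a). \<exists>y \<in> tuples M 1.
          \<forall>g \<in> P0. holds M (fst g) (map (case_sum e ((!) y)) (Inr 0 # map Inl (snd g))))"
        have "definable L G Q"
          unfolding Q_def
        proof (intro definable_exists_tuple definable_Ball P0(1) definable_holds)
          fix g
          assume "g \<in> P0"
          then have "set (snd g) \<subseteq> G" "fst g \<in> fms L (1 + length (snd g))"
            using P0(3)[of "fst g" "snd g"] by auto
          then show "fst g \<in> fms L (length (Inr 0 # map Inl (snd g)))"
            "set (Inr 0 # map Inl (snd g)) \<subseteq> G <+> {..<1 :: nat}"
            by auto
        qed
        then obtain \<psi> zs where \<psi>: "set zs \<subseteq> G" "\<psi> \<in> fms L (length zs)"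
          "\<And>e. e ` G \<subseteq> univ M \<Longrightarrow> Q M e \<longleftrightarrow> holds M \<psi> (map e zs)"
          using is_struct unfolding definable_def by blast
        have "{e. holds M \<psi> (map (e \<circ> fst) zs)} \<in> \<U>"
        proof (rule upward)
          show "\<Inter> ((\<lambda>(\<phi>, gs). {e. holds M \<phi> (e v # map (e \<circ> fst) gs)}) ` P0) \<in> \<U>"
            using P0 by (intro Int) auto
          show "\<Inter> ((\<lambda>(\<phi>, gs). {e. holds M \<phi> (e v # map (e \<circ> fst) gs)}) ` P0) \<inter> S
            \<subseteq> {e. holds M \<psi> (map (e \<circ> fst) zs)}"
          proof
            fix e
            assume e: "e \<in> \<Inter> ((\<lambda>(\<phi>, gs). {e. holds M \<phi> (e v # map (e \<circ> fst) gs)}) ` P0) \<inter> S"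
            then have im: "e ` V \<subseteq> univ M" by (simp add: S_def)
            have "Q M (e \<circ> fst)"
              unfolding Q_def
            proof (intro bexI ballI)
              show "[e v] \<in> tuples M 1"
                using im v by (auto simp: tuples_def)
              fix g
              assume "g \<in> P0"
              then show "holds M (fst g) (map (case_sum (e \<circ> fst) ((!) [e v])) (Inr 0 # map Inl (snd g)))"
                using e by (force simp: comp_def)
            qed
            moreover have "(e \<circ> fst) ` G \<subseteq> univ M"
              using im fstG by (auto simp: image_subset_iff)
            ultimately show "e \<in> {e. holds M \<psi> (map (e \<circ> fst) zs)}"
              using \<psi>(3) by blast
          qed
        qed
        then have "holds M \<psi> (map snd zs)"
          using \<psi> by (intro Gtrue)
        then have "Q M snd"
          using \<psi>(3)[of snd] sndG by blast
        then obtain y where y: "y \<in> tuples M 1"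
          "\<And>g. g \<in> P0 \<Longrightarrow> holds M (fst g) (map (case_sum snd ((!) y)) (Inr 0 # map Inl (snd g)))"
          unfolding Q_def by blast
        have "y = [y ! 0]"
          using y(1) by (cases y) (auto simp: tuples_def)
        then have "y @ map snd gs = map (case_sum snd ((!) y)) (Inr 0 # map Inl gs)" for gs :: "('v \<times> 'a) list"
          by (metis (no_types, lifting) append_Cons append_Nil comp_apply list.simps(9) map_eq_conv map_map old.sum.simps(5,6))
        with y have "realizes M 1 q0 y"
          by (fastforce simp: realizes_def P0(2))
        then show "\<exists>a. realizes M 1 q0 a" ..
      qed
      fix x
      assume "x \<in> pfms L 1 B"
      then obtain \<phi> b where x: "x = (\<phi>, b)" "set b \<subseteq> B" "\<phi> \<in> fms L (1 + length b)"
        by (auto simp: pfms_def)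
      have "\<forall>a \<in> set b. \<exists>g. g \<in> G \<and> snd g = a"
        using x(2) unfolding B_def by fast
      then obtain g where "\<forall>a \<in> set b. g a \<in> G \<and> snd (g a) = a"
        by (meson bchoice)
      then have "set (map g b) \<subseteq> G" "b = map snd (map g b)"
        by (auto simp: map_idI)
      then obtain gs where gs: "set gs \<subseteq> G" "b = map snd gs" by blast
      have neg: "{e. holds M (Neg \<phi>) (e v # map (e \<circ> fst) gs)} = - {e. holds M \<phi> (e v # map (e \<circ> fst) gs)}"
        by (auto simp: holds_def)
      have "Neg \<phi> \<in> fms L (1 + length b)"
        using x(3) by (auto simp: fms_def)
      then have "(\<phi>, b) \<in> q \<or> (Neg \<phi>, b) \<in> q"
        using ultra[of "{e. holds M \<phi> (e v # map (e \<circ> fst) gs)}"] x(3) gs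
        unfolding q_def neg[symmetric] by auto
      then show "case x of (\<phi>, b) \<Rightarrow> (\<phi>, b) \<in> q \<or> (Neg \<phi>, b) \<in> q"
        by (simp add: x)
    qed
    ultimately obtain as where as: "realizes M 1 q as"
      using saturated[unfolded saturated_def, rule_format, of B q 1] by blast
    then obtain a where a: "as = [a]" "a \<in> univ M"
      by (cases as) (auto simp: realizes_def tuples_def)
    have "insert (v, a) G \<in> \<G>"
      unfolding \<G>_def
    proof (intro CollectI conjI allI impI)
      show "(\<lambda>v. (v, w v)) ` W \<subseteq> insert (v, a) G" "insert (v, a) G \<subseteq> V \<times> univ M"
        using GW GV v a by auto
      fix \<phi> gs
      assume *: "set gs \<subseteq> insert (v, a) G \<and> \<phi> \<in> fms L (length gs) \<and>
        {e. holds M \<phi> (map (e \<circ> fst) gs)} \<in> \<U>"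
      define gs' where "gs' = filter (\<lambda>g. g \<noteq> (v, a)) gs"
      have gs': "set gs' \<subseteq> G" "set gs \<subseteq> set ((v, a) # gs')"
        using * by (auto simp: gs'_def)
      have "\<phi> \<in> fms L (length gs)" using * by blast
      from fms_recode[OF this gs'(2), where 'a = 'a] obtain \<psi> where
        "\<psi> \<in> fms L (length ((v, a) # gs'))"
        "\<forall>(M :: ('f, 'r, 'a) struct) e. e ` set ((v, a) # gs') \<subseteq> univ M \<longrightarrow>
          holds M \<psi> (map e ((v, a) # gs')) \<longleftrightarrow> holds M \<phi> (map e gs)"
        by blast
      then have \<psi>: "\<psi> \<in> fms L (1 + length gs')"
        "\<And>e. e ` set ((v, a) # gs') \<subseteq> univ M \<Longrightarrow>
          holds M \<psi> (map e ((v, a) # gs')) \<longleftrightarrow> holds M \<phi> (map e gs)"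
        by simp_all
      have "{e. holds M \<psi> (e v # map (e \<circ> fst) gs')} \<in> \<U>"
      proof (rule upward)
        show "{e. holds M \<phi> (map (e \<circ> fst) gs)} \<in> \<U>" using * by blast
        show "{e. holds M \<phi> (map (e \<circ> fst) gs)} \<inter> S \<subseteq> {e. holds M \<psi> (e v # map (e \<circ> fst) gs')}"
        proof
          fix e
          assume e: "e \<in> {e. holds M \<phi> (map (e \<circ> fst) gs)} \<inter> S"
          then have "(e \<circ> fst) ` set ((v, a) # gs') \<subseteq> univ M"
            using gs'(1) fstG v unfolding S_def by (fastforce simp: image_subset_iff)
          with \<psi>(2)[OF this] e show "e \<in> {e. holds M \<psi> (e v # map (e \<circ> fst) gs')}" by simp
        qed
      qed
      then have "(\<psi>, map snd gs') \<in> q"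
        using gs'(1) \<psi>(1) unfolding q_def by blast
      then have "holds M \<psi> (map snd ((v, a) # gs'))"
        using as a by (auto simp: realizes_def)
      moreover have "snd ` set ((v, a) # gs') \<subseteq> univ M"
        using gs'(1) sndG a by fastforce
      ultimately show "holds M \<phi> (map snd gs)"
        using \<psi>(2) by blast
    qed
    with max[of "insert (v, a) G"] have "(v, a) \<in> G" by blast
    with \<open>v \<notin> Domain G\<close> show False by blast
  qed
  define e where "e v = (THE a. (v, a) \<in> G)" for v
  have e: "(v, e v) \<in> G" if "v \<in> V" for v
    using dom[OF that] functional unfolding e_def by (metis DomainE theI)
  show ?thesis
  proof (intro exI conjI ballI)
    show "e ` V \<subseteq> univ M" using e GV by blast
    show "e v = w v" if "v \<in> W" for v
      using e[of v] GW[OF that] functional W(1) that by blast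
    fix Q
    assume Q: "Q \<in> F"
    then obtain \<phi> zs where \<phi>: "set zs \<subseteq> V" "\<phi> \<in> fms L (length zs)"
      "\<And>e. e ` V \<subseteq> univ M \<Longrightarrow> Q M e \<longleftrightarrow> holds M \<phi> (map e zs)"
      using def is_struct unfolding definable_def by meson
    have "{e. Q M e} \<in> \<U>" using Q U by blast
    then have "{e. holds M \<phi> (map e zs)} \<in> \<U>"
      by (rule upward) (use \<phi>(3) in \<open>auto simp: S_def\<close>)
    then have "holds M \<phi> (map snd (map (\<lambda>z. (z, e z)) zs))"
      using \<phi>(1,2) e by (intro Gtrue) (auto simp: comp_def)
    then show "Q M e"
      using \<phi>(3) \<open>e ` V \<subseteq> univ M\<close> by (simp add: comp_def)
  qed
qed

end

section \<open>Small sets and automorphisms\<close>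

lemma (in monster) aleph0_less: "natLeq <o \<mu>"
proof -
  have "inj (\<lambda>i. Eq (Var 0) (Var i) :: ('f, 'r) fm)"
    by (auto simp: inj_def)
  moreover have "range (\<lambda>i. Eq (Var 0) (Var i)) \<subseteq> {\<phi>. wf_fm L \<phi>}"
    by auto
  ultimately have "|UNIV :: nat set| \<le>o |{\<phi>. wf_fm L \<phi>}|"
    by (meson card_of_ordLeq)
  then show ?thesis
    using card_of_nat formulas_small by (meson ordIso_symmetric ordIso_ordLeq_trans ordLeq_ordLess_trans)
qed

context monster
begin

abbreviation small :: "'b set \<Rightarrow> bool" where
  "small X \<equiv> |X| <o \<mu>"

lemma small_image: "small X \<Longrightarrow> small (f ` X)"
  using card_of_image ordLeq_ordLess_trans by blast

lemma small_countable: "countable X \<Longrightarrow> small X"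
proof -
  assume "countable X"
  then have "|X| \<le>o |UNIV :: nat set|"
    by (auto simp: countable_def card_of_ordLeq[symmetric])
  then show ?thesis
    using card_of_nat aleph0_less by (meson ordLeq_ordIso_trans ordLeq_ordLess_trans)
qed

lemma small_finite: "finite X \<Longrightarrow> small X"
  by (rule small_countable) (rule countable_finite)

lemma infinite_Field: "\<not> finite (Field \<mu>)"
proof -
  have "natLeq \<le>o \<mu>"
    using aleph0_less ordLess_imp_ordLeq by blast
  then have "|Field natLeq| \<le>o |Field \<mu>|"
    by (rule card_of_mono2)
  then show ?thesis
    using card_of_ordLeq_finite Field_natLeq infinite_UNIV_nat by metis
qed

lemma small_Plus: "small X \<Longrightarrow> small Y \<Longrightarrow> small (X <+> Y)"
  using card_of_Plus_ordLess_infinite_Field[OF infinite_Field Card_order] .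

lemma small_Un: "small X \<Longrightarrow> small Y \<Longrightarrow> small (X \<union> Y)"
  using card_of_Un_ordLess_infinite_Field[OF infinite_Field Card_order] .

lemma formulas_infinite: "infinite {\<phi>. wf_fm L \<phi>}"
proof -
  have "inj (\<lambda>i. Eq (Var 0) (Var i) :: ('f, 'r) fm)" by (auto simp: inj_def)
  moreover have "range (\<lambda>i. Eq (Var 0) (Var i)) \<subseteq> {\<phi>. wf_fm L \<phi>}" by auto
  ultimately show ?thesis using infinite_iff_countable_subset by blast
qed

lemma small_Sigma:
  assumes "|K| \<le>o |{\<phi>. wf_fm L \<phi>}|" "\<And>k. k \<in> K \<Longrightarrow> countable (X k)"
  shows "small (SIGMA k:K. X k)"
proof -
  have "|SIGMA k:K. X k| \<le>o |{\<phi>. wf_fm L \<phi>}|"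
  proof (rule card_of_Sigma_ordLeq_infinite[OF formulas_infinite assms(1)])
    show "\<forall>k \<in> K. |X k| \<le>o |{\<phi>. wf_fm L \<phi>}|"
    proof
      fix k
      assume "k \<in> K"
      then have "|X k| \<le>o |UNIV :: nat set|"
        using assms(2) by (auto simp: countable_def card_of_ordLeq[symmetric])
      moreover have "|UNIV :: nat set| \<le>o |{\<phi>. wf_fm L \<phi>}|"
        using formulas_infinite infinite_iff_card_of_nat by blast
      ultimately show "|X k| \<le>o |{\<phi>. wf_fm L \<phi>}|" by (rule ordLeq_transitive)
    qed
  qed
  then show ?thesis using formulas_small ordLeq_ordLess_trans by blast
qed

lemma univ_nonempty: "univ M \<noteq> {}"
  using is_struct by (simp add: is_struct_def)

lemma eval_automorphism:
  assumes "automorphism L M \<sigma>" "wf_tm L t" "range e \<subseteq> univ M"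
  shows "eval M e t \<in> univ M \<and> eval M (\<sigma> \<circ> e) t = \<sigma> (eval M e t)"
  using assms(2)
proof (induction t)
  case (Fn f ts)
  have f: "(f, length ts) \<in> funs L"
    using Fn.prems by simp
  have IH: "eval M e t \<in> univ M \<and> eval M (\<sigma> \<circ> e) t = \<sigma> (eval M e t)" if "t \<in> set ts" for t
    using Fn that by (simp only: wf_tm.simps)
  have "set (map (eval M e) ts) \<subseteq> univ M"
    using IH by auto
  moreover have "map (eval M (\<sigma> \<circ> e)) ts = map \<sigma> (map (eval M e) ts)"
    using IH unfolding map_map by (intro map_cong refl) (simp only: comp_apply)
  moreover have "fn_int M f as \<in> univ M" "\<sigma> (fn_int M f as) = fn_int M f (map \<sigma> as)"
    if "length as = length ts" "set as \<subseteq> univ M" for as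
    using f that assms(1) is_struct unfolding automorphism_def is_struct_def by fast+
  ultimately show ?case
    unfolding eval.simps by (metis length_map)
qed (use assms in auto)

lemma sat_automorphism:
  assumes "automorphism L M \<sigma>" "wf_fm L \<phi>" "range e \<subseteq> univ M"
  shows "sat M (\<sigma> \<circ> e) \<phi> \<longleftrightarrow> sat M e \<phi>"
  using assms(2,3)
proof (induction \<phi> arbitrary: e)
  case (Eq s t)
  then have "wf_tm L s" "wf_tm L t" by auto
  with eval_automorphism[OF assms(1)] Eq.prems(2)
  have "eval M (\<sigma> \<circ> e) s = \<sigma> (eval M e s)" "eval M (\<sigma> \<circ> e) t = \<sigma> (eval M e t)"
    "eval M e s \<in> univ M" "eval M e t \<in> univ M" by blast+
  moreover have "inj_on \<sigma> (univ M)"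
    using assms(1) by (simp add: automorphism_def bij_betw_def)
  ultimately show ?case
    unfolding sat.simps by (metis inj_on_eq_iff)
next
  case (Rel R ts)
  have R: "(R, length ts) \<in> rels L"
    using Rel by simp
  have ts: "eval M e t \<in> univ M \<and> eval M (\<sigma> \<circ> e) t = \<sigma> (eval M e t)" if "t \<in> set ts" for t
    using Rel that by (intro eval_automorphism[OF assms(1)]) auto
  have "set (map (eval M e) ts) \<subseteq> univ M"
    using ts by auto
  moreover have "map (eval M (\<sigma> \<circ> e)) ts = map \<sigma> (map (eval M e) ts)"
    using ts unfolding map_map by (intro map_cong refl) (simp only: comp_apply)
  moreover have "rel_int M R as \<longleftrightarrow> rel_int M R (map \<sigma> as)"
    if "length as = length ts" "set as \<subseteq> univ M" for as
    using R that assms(1) unfolding automorphism_def by fast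
  ultimately show ?case
    unfolding sat.simps by (metis length_map)
next
  case (Neg \<phi>)
  then have "sat M (\<sigma> \<circ> e) \<phi> \<longleftrightarrow> sat M e \<phi>" by (simp only: wf_fm.simps)
  then show ?case by (simp only: sat.simps)
next
  case (And \<phi> \<psi>)
  then have "sat M (\<sigma> \<circ> e) \<phi> \<longleftrightarrow> sat M e \<phi>" "sat M (\<sigma> \<circ> e) \<psi> \<longleftrightarrow> sat M e \<psi>"
    by (simp_all only: wf_fm.simps)
  then show ?case by (simp only: sat.simps)
next
  case (Ex x \<phi>)
  have upd: "(\<sigma> \<circ> e)(x := \<sigma> a) = \<sigma> \<circ> e(x := a)" for a
    by (auto simp: fun_eq_iff)
  have IH: "sat M (\<sigma> \<circ> e(x := a)) \<phi> \<longleftrightarrow> sat M (e(x := a)) \<phi>" if "a \<in> univ M" for a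
    using Ex.prems that by (intro Ex.IH) auto
  have "\<sigma> ` univ M = univ M"
    using assms(1) by (simp add: automorphism_def bij_betw_def)
  then have "(\<exists>b \<in> univ M. sat M ((\<sigma> \<circ> e)(x := b)) \<phi>) \<longleftrightarrow> (\<exists>a \<in> univ M. sat M ((\<sigma> \<circ> e)(x := \<sigma> a)) \<phi>)"
    by (metis imageE imageI)
  also have "\<dots> \<longleftrightarrow> (\<exists>a \<in> univ M. sat M (e(x := a)) \<phi>)"
    unfolding upd using IH by blast
  finally show ?case by (simp only: sat.simps)
qed

lemma holds_automorphism:
  assumes "automorphism L M \<sigma>" "\<phi> \<in> fms L (length as)" "set as \<subseteq> univ M"
  shows "holds M \<phi> (map \<sigma> as) \<longleftrightarrow> holds M \<phi> as"
proof -
  obtain c where c: "c \<in> univ M" using univ_nonempty by blast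
  define e where "e i = (if i < length as then as ! i else c)" for i
  have "range e \<subseteq> univ M"
    using c assms(3) by (auto simp: e_def)
  moreover have "holds M \<phi> as = sat M e \<phi>"
    using assms(2) by (rule holds_sat) (simp add: e_def)
  moreover have "holds M \<phi> (map \<sigma> as) = sat M (\<sigma> \<circ> e) \<phi>"
    by (rule holds_sat[of _ L]) (use assms(2) in \<open>auto simp: e_def\<close>)
  ultimately show ?thesis
    using sat_automorphism[OF assms(1)] assms(2) by (simp add: fms_def)
qed

definition aut_fixing :: "'a set \<Rightarrow> ('a \<Rightarrow> 'a) set" where
  "aut_fixing B = {\<sigma>. automorphism L M \<sigma> \<and> (\<forall>b \<in> B. \<sigma> b = b)}"

lemma aut_fixing_antimono: "B \<subseteq> B' \<Longrightarrow> aut_fixing B' \<subseteq> aut_fixing B"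
  by (auto simp: aut_fixing_def)

lemma aut_fixing_map: "\<sigma> \<in> aut_fixing B \<Longrightarrow> set b \<subseteq> B \<Longrightarrow> map \<sigma> b = b"
  by (auto simp: aut_fixing_def map_idI subset_eq)

lemma aut_in_univ: "\<sigma> \<in> aut_fixing B \<Longrightarrow> a \<in> univ M \<Longrightarrow> \<sigma> a \<in> univ M"
  by (auto simp: aut_fixing_def automorphism_def bij_betw_def)

lemma aut_tuples: "\<sigma> \<in> aut_fixing B \<Longrightarrow> x \<in> tuples M n \<Longrightarrow> map \<sigma> x \<in> tuples M n"
  by (auto simp: tuples_def aut_in_univ subset_eq)

lemma aut_holds:
  "\<sigma> \<in> aut_fixing B \<Longrightarrow> \<phi> \<in> fms L (length as) \<Longrightarrow> set as \<subseteq> univ M \<Longrightarrow>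
    holds M \<phi> (map \<sigma> as) \<longleftrightarrow> holds M \<phi> as"
  using holds_automorphism by (auto simp: aut_fixing_def)

lemma id_aut: "id \<in> aut_fixing B"
  by (auto simp: aut_fixing_def automorphism_def)

lemma comp_aut:
  assumes "\<sigma> \<in> aut_fixing B" "\<tau> \<in> aut_fixing B"
  shows "\<sigma> \<circ> \<tau> \<in> aut_fixing B"
proof -
  have \<tau>: "set (map \<tau> as) \<subseteq> univ M" if "set as \<subseteq> univ M" for as
    using that aut_in_univ[OF assms(2)] by auto
  have \<sigma>': "automorphism L M \<sigma>" and \<tau>': "automorphism L M \<tau>"
    using assms by (auto simp: aut_fixing_def)
  have "bij_betw (\<sigma> \<circ> \<tau>) (univ M) (univ M)"
    using \<sigma>' \<tau>' by (auto simp: automorphism_def intro: bij_betw_trans)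
  moreover have "\<sigma> (\<tau> (fn_int M f as)) = fn_int M f (map (\<sigma> \<circ> \<tau>) as)"
    if "(f, length as) \<in> funs L" "set as \<subseteq> univ M" for f as
  proof -
    have "\<tau> (fn_int M f as) = fn_int M f (map \<tau> as)"
      using \<tau>' that unfolding automorphism_def by fast
    moreover have "\<sigma> (fn_int M f (map \<tau> as)) = fn_int M f (map \<sigma> (map \<tau> as))"
      using \<sigma>' that \<tau>[OF that(2)] unfolding automorphism_def by force
    ultimately show ?thesis by simp
  qed
  moreover have "rel_int M R as \<longleftrightarrow> rel_int M R (map (\<sigma> \<circ> \<tau>) as)"
    if "(R, length as) \<in> rels L" "set as \<subseteq> univ M" for R as
  proof -
    have "rel_int M R as \<longleftrightarrow> rel_int M R (map \<tau> as)"
      using \<tau>' that unfolding automorphism_def by fast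
    also have "\<dots> \<longleftrightarrow> rel_int M R (map \<sigma> (map \<tau> as))"
      using \<sigma>' that \<tau>[OF that(2)] unfolding automorphism_def by force
    finally show ?thesis by simp
  qed
  ultimately have "automorphism L M (\<sigma> \<circ> \<tau>)"
    unfolding automorphism_def by auto
  with assms show ?thesis by (auto simp: aut_fixing_def)
qed

lemma realizes_aut:
  assumes "\<sigma> \<in> aut_fixing B" "\<Sigma> \<subseteq> pfms L n B" "B \<subseteq> univ M" "realizes M n \<Sigma> x"
  shows "realizes M n \<Sigma> (map \<sigma> x)"
  unfolding realizes_def
proof (intro conjI ballI)
  have x: "x \<in> tuples M n" using assms(4) by (simp add: realizes_def)
  then show "map \<sigma> x \<in> tuples M n" using aut_tuples assms(1) by blast
  fix q
  assume q: "q \<in> \<Sigma>"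
  obtain \<phi> b where [simp]: "q = (\<phi>, b)" by force
  have b: "set b \<subseteq> B" "\<phi> \<in> fms L (n + length b)"
    using q assms(2) by (auto simp: pfms_def)
  then have "map \<sigma> b = b" using aut_fixing_map assms(1) by blast
  moreover have "holds M \<phi> (x @ b)"
    using q assms(4) by (auto simp: realizes_def)
  then have "holds M \<phi> (map \<sigma> (x @ b))"
    using aut_holds[OF assms(1), of \<phi> "x @ b"] b x assms(3) by (auto simp: tuples_def)
  ultimately show "case q of (\<phi>, b) \<Rightarrow> holds M \<phi> (map \<sigma> x @ b)" by simp
qed

text \<open>
  Strong homogeneity extends elementary maps between small sets. The map to be extended sends each
  \<open>e v\<close> to \<open>e' v\<close> and fixes \<open>B\<close>; it is well defined since equations between variables are
  among the formulas that \<open>e'\<close> has to preserve.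
\<close>

lemma aut_of_same_type:
  fixes e e' :: "'v \<Rightarrow> 'a"
  assumes B: "B \<subseteq> univ M" "small B" and V: "small V"
    and e: "e ` V \<subseteq> univ M" "e' ` V \<subseteq> univ M"
    and same: "\<And>\<phi> zs. set zs \<subseteq> V <+> B \<Longrightarrow> \<phi> \<in> fms L (length zs) \<Longrightarrow>
      holds M \<phi> (map (case_sum e id) zs) \<Longrightarrow> holds M \<phi> (map (case_sum e' id) zs)"
  obtains \<sigma> where "\<sigma> \<in> aut_fixing B" "\<And>v. v \<in> V \<Longrightarrow> \<sigma> (e v) = e' v"
proof -
  define D where "D = case_sum e id ` (V <+> B)"
  define z where "z x = (SOME z. z \<in> V <+> B \<and> case_sum e id z = x)" for x
  have z: "z x \<in> V <+> B \<and> case_sum e id (z x) = x" if "x \<in> D" for x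
    unfolding z_def by (rule someI_ex) (use that in \<open>auto simp: D_def\<close>)
  define g where "g x = case_sum e' id (z x)" for x
  have g: "g (case_sum e id y) = case_sum e' id y" if y: "y \<in> V <+> B" for y
  proof -
    have D: "case_sum e id y \<in> D" using y by (simp add: D_def)
    have "holds M (Eq (Var 0) (Var 1)) (map (case_sum e' id) [z (case_sum e id y), y])"
    proof (rule same)
      show "holds M (Eq (Var 0) (Var 1)) (map (case_sum e id) [z (case_sum e id y), y])"
        using z[OF D] by (simp add: holds_def)
    qed (use y z[OF D] in \<open>auto simp: fms_def\<close>)
    then show ?thesis by (simp add: holds_def g_def)
  qed
  have "D \<subseteq> univ M"
    using e B by (auto simp: D_def)
  moreover have "small D"
    unfolding D_def using small_image small_Plus V B(2) by blast
  moreover have "g ` D \<subseteq> univ M"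
  proof
    fix y
    assume "y \<in> g ` D"
    then obtain v where "v \<in> V <+> B" "y = case_sum e' id v"
      using g unfolding D_def by blast
    then show "y \<in> univ M" using e B by auto
  qed
  moreover have "holds M \<phi> as \<longleftrightarrow> holds M \<phi> (map g as)"
    if "set as \<subseteq> D" "\<phi> \<in> fms L (length as)" for as \<phi>
  proof -
    have zs: "set (map z as) \<subseteq> V <+> B" "map (case_sum e id) (map z as) = as"
      using that(1) z by (auto simp: map_idI subset_eq)
    have g': "map g as = map (case_sum e' id) (map z as)"
      by (simp add: g_def)
    have "holds M \<psi> as \<Longrightarrow> holds M \<psi> (map g as)" if "\<psi> \<in> fms L (length as)" for \<psi>
      using same[OF zs(1), of \<psi>] that unfolding zs(2) g' by simp
    from this[of \<phi>] this[of "Neg \<phi>"] that(2) show ?thesis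
      by (auto simp: holds_def fms_def)
  qed
  ultimately have "\<exists>\<sigma>. automorphism L M \<sigma> \<and> (\<forall>b \<in> D. \<sigma> b = g b)"
    by (intro homogeneous[unfolded strongly_homogeneous_def, rule_format]) simp
  then obtain \<sigma> where \<sigma>: "automorphism L M \<sigma>" "\<And>b. b \<in> D \<Longrightarrow> \<sigma> b = g b" by blast
  show thesis
  proof (rule that)
    show "\<sigma> \<in> aut_fixing B"
      using \<sigma> g[of "Inr _"] by (force simp: aut_fixing_def D_def image_def)
    show "\<sigma> (e v) = e' v" if "v \<in> V" for v
      using \<sigma>(2)[of "e v"] g[of "Inl v"] that by (force simp: D_def image_def)
  qed
qed

lemma aut_of_same_tuple_type:
  assumes B: "B \<subseteq> univ M" "small B" and x: "x \<in> tuples M n" "y \<in> tuples M n"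
    and same: "\<And>\<phi> b. (\<phi>, b) \<in> pfms L n B \<Longrightarrow> holds M \<phi> (x @ b) \<Longrightarrow> holds M \<phi> (y @ b)"
  obtains \<sigma> where "\<sigma> \<in> aut_fixing B" "map \<sigma> x = y"
proof -
  have "\<exists>\<sigma>. \<sigma> \<in> aut_fixing B \<and> (\<forall>i \<in> {..<n}. \<sigma> (x ! i) = y ! i)"
  proof (rule aut_of_same_type[OF B, of "{..<n}" "(!) x" "(!) y"])
    fix \<phi> and zs :: "(nat + 'a) list"
    assume zs: "set zs \<subseteq> {..<n} <+> B" "\<phi> \<in> fms L (length zs)"
      and hx: "holds M \<phi> (map (case_sum ((!) x) id) zs)"
    have "definable L ({..<n} <+> B) (\<lambda>M e. holds M \<phi> (map e zs) :: bool)"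
      for M :: "('f, 'r, 'a) struct"
      using zs by (intro definable_holds)
    then obtain \<psi> b where \<psi>: "set b \<subseteq> B" "\<psi> \<in> fms L (n + length b)"
      "\<And>M x (e :: 'a \<Rightarrow> 'a). e ` B \<subseteq> univ M \<Longrightarrow> is_struct L M \<Longrightarrow> x \<in> tuples M n \<Longrightarrow>
       holds (M :: ('f, 'r, 'a) struct) \<phi> (map (case_sum ((!) x) e) zs) \<longleftrightarrow> holds M \<psi> (x @ map e b)"
      by (rule definable_prefixE) (rule that)
    have "holds M \<phi> (map (case_sum ((!) x) id) zs) \<longleftrightarrow> holds M \<psi> (x @ b)" if "x \<in> tuples M n" for x
      using \<psi>(3)[of id M x] B(1) is_struct that by simp
    moreover have "(\<psi>, b) \<in> pfms L n B"
      using \<psi> by (simp add: pfms_def)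
    ultimately show "holds M \<phi> (map (case_sum ((!) y) id) zs)"
      using same hx x by blast
  qed (use x in \<open>auto simp: tuples_def small_finite\<close>)
  then obtain \<sigma> where "\<sigma> \<in> aut_fixing B" "\<forall>i \<in> {..<n}. \<sigma> (x ! i) = y ! i" by blast
  moreover from this have "map \<sigma> x = y"
    using x by (auto simp: tuples_def list_eq_iff_nth_eq)
  ultimately show thesis using that by blast
qed

lemma inverse_aut:
  assumes "\<sigma> \<in> aut_fixing B" "B \<subseteq> univ M"
  obtains \<tau> where "\<tau> \<in> aut_fixing B" "\<And>a. a \<in> univ M \<Longrightarrow> \<tau> (\<sigma> a) = a"
    "\<And>a. a \<in> univ M \<Longrightarrow> \<sigma> (\<tau> a) = a"
proof -
  let ?\<tau> = "inv_into (univ M) \<sigma>"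
  have aut: "automorphism L M \<sigma>" and bij: "bij_betw \<sigma> (univ M) (univ M)"
    using assms(1) by (auto simp: aut_fixing_def automorphism_def)
  have \<tau>\<sigma>: "?\<tau> (\<sigma> a) = a" and \<sigma>\<tau>: "\<sigma> (?\<tau> a) = a" and \<tau>: "?\<tau> a \<in> univ M" if "a \<in> univ M" for a
    using that bij bij_betw_inv_into_left bij_betw_inv_into_right bij_betw_apply bij_betw_inv_into by metis+
  have \<tau>s: "set (map ?\<tau> as) \<subseteq> univ M" "map \<sigma> (map ?\<tau> as) = as" if "set as \<subseteq> univ M" for as
    using that \<tau> \<sigma>\<tau> by (auto simp: map_idI subset_eq)
  have "bij_betw ?\<tau> (univ M) (univ M)"
    using bij by (rule bij_betw_inv_into)
  moreover have "?\<tau> (fn_int M f as) = fn_int M f (map ?\<tau> as)"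
    if "(f, length as) \<in> funs L" "set as \<subseteq> univ M" for f as
  proof -
    have f: "fn_int M f (map ?\<tau> as) \<in> univ M"
      using is_struct that \<tau>s[OF that(2)] unfolding is_struct_def by force
    have "\<sigma> (fn_int M f (map ?\<tau> as)) = fn_int M f (map \<sigma> (map ?\<tau> as))"
      using aut that \<tau>s(1)[OF that(2)] unfolding automorphism_def by force
    then show ?thesis
      using \<tau>\<sigma>[OF f] \<tau>s(2)[OF that(2)] by simp
  qed
  moreover have "rel_int M R as \<longleftrightarrow> rel_int M R (map ?\<tau> as)"
    if "(R, length as) \<in> rels L" "set as \<subseteq> univ M" for R as
  proof -
    have "rel_int M R (map ?\<tau> as) \<longleftrightarrow> rel_int M R (map \<sigma> (map ?\<tau> as))"
      using aut that \<tau>s(1)[OF that(2)] unfolding automorphism_def by force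
    then show ?thesis using \<tau>s(2)[OF that(2)] by simp
  qed
  ultimately have "automorphism L M ?\<tau>"
    unfolding automorphism_def by auto
  moreover have "\<forall>b \<in> B. ?\<tau> b = b"
    using assms \<tau>\<sigma> unfolding aut_fixing_def by force
  ultimately have "?\<tau> \<in> aut_fixing B"
    by (simp add: aut_fixing_def)
  with \<tau>\<sigma> \<sigma>\<tau> that show thesis by blast
qed

lemma realizes_partial_type:
  assumes \<Sigma>: "\<Sigma> \<subseteq> pfms L n B" and B: "B \<subseteq> univ M" "small B" and con: "consistent M n \<Sigma>"
  shows "\<exists>a. realizes M n \<Sigma> a"
proof -
  define Q where "Q = (\<lambda>(\<phi>, b) (M :: ('f, 'r, 'a) struct) (e :: nat + 'a \<Rightarrow> 'a).
    holds M \<phi> (map e (map Inl [0..<n] @ map Inr b)))"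
  have "\<exists>e. e ` ({..<n} <+> B) \<subseteq> univ M \<and> (\<forall>v \<in> Inr ` B. e v = case_sum undefined id v) \<and>
      (\<forall>P \<in> Q ` \<Sigma>. P M e)"
  proof (rule compactness[of "{..<n} <+> B" "Inr ` B" "case_sum undefined id" "Q ` \<Sigma>"])
    show "small ({..<n} <+> B)"
      by (intro small_Plus small_finite B) simp
    show "definable L ({..<n} <+> B) P" if "P \<in> Q ` \<Sigma>" for P
    proof -
      from that obtain q where q: "q \<in> \<Sigma>" "P = Q q" by blast
      moreover obtain \<phi> b where "q = (\<phi>, b)" by (cases q)
      ultimately have "(\<phi>, b) \<in> \<Sigma>" "P = Q (\<phi>, b)" by simp_all
      moreover from this have "set b \<subseteq> B" "\<phi> \<in> fms L (n + length b)"
        using \<Sigma> by (auto simp: pfms_def)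
      ultimately show ?thesis
        by (auto simp: Q_def simp del: map_append map_map intro!: definable_holds)
    qed
    fix F0
    assume "finite F0" "F0 \<subseteq> Q ` \<Sigma>"
    then obtain S0 where S0: "S0 \<subseteq> \<Sigma>" "finite S0" "F0 = Q ` S0"
      by (meson finite_subset_image)
    then obtain a where a: "realizes M n S0 a"
      using con unfolding consistent_def by blast
    have am: "map ((!) a) [0..<n] = a"
      using a by (auto simp: realizes_def tuples_def map_nth)
    have "case_sum ((!) a) id ` ({..<n} <+> B) \<subseteq> univ M"
      using a B by (force simp: realizes_def tuples_def)
    moreover have "\<forall>P \<in> F0. P M (case_sum ((!) a) id)"
      using a am by (auto simp: S0 Q_def realizes_def comp_def)
    ultimately show "\<exists>e. e ` ({..<n} <+> B) \<subseteq> univ M \<and>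
        (\<forall>v \<in> Inr ` B. e v = case_sum undefined id v) \<and> (\<forall>P \<in> F0. P M e)"
      by (intro exI[of _ "case_sum ((!) a) id"]) auto
  qed (use B in auto)
  then obtain e where e: "e ` ({..<n} <+> B) \<subseteq> univ M" "\<And>b. b \<in> B \<Longrightarrow> e (Inr b) = b"
    "\<And>q. q \<in> \<Sigma> \<Longrightarrow> Q q M e"
    by auto
  have "realizes M n \<Sigma> (map (e \<circ> Inl) [0..<n])"
    unfolding realizes_def
  proof (intro conjI ballI)
    show "map (e \<circ> Inl) [0..<n] \<in> tuples M n"
      using e(1) by (auto simp: tuples_def image_subset_iff)
    fix q
    assume q: "q \<in> \<Sigma>"
    then have "map (e \<circ> Inr) (snd q) = snd q"
      using \<Sigma> e(2) by (intro map_idI) (force simp: pfms_def)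
    then show "case q of (\<phi>, b) \<Rightarrow> holds M \<phi> (map (e \<circ> Inl) [0..<n] @ b)"
      using e(3)[OF q] by (auto simp: Q_def comp_def split: prod.splits)
  qed
  then show ?thesis ..
qed

end

section \<open>Generically stable types\<close>

text \<open>
  The sequences in the definition of generic stability are indexed by lists of elements. The lists
  \<open>replicate i undefined\<close> serve as copies of the natural numbers, ordered first by the value of
  \<open>c\<close>. With \<open>c i = i mod 2\<close> this is the order type \<open>\<omega> + \<omega>\<close>, the even numbers
  preceding the odd ones.
\<close>

definition list_order :: "(nat \<Rightarrow> nat) \<Rightarrow> 'a list rel" where
  "list_order c = {(u, v). \<exists>i j. u = replicate i undefined \<and> v = replicate j undefined \<and>
     (c i < c j \<or> c i = c j \<and> i \<le> j)}"

lemma in_list_order: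
  "(replicate i undefined, replicate j undefined) \<in> list_order c \<longleftrightarrow> c i < c j \<or> c i = c j \<and> i \<le> j"
  unfolding list_order_def by (auto dest!: arg_cong[of "replicate _ _" _ length])

lemma Field_list_order: "Field (list_order c) = range (\<lambda>i. replicate i undefined)"
  unfolding Field_def list_order_def by auto

lemma Well_order_list_order: "Well_order (list_order c)"
proof -
  have "(list_order c :: 'a list rel) - Id \<subseteq>
      inv_image (less_than <*lex*> less_than) (\<lambda>u. (c (length u), length u))"
    by (auto simp: list_order_def)
  then have "wf ((list_order c :: 'a list rel) - Id)"
    by (rule wf_subset[rotated]) (intro wf_inv_image wf_lex_prod wf_less_than)
  moreover have "Linear_order (list_order c :: 'a list rel)"
    unfolding linear_order_on_def partial_order_on_def preorder_on_def Field_list_order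
  proof (intro conjI)
    show "refl_on (range (\<lambda>i. replicate i undefined)) (list_order c :: 'a list rel)"
      by (auto simp: refl_on_def in_list_order)
    show "trans (list_order c :: 'a list rel)"
      unfolding trans_def list_order_def by (auto dest!: arg_cong[of "replicate _ _" _ length])
    show "antisym (list_order c :: 'a list rel)"
      unfolding antisym_def list_order_def by (auto dest!: arg_cong[of "replicate _ _" _ length])
    show "total_on (range (\<lambda>i. replicate i undefined)) (list_order c :: 'a list rel)"
      by (auto simp: total_on_def in_list_order)
    show "list_order c \<subseteq> range (\<lambda>i. replicate i undefined) \<times> (range (\<lambda>i. replicate i undefined) :: 'a list set)"
      unfolding list_order_def by auto
  qed
  ultimately show ?thesis by (simp add: well_order_on_def)
qed

text \<open>
  Dependent choice for generated sequences, where the condition on a tuple refers to the set of all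
  entries of its predecessors.
\<close>

lemma exists_seq:
  fixes P :: "'a set \<Rightarrow> 'a list \<Rightarrow> bool"
  assumes "\<And>(k :: nat) b. (\<And>j. j < k \<Longrightarrow> P (\<Union>i<j. set (b i)) (b j)) \<Longrightarrow> \<exists>x. P (\<Union>i<k. set (b i)) x"
  shows "\<exists>b. \<forall>k :: nat. P (\<Union>i<k. set (b i)) (b k)"
proof (rule dependent_wf_choice[of less_than "\<lambda>b k x. P (\<Union>i<k. set (b i)) x"])
  fix f g :: "nat \<Rightarrow> 'a list" and k x
  assume "\<And>z. (z, k) \<in> less_than \<Longrightarrow> f z = g z"
  then have "(\<Union>i<k. set (f i)) = (\<Union>i<k. set (g i))" by simp
  then show "P (\<Union>i<k. set (f i)) x = P (\<Union>i<k. set (g i)) x" by simp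
next
  fix f :: "nat \<Rightarrow> 'a list" and k
  show "\<exists>r. P (\<Union>i<k. set (f i)) r" if "\<And>y. (y, k) \<in> less_than \<Longrightarrow> P (\<Union>i<y. set (f i)) (f y)"
    by (rule assms) (use that in simp)
qed simp

context monster
begin

lemma pfm_of_definable:
  assumes "definable L ({..<n} <+> B) P" "B \<subseteq> univ M"
  shows "\<exists>\<phi> b. (\<phi>, b) \<in> pfms L n B \<and>
    (\<forall>x \<in> tuples M n. P M (case_sum ((!) x) id) \<longleftrightarrow> holds M \<phi> (x @ b))"
proof -
  from assms(1) obtain \<phi> b where \<phi>: "set b \<subseteq> B" "\<phi> \<in> fms L (n + length b)"
      "\<And>M x (e :: 'a \<Rightarrow> 'a). e ` B \<subseteq> univ M \<Longrightarrow> is_struct L M \<Longrightarrow> x \<in> tuples M n \<Longrightarrow>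
       P M (case_sum ((!) x) e) \<longleftrightarrow> holds M \<phi> (x @ map e b)"
    by (rule definable_prefixE) (rule that)
  have "P M (case_sum ((!) x) id) \<longleftrightarrow> holds M \<phi> (x @ b)" if "x \<in> tuples M n" for x
    using \<phi>(3)[of id M x] assms(2) is_struct that by simp
  with \<phi>(1,2) show ?thesis by (auto simp: pfms_def)
qed

lemma map_case_sum_nth:
  "x \<in> tuples M n \<Longrightarrow> map (case_sum ((!) x) id) (map Inl [0..<n] @ map Inr b) = x @ b"
  by (auto simp: tuples_def comp_def map_nth)

text \<open>
  Lets the parameters of a formula be listed in any desired order, for instance with the entries of a
  distinguished tuple first.
\<close>

lemma pfm_recode:
  assumes "\<phi> \<in> fms L (n + length c)" "set c \<subseteq> set d" "set d \<subseteq> univ M"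
  shows "\<exists>\<chi> \<in> fms L (n + length d). \<forall>x \<in> tuples M n. holds M \<chi> (x @ d) \<longleftrightarrow> holds M \<phi> (x @ c)"
proof -
  have "\<phi> \<in> fms L (length (map Inl [0..<n] @ map Inr c))"
    "set (map Inl [0..<n] @ map Inr c) \<subseteq> set (map Inl [0..<n] @ map Inr d)"
    using assms(1,2) by auto
  from fms_recode[OF this, where 'a = 'a] obtain \<chi> where
    "\<chi> \<in> fms L (length (map Inl [0..<n] @ map Inr d))"
    and \<chi>: "\<forall>(M :: ('f, 'r, 'a) struct) e. e ` set (map Inl [0..<n] @ map Inr d) \<subseteq> univ M \<longrightarrow>
      (holds M \<chi> (map e (map Inl [0..<n] @ map Inr d)) \<longleftrightarrow>
       holds M \<phi> (map e (map Inl [0..<n] @ map Inr c)))"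
    by blast
  moreover have "holds M \<chi> (x @ d) \<longleftrightarrow> holds M \<phi> (x @ c)" if x: "x \<in> tuples M n" for x
  proof -
    have "case_sum ((!) x) id ` set (map Inl [0..<n] @ map Inr d) \<subseteq> univ M"
      using x assms(3) by (force simp: tuples_def)
    from \<chi>[rule_format, OF this] show ?thesis
      unfolding map_case_sum_nth[OF x] .
  qed
  ultimately show ?thesis by auto
qed

lemma pfm_swap:
  assumes "\<chi> \<in> fms L (n + (n + k))"
  shows "\<exists>\<chi>' \<in> fms L (n + (n + k)). \<forall>x \<in> tuples M n. \<forall>y \<in> tuples M n. \<forall>c \<in> tuples M k.
    holds M \<chi>' (y @ x @ c) \<longleftrightarrow> holds M \<chi> (x @ y @ c)"
proof -
  define zs where "zs = [n..<n + n] @ [0..<n] @ [n + n..<n + n + k]"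
  have "\<chi> \<in> fms L (length zs)" "set zs \<subseteq> set [0..<n + n + k]"
    using assms by (auto simp: zs_def add.assoc)
  from fms_recode[OF this, where 'a = 'a] obtain \<chi>' where
    "\<chi>' \<in> fms L (length [0..<n + n + k])"
    and \<chi>': "\<forall>(M :: ('f, 'r, 'a) struct) e. e ` set [0..<n + n + k] \<subseteq> univ M \<longrightarrow>
      (holds M \<chi>' (map e [0..<n + n + k]) \<longleftrightarrow> holds M \<chi> (map e zs))"
    by blast
  moreover have "holds M \<chi>' (y @ x @ c) \<longleftrightarrow> holds M \<chi> (x @ y @ c)"
    if x: "x \<in> tuples M n" "y \<in> tuples M n" "c \<in> tuples M k" for x y c
  proof -
    have len: "length x = n" "length y = n" "length c = k"
      using x by (auto simp: tuples_def)
    have "set (y @ x @ c) \<subseteq> univ M" using x by (auto simp: tuples_def)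
    then have "(y @ x @ c) ! i \<in> univ M" if "i < n + n + k" for i
      using that len nth_mem[of i "y @ x @ c"] by (auto simp only: length_append add.assoc)
    then have "(!) (y @ x @ c) ` set [0..<n + n + k] \<subseteq> univ M"
      by (auto simp only: image_subset_iff set_upt atLeastLessThan_iff)
    moreover have "map ((!) (y @ x @ c)) [0..<n + n + k] = y @ x @ c"
      using len map_nth[of "y @ x @ c"] by (simp add: add.assoc)
    moreover have "map ((!) (y @ x @ c)) zs = x @ y @ c"
      using len by (intro nth_equalityI) (auto simp: zs_def nth_append)
    ultimately show ?thesis using \<chi>' by metis
  qed
  ultimately show ?thesis
    by (intro bexI[of _ \<chi>'] ballI) (simp_all only: length_upt diff_zero add.assoc)
qed

end

locale generically_stable_type = monster L T \<mu> M
  for L :: "('f, 'r) lang" and T :: "('f, 'r) fm set" and \<mu> :: "'k rel" and M :: "('f, 'r, 'a) struct" +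
  fixes A :: "'a set" and n :: nat and p :: "('f, 'r, 'a) pfm set"
  assumes A: "A \<subseteq> univ M" "small A"
    and p: "p \<in> complete_types L M n (univ M)"
    and stable: "generically_stable L M n A p"
begin

lemma p_subset: "p \<subseteq> pfms L n (univ M)"
  using p by (simp add: complete_types_def)

lemma p_consistent: "finite F \<Longrightarrow> F \<subseteq> p \<Longrightarrow> \<exists>x. realizes M n F x"
  using p by (simp add: complete_types_def consistent_def)

lemma consistent_subset: "\<Gamma> \<subseteq> p \<Longrightarrow> consistent M n \<Gamma>"
  unfolding consistent_def by (intro allI impI p_consistent) (auto intro: subset_trans)

lemma Neg_in_p:
  assumes "(\<phi>, b) \<in> pfms L n (univ M)"
  shows "(Neg \<phi>, b) \<in> p \<longleftrightarrow> (\<phi>, b) \<notin> p"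
proof
  assume N: "(Neg \<phi>, b) \<in> p"
  show "(\<phi>, b) \<notin> p"
  proof
    assume "(\<phi>, b) \<in> p"
    with N obtain x where "realizes M n {(\<phi>, b), (Neg \<phi>, b)} x"
      using p_consistent[of "{(\<phi>, b), (Neg \<phi>, b)}"] by auto
    then show False by (auto simp: realizes_def holds_def)
  qed
next
  assume "(\<phi>, b) \<notin> p"
  with assms p show "(Neg \<phi>, b) \<in> p"
    unfolding complete_types_def by fast
qed

lemma p_closed:
  assumes "finite F" "F \<subseteq> p" "(\<phi>, b) \<in> pfms L n (univ M)"
    and imp: "\<And>x. realizes M n F x \<Longrightarrow> holds M \<phi> (x @ b)"
  shows "(\<phi>, b) \<in> p"
proof (rule ccontr)
  assume "(\<phi>, b) \<notin> p"
  then have "insert (Neg \<phi>, b) F \<subseteq> p"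
    using assms Neg_in_p by auto
  then obtain x where "realizes M n (insert (Neg \<phi>, b) F) x"
    using p_consistent assms(1) by blast
  then have "realizes M n F x" "\<not> holds M \<phi> (x @ b)"
    by (auto simp: realizes_def holds_def)
  with imp show False by blast
qed

abbreviation generic :: "'a set \<Rightarrow> 'a list \<Rightarrow> bool" where
  "generic B x \<equiv> realizes M n (restrict_type p B) x"

lemma restrict_subset: "restrict_type p B \<subseteq> pfms L n B" "restrict_type p B \<subseteq> p"
  using p_subset by (auto simp: restrict_type_def pfms_def)

lemma generic_tuple: "generic B x \<Longrightarrow> x \<in> tuples M n"
  by (simp add: realizes_def)

lemma generic_set: "generic B x \<Longrightarrow> set x \<subseteq> univ M"
  by (simp add: realizes_def tuples_def)

lemma generic_mono: "generic B' x \<Longrightarrow> B \<subseteq> B' \<Longrightarrow> generic B x"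
  by (auto simp: realizes_def restrict_type_def)

lemma generic_holds:
  assumes "generic B x" "(\<phi>, b) \<in> pfms L n (univ M)" "set b \<subseteq> B"
  shows "holds M \<phi> (x @ b) \<longleftrightarrow> (\<phi>, b) \<in> p"
proof -
  have "(\<psi>, b) \<in> p \<Longrightarrow> holds M \<psi> (x @ b)" for \<psi>
    using assms by (auto simp: realizes_def restrict_type_def)
  from this[of \<phi>] this[of "Neg \<phi>"] Neg_in_p[OF assms(2)] show ?thesis
    by (auto simp: holds_def)
qed

lemma p_conj:
  assumes "finite F" "F \<subseteq> restrict_type p B" "B \<subseteq> univ M"
  shows "\<exists>\<chi> c. (\<chi>, c) \<in> restrict_type p B \<and> (\<forall>x \<in> tuples M n. holds M \<chi> (x @ c) \<longrightarrow> realizes M n F x)"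
proof -
  define P where "P = (\<lambda>(M :: ('f, 'r, 'a) struct) e. \<forall>q \<in> F. holds M (fst q) (map e (map Inl [0..<n] @ map Inr (snd q))))"
  have "definable L ({..<n} <+> B) P"
    unfolding P_def
  proof (intro definable_Ball assms(1) definable_holds)
    fix q
    assume "q \<in> F"
    then have "q \<in> pfms L n B" using assms(2) restrict_subset by blast
    then show "fst q \<in> fms L (length (map Inl [0..<n] @ map Inr (snd q)))"
      "set (map Inl [0..<n] @ map Inr (snd q)) \<subseteq> {..<n} <+> B"
      by (auto simp: pfms_def)
  qed
  from pfm_of_definable[OF this assms(3)] obtain \<chi> c where \<chi>: "(\<chi>, c) \<in> pfms L n B"
    and eq: "\<And>x. x \<in> tuples M n \<Longrightarrow> P M (case_sum ((!) x) id) \<longleftrightarrow> holds M \<chi> (x @ c)"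
    by blast
  have eq': "realizes M n F x \<longleftrightarrow> holds M \<chi> (x @ c)" if x: "x \<in> tuples M n" for x
    unfolding eq[OF x, symmetric] P_def map_case_sum_nth[OF x] using x
    by (auto simp: realizes_def)
  have "(\<chi>, c) \<in> p"
  proof (rule p_closed[OF assms(1)])
    show "F \<subseteq> p" using assms(2) restrict_subset by blast
    show "(\<chi>, c) \<in> pfms L n (univ M)" using \<chi> assms(3) by (auto simp: pfms_def)
    show "holds M \<chi> (x @ c)" if "realizes M n F x" for x
      using that eq' by (auto simp: realizes_def)
  qed
  with \<chi> have "(\<chi>, c) \<in> restrict_type p B"
    by (auto simp: restrict_type_def pfms_def)
  with eq' show ?thesis by blast
qed

lemma exists_generic:
  assumes "B \<subseteq> univ M" "small B"
  shows "\<exists>x. generic B x"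
proof (rule realizes_partial_type[OF _ assms])
  show "restrict_type p B \<subseteq> pfms L n B" by (rule restrict_subset)
  show "consistent M n (restrict_type p B)"
    using restrict_subset(2) by (rule consistent_subset)
qed

lemma p_invariant:
  assumes "\<sigma> \<in> aut_fixing A" "(\<phi>, b) \<in> pfms L n (univ M)"
  shows "(\<phi>, map \<sigma> b) \<in> p \<longleftrightarrow> (\<phi>, b) \<in> p"
  using stable assms unfolding generically_stable_def invariant_type_def aut_fixing_def by fast

lemma generic_aut:
  assumes \<sigma>: "\<sigma> \<in> aut_fixing A" and x: "generic B x" and B: "B \<subseteq> univ M"
  shows "generic (\<sigma> ` B) (map \<sigma> x)"
  unfolding realizes_def
proof (intro conjI ballI)
  have x': "x \<in> tuples M n" using x by (rule generic_tuple)
  then show "map \<sigma> x \<in> tuples M n" using aut_tuples \<sigma> by blast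
  fix q
  assume q: "q \<in> restrict_type p (\<sigma> ` B)"
  obtain \<phi> b' where [simp]: "q = (\<phi>, b')" by force
  have "set b' \<subseteq> \<sigma> ` B" using q by (simp add: restrict_type_def)
  then have "\<forall>a \<in> set b'. \<exists>b. b \<in> B \<and> \<sigma> b = a" by blast
  then obtain g where g: "\<forall>a \<in> set b'. g a \<in> B \<and> \<sigma> (g a) = a"
    by (meson bchoice)
  define b where "b = map g b'"
  have b: "set b \<subseteq> B" "map \<sigma> b = b'"
    using g by (auto simp: b_def map_idI)
  have "(\<phi>, b') \<in> p" using q by (simp add: restrict_type_def)
  moreover from this have \<phi>: "(\<phi>, b) \<in> pfms L n (univ M)"
    using p_subset b B by (auto simp: pfms_def)
  ultimately have "(\<phi>, b) \<in> p"
    using p_invariant[OF \<sigma> \<phi>] b(2) by simp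
  then have "holds M \<phi> (x @ b)"
    using generic_holds[OF x \<phi> b(1)] by simp
  then have "holds M \<phi> (map \<sigma> (x @ b))"
    using aut_holds[OF \<sigma>, of \<phi> "x @ b"] \<phi> x' by (auto simp: pfms_def tuples_def)
  then show "case q of (\<phi>, b) \<Rightarrow> holds M \<phi> (map \<sigma> x @ b)"
    using b(2) by simp
qed

lemma generic_conjugate:
  assumes "generic B x" "generic B y" "B \<subseteq> univ M" "small B"
  obtains \<sigma> where "\<sigma> \<in> aut_fixing B" "map \<sigma> x = y"
proof (rule aut_of_same_tuple_type[OF assms(3,4), of x n y])
  fix \<phi> b
  assume b: "(\<phi>, b) \<in> pfms L n B" "holds M \<phi> (x @ b)"
  then have "(\<phi>, b) \<in> pfms L n (univ M)" "set b \<subseteq> B"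
    using assms(3) by (auto simp: pfms_def)
  with b assms(1,2) show "holds M \<phi> (y @ b)"
    using generic_holds by blast
qed (use assms generic_tuple in auto)

text \<open>
  By induction, an automorphism moves all entries but the last of the first tuple to those of the
  second. By invariance of \<open>p\<close> it moves the last entry to a realization of \<open>p\<close> over the
  resulting set, and the last entry of the second tuple is another one.
\<close>

lemma generated_conjugate:
  assumes gen: "generated_by M n p A r a"
    and "increasing r is" "increasing r js" "length is = length js"
  shows "\<exists>\<sigma> \<in> aut_fixing A. map (map \<sigma>) (map a is) = map a js"
  using assms(2-)
proof (induction "is" arbitrary: js rule: rev_induct)
  case Nil
  then show ?case using id_aut by auto
next
  case (snoc i is')
  obtain js' j where js: "js = js' @ [j]" "length js' = length is'"
    using snoc.prems(3) by (cases js rule: rev_cases) auto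
  have inc: "increasing r is'" "increasing r js'" "i \<in> Field r" "j \<in> Field r"
    "set is' \<subseteq> below r i" "set js' \<subseteq> below r j" "set is' \<subseteq> Field r" "set js' \<subseteq> Field r"
    using snoc.prems unfolding js by (auto simp: increasing_def sorted_wrt_append below_def)
  obtain \<sigma> where \<sigma>: "\<sigma> \<in> aut_fixing A" "map (map \<sigma>) (map a is') = map a js'"
    using snoc.IH[of js'] inc js by auto
  have inuniv: "set (a k) \<subseteq> univ M" if "k \<in> Field r" for k
    using gen that unfolding generated_by_def using generic_set by blast
  define B where "B = A \<union> entries a (set is')"
  define B' where "B' = A \<union> entries a (set js')"
  have B: "B \<subseteq> univ M" "B' \<subseteq> univ M"
    unfolding B_def B'_def entries_def using A inuniv inc by blast+
  have "small (entries a (set js'))"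
    by (intro small_finite) (auto simp: entries_def)
  then have smallB: "small B'"
    unfolding B'_def using A small_Un by blast
  have "\<sigma> ` A = A"
    using \<sigma>(1) by (auto simp: aut_fixing_def)
  moreover have "\<sigma> ` entries a (set is') = entries a (set js')"
  proof -
    have "\<sigma> ` entries a (set is') = \<Union> (set ` set (map (map \<sigma>) (map a is')))"
      by (auto simp: entries_def)
    also have "\<dots> = entries a (set js')"
      unfolding \<sigma>(2) by (auto simp: entries_def)
    finally show ?thesis .
  qed
  ultimately have img: "\<sigma> ` B = B'"
    unfolding B_def B'_def by (simp add: image_Un)
  have "generic B (a i)" "generic B' (a j)"
    using gen inc generic_mono unfolding generated_by_def B_def B'_def entries_def
    by (meson UN_mono Un_mono order_refl)+
  moreover from this have "generic B' (map \<sigma> (a i))"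
    using generic_aut[OF \<sigma>(1) _ B(1)] img by metis
  ultimately obtain \<tau> where \<tau>: "\<tau> \<in> aut_fixing B'" "map \<tau> (map \<sigma> (a i)) = a j"
    using generic_conjugate B(2) smallB by metis
  have "map \<tau> (a k) = a k" if "k \<in> set js'" for k
    by (rule aut_fixing_map[OF \<tau>(1)]) (use that in \<open>auto simp: B'_def entries_def\<close>)
  then have "map (map \<tau>) (map a js') = map a js'" by simp
  then have c1: "map (map (\<tau> \<circ> \<sigma>)) (map a is') = map a js'"
    using \<sigma>(2) by (metis (no_types, lifting) List.map.comp list.map_comp)
  have "\<tau> \<in> aut_fixing A"
    using \<tau>(1) aut_fixing_antimono[of A B'] by (auto simp: B'_def)
  then have "\<tau> \<circ> \<sigma> \<in> aut_fixing A"
    using \<sigma>(1) by (rule comp_aut)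
  moreover have c2: "map (\<tau> \<circ> \<sigma>) (a i) = a j"
    using \<tau>(2) by simp
  have "map (map (\<tau> \<circ> \<sigma>)) (map a (is' @ [i])) = map a js"
    unfolding js(1) map_append list.map c1 c2 ..
  ultimately show ?case by blast
qed

text \<open>
  If a formula of \<open>p\<close> divided over \<open>A\<close>, invariance would place the members of an inconsistent set of
  conjugates into \<open>p\<close>. So \<open>p\<close> contains the negation of every formula that divides over \<open>A\<close>.
\<close>

lemma not_forks_generic:
  assumes x: "generic B x" and B: "A \<subseteq> B" "B \<subseteq> univ M"
  shows "\<not> forks L M n A (tp L M x B)"
proof
  assume "forks L M n A (tp L M x B)"
  then obtain \<Delta> where \<Delta>: "\<Delta> \<subseteq> pfms L n (univ M)" "\<And>\<delta>. \<delta> \<in> \<Delta> \<Longrightarrow> divides L M n A \<delta>"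
    and inc: "\<not> consistent M n (tp L M x B \<union> {(Neg \<phi>, b) | \<phi> b. (\<phi>, b) \<in> \<Delta>})"
    unfolding forks_def by blast
  have "length x = n" using generic_tuple[OF x] by (simp add: tuples_def)
  have "tp L M x B \<subseteq> p"
  proof
    fix q
    assume "q \<in> tp L M x B"
    then obtain \<phi> b where q: "q = (\<phi>, b)" "(\<phi>, b) \<in> pfms L n B" "holds M \<phi> (x @ b)"
      using \<open>length x = n\<close> by (auto simp: tp_def)
    then have "(\<phi>, b) \<in> pfms L n (univ M)" "set b \<subseteq> B"
      using B by (auto simp: pfms_def)
    with generic_holds[OF x] q show "q \<in> p" by blast
  qed
  moreover have "\<exists>\<phi> b. (\<phi>, b) \<in> \<Delta> \<and> (\<phi>, b) \<in> p"
  proof (rule ccontr)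
    assume none: "\<nexists>\<phi> b. (\<phi>, b) \<in> \<Delta> \<and> (\<phi>, b) \<in> p"
    have "(Neg \<phi>, b) \<in> p" if "(\<phi>, b) \<in> \<Delta>" for \<phi> b
      using that none \<Delta>(1) Neg_in_p by blast
    with \<open>tp L M x B \<subseteq> p\<close> have sub: "tp L M x B \<union> {(Neg \<phi>, b) | \<phi> b. (\<phi>, b) \<in> \<Delta>} \<subseteq> p"
      by blast
    then have "consistent M n (tp L M x B \<union> {(Neg \<phi>, b) | \<phi> b. (\<phi>, b) \<in> \<Delta>})"
      by (rule consistent_subset)
    with inc show False ..
  qed
  then obtain \<phi> b where \<phi>: "(\<phi>, b) \<in> \<Delta>" "(\<phi>, b) \<in> p" by blast
  have "\<exists>(c :: nat \<Rightarrow> 'a list) k. (\<forall>i. c i \<in> tuples M (length b) \<and> tp L M (c i) A = tp L M b A) \<and>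
     (\<forall>F. finite F \<and> card F = k \<longrightarrow> \<not> consistent M n {(\<phi>, c i) | i. i \<in> F})"
    using \<Delta>(2)[OF \<phi>(1)] unfolding divides_def prod.case .
  then obtain c :: "nat \<Rightarrow> 'a list" and k where
    "\<forall>i. c i \<in> tuples M (length b) \<and> tp L M (c i) A = tp L M b A"
    "\<forall>F. finite F \<and> card F = k \<longrightarrow> \<not> consistent M n {(\<phi>, c i) | i. i \<in> F}"
    by (elim exE conjE)
  then have c: "\<And>i. c i \<in> tuples M (length b)" "\<And>i. tp L M (c i) A = tp L M b A"
    and k: "\<And>F. finite F \<Longrightarrow> card F = k \<Longrightarrow> \<not> consistent M n {(\<phi>, c i) | i. i \<in> F}"
    by simp_all
  have \<phi>': "(\<phi>, b) \<in> pfms L n (univ M)" using \<phi>(2) p_subset by blast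
  then have b: "b \<in> tuples M (length b)" by (auto simp: pfms_def tuples_def)
  have "(\<phi>, c i) \<in> p" for i
  proof -
    have "length (c i) = length b" using c(1)[of i] by (simp add: tuples_def)
    obtain \<sigma> where "\<sigma> \<in> aut_fixing A" "map \<sigma> b = c i"
    proof (rule aut_of_same_tuple_type[OF A b c(1)[of i]])
      fix \<psi> d
      assume "(\<psi>, d) \<in> pfms L (length b) A" "holds M \<psi> (b @ d)"
      then have "(\<psi>, d) \<in> tp L M b A" by (simp add: tp_def)
      then show "holds M \<psi> (c i @ d)"
        unfolding c(2)[of i, symmetric] by (simp add: tp_def)
    qed (rule that)
    then show ?thesis using p_invariant[OF _ \<phi>'] \<phi>(2) by metis
  qed
  then have "{(\<phi>, c i) | i. i \<in> {..<k}} \<subseteq> p" by blast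
  then have "consistent M n {(\<phi>, c i) | i. i \<in> {..<k}}"
    by (rule consistent_subset)
  with k[of "{..<k}"] show False by simp
qed

text \<open>
  Generic stability speaks of Morley sequences only, but for an invariant type this is no restriction.
\<close>

lemma Morley_seq_of_generated:
  assumes "Linear_order r" and gen: "generated_by M n p A r a"
  shows "Morley_seq L M n A r a"
  unfolding Morley_seq_def
proof (intro conjI ballI)
  have g: "generic (A \<union> entries a (below r i)) (a i)" if "i \<in> Field r" for i
    using gen that by (simp add: generated_by_def)
  show "is_seq M n r a"
    unfolding is_seq_def using assms(1) g generic_tuple by blast
  have inuniv: "set (a k) \<subseteq> univ M" if "k \<in> Field r" for k
    using g[OF that] generic_set by blast
  show "indiscernible L M A r a"
    unfolding indiscernible_def
  proof (intro allI impI)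
    fix "is" js
    assume *: "increasing r is \<and> increasing r js \<and> length is = length js"
    then obtain \<sigma> where \<sigma>: "\<sigma> \<in> aut_fixing A" "map (map \<sigma>) (map a is) = map a js"
      using generated_conjugate[OF gen] by blast
    then have eq: "concat (map a js) = map \<sigma> (concat (map a is))"
      by (simp add: map_concat)
    have "set (concat (map a is)) \<subseteq> univ M"
      using inuniv * by (force simp: increasing_def)
    then have "holds M \<phi> (map \<sigma> (concat (map a is)) @ b) \<longleftrightarrow> holds M \<phi> (concat (map a is) @ b)"
      if "(\<phi>, b) \<in> pfms L (length (concat (map a is))) A" for \<phi> b
      using aut_holds[OF \<sigma>(1), of \<phi> "concat (map a is) @ b"] aut_fixing_map[OF \<sigma>(1), of b] that A
      by (auto simp: pfms_def)
    then show "tp L M (concat (map a is)) A = tp L M (concat (map a js)) A"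
      unfolding eq tp_def by auto
  qed
  fix i
  assume i: "i \<in> Field r"
  have "below r i \<subseteq> Field r" by (auto simp: below_def Field_def)
  then have "entries a (below r i) \<subseteq> univ M"
    using inuniv by (force simp: entries_def)
  then show "\<not> forks L M n A (tp L M (a i) (A \<union> entries a (below r i)))"
    using g[OF i] A by (intro not_forks_generic) auto
qed

definition generic_seq :: "'a set \<Rightarrow> (nat \<Rightarrow> 'a list) \<Rightarrow> bool" where
  "generic_seq B g \<longleftrightarrow> (\<forall>i. generic (B \<union> (\<Union>j<i. set (g j))) (g i))"

lemma generic_seq_mono: "generic_seq B' g \<Longrightarrow> B \<subseteq> B' \<Longrightarrow> generic_seq B g"
  unfolding generic_seq_def by (meson Un_mono generic_mono order_refl)

lemma generic_seqD: "generic_seq B g \<Longrightarrow> generic B (g i)"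
  unfolding generic_seq_def by (meson Un_upper1 generic_mono)

lemma exists_generic_seq:
  assumes "B \<subseteq> univ M" "small B"
  shows "\<exists>g. generic_seq B g"
  unfolding generic_seq_def
proof (rule exists_seq[of "\<lambda>X. generic (B \<union> X)"])
  fix k and b :: "nat \<Rightarrow> 'a list"
  assume "\<And>j. j < k \<Longrightarrow> generic (B \<union> (\<Union>i<j. set (b i))) (b j)"
  then have "(\<Union>i<k. set (b i)) \<subseteq> univ M"
    using generic_set by blast
  moreover have "small (\<Union>i<k. set (b i))"
    by (intro small_finite) simp
  ultimately show "\<exists>x. generic (B \<union> (\<Union>i<k. set (b i))) x"
    using assms by (intro exists_generic) (auto intro: small_Un)
qed

lemma small_range_generic_seq: "small (\<Union>i :: nat. set (g i))"
  by (rule small_countable) (rule countable_UN[OF countableI_type countable_finite[OF finite_set]])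

text \<open>
  Otherwise the members of the sequence at which \<open>\<phi>(x, c)\<close> holds can be continued by realizations of
  \<open>p\<close> over all of them and \<open>c\<close>. The continued sequence has order type \<open>\<omega> + \<omega>\<close>, is generated by
  \<open>p\<close>, and satisfies \<open>\<phi>(x, c)\<close> infinitely often and fails it infinitely often.
\<close>

lemma average:
  assumes g: "generic_seq A g" and \<phi>: "(\<phi>, c) \<in> pfms L n (univ M)"
    and inf: "infinite {i. holds M \<phi> (g i @ c)}"
  shows "(\<phi>, c) \<in> p"
proof (rule ccontr)
  assume "(\<phi>, c) \<notin> p"
  then have neg: "(Neg \<phi>, c) \<in> p" using Neg_in_p[OF \<phi>] by blast
  define e where "e = enumerate {i. holds M \<phi> (g i @ c)}"
  define g' where "g' = g \<circ> e"
  have e: "e j < e i" if "j < i" for i j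
    using enumerate_mono[OF that inf] by (simp add: e_def)
  have g'\<phi>: "holds M \<phi> (g' i @ c)" for i
    using enumerate_in_set[OF inf] by (simp add: g'_def e_def)
  have g': "generic (A \<union> (\<Union>j<i. set (g' j))) (g' i)" for i
  proof (rule generic_mono)
    show "generic (A \<union> (\<Union>j<e i. set (g j))) (g' i)"
      using g by (simp add: generic_seq_def g'_def)
    show "A \<union> (\<Union>j<i. set (g' j)) \<subseteq> A \<union> (\<Union>j<e i. set (g j))"
      using e by (fastforce simp: g'_def)
  qed
  define B where "B = A \<union> ((\<Union>i. set (g' i)) \<union> set c)"
  have "(\<Union>i. set (g' i)) \<subseteq> univ M"
    using g' generic_set by blast
  moreover have "small (\<Union>i. set (g' i))" by (rule small_range_generic_seq)
  moreover have "set c \<subseteq> univ M"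
    using \<phi> by (auto simp: pfms_def)
  moreover have "small (set c)"
    by (rule small_finite) simp
  ultimately have B: "B \<subseteq> univ M" "small B"
    unfolding B_def using A by (blast, intro small_Un)
  then obtain h where h: "generic_seq B h" using exists_generic_seq by blast
  \<comment> \<open>The even indices carry the subsequence, the odd ones its continuation.\<close>
  define s where "s i = (if even i then g' (i div 2) else h (i div 2))" for i
  define r :: "'a list rel" where "r = list_order (\<lambda>i. i mod 2)"
  have gs: "generic (A \<union> (\<Union>j \<in> {j. j mod 2 < i mod 2 \<or> j mod 2 = i mod 2 \<and> j < i}. set (s j))) (s i)" for i
  proof (cases "even i")
    case True
    have "(\<Union>j \<in> {j. j mod 2 < i mod 2 \<or> j mod 2 = i mod 2 \<and> j < i}. set (s j)) \<subseteq> (\<Union>j<i div 2. set (g' j))"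
    proof (intro UN_least)
      fix j
      assume "j \<in> {j. j mod 2 < i mod 2 \<or> j mod 2 = i mod 2 \<and> j < i}"
      then have "even j" "j < i" using True by (auto simp: even_iff_mod_2_eq_zero)
      then have "j div 2 < i div 2" using True by (auto elim!: evenE)
      with \<open>even j\<close> show "set (s j) \<subseteq> (\<Union>j<i div 2. set (g' j))"
        by (auto simp: s_def)
    qed
    moreover have "generic (A \<union> (\<Union>j<i div 2. set (g' j))) (s i)"
      using g'[of "i div 2"] True by (simp add: s_def)
    ultimately show ?thesis
      by (elim generic_mono) blast
  next
    case False
    have "(\<Union>j \<in> {j. j mod 2 < i mod 2 \<or> j mod 2 = i mod 2 \<and> j < i}. set (s j))
      \<subseteq> (\<Union>i. set (g' i)) \<union> (\<Union>j<i div 2. set (h j))"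
    proof (intro UN_least)
      fix j
      assume j: "j \<in> {j. j mod 2 < i mod 2 \<or> j mod 2 = i mod 2 \<and> j < i}"
      show "set (s j) \<subseteq> (\<Union>i. set (g' i)) \<union> (\<Union>j<i div 2. set (h j))"
      proof (cases "even j")
        case odd: False
        with j have "j < i" by (auto simp: odd_iff_mod_2_eq_one)
        with False odd have "j div 2 < i div 2" by (auto elim!: oddE)
        with odd show ?thesis by (auto simp: s_def)
      qed (auto simp: s_def)
    qed
    moreover have "generic (B \<union> (\<Union>j<i div 2. set (h j))) (s i)"
      using h False by (simp add: generic_seq_def s_def)
    ultimately show ?thesis
      unfolding B_def by (elim generic_mono) blast
  qed
  define a :: "'a list \<Rightarrow> 'a list" where "a u = s (length u)" for u
  have "generated_by M n p A r a"
    unfolding generated_by_def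
  proof
    fix u
    assume "u \<in> Field r"
    then obtain i where u: "u = replicate i undefined" by (auto simp: r_def Field_list_order)
    have "entries a (below r u) \<subseteq> (\<Union>j \<in> {j. j mod 2 < i mod 2 \<or> j mod 2 = i mod 2 \<and> j < i}. set (s j))"
    proof
      fix z
      assume "z \<in> entries a (below r u)"
      then obtain v where v: "(v, u) \<in> r" "v \<noteq> u" "z \<in> set (a v)"
        by (auto simp: entries_def below_def)
      then have "v \<in> Field r" by (auto simp: Field_def)
      then obtain j where j: "v = replicate j undefined" by (auto simp: r_def Field_list_order)
      with v u have "j mod 2 < i mod 2 \<or> j mod 2 = i mod 2 \<and> j < i"
        unfolding r_def by (auto simp: in_list_order le_less)
      with v j show "z \<in> (\<Union>j \<in> {j. j mod 2 < i mod 2 \<or> j mod 2 = i mod 2 \<and> j < i}. set (s j))"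
        by (auto simp: a_def)
    qed
    then show "generic (A \<union> entries a (below r u)) (a u)"
      using gs[of i] by (auto simp: a_def u intro: generic_mono)
  qed
  moreover have "Well_order r" unfolding r_def by (rule Well_order_list_order)
  moreover from this have "Linear_order r" by (simp add: well_order_on_def)
  ultimately have "finite {u \<in> Field r. holds M \<phi> (a u @ c)} \<or> finite {u \<in> Field r. \<not> holds M \<phi> (a u @ c)}"
    using stable \<phi> Morley_seq_of_generated unfolding generically_stable_def by fast
  moreover have "range (\<lambda>k. replicate (2 * k) undefined) \<subseteq> {u \<in> Field r. holds M \<phi> (a u @ c)}"
    using g'\<phi> by (auto simp: r_def Field_list_order a_def s_def)
  moreover have "range (\<lambda>k. replicate (2 * k + 1) undefined) \<subseteq> {u \<in> Field r. \<not> holds M \<phi> (a u @ c)}"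
  proof -
    have "\<not> holds M \<phi> (h k @ c)" for k
      using generic_holds[OF generic_seqD[OF h, of k] \<phi>] \<open>(\<phi>, c) \<notin> p\<close> by (auto simp: B_def)
    then show ?thesis
      by (auto simp: r_def Field_list_order a_def s_def simp del: replicate.simps)
  qed
  moreover have "infinite (range (\<lambda>k. replicate (2 * k) (undefined :: 'a)))"
    by (rule range_inj_infinite) (auto simp: inj_def dest!: arg_cong[of "replicate _ _" _ length])
  moreover have "infinite (range (\<lambda>k. replicate (2 * k + 1) (undefined :: 'a)))"
    by (rule range_inj_infinite)
      (auto simp: inj_def simp del: replicate.simps dest!: arg_cong[of "replicate _ _" _ length])
  ultimately show False using finite_subset by blast
qed

text \<open>
  Suppose that \<open>b\<close> violates a formula \<open>\<chi>(x, f, c)\<close> of \<open>p\<close>. Let \<open>g\<close> be a sequence generated by \<open>p\<close>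
  over \<open>B\<close> and let \<open>y\<close> realize \<open>p\<close> over \<open>B\<close> and \<open>g\<close>. Then every \<open>g i\<close> violates \<open>\<chi>(x, y, c)\<close>,
  which by invariance belongs to \<open>p\<close>. This contradicts \<open>average\<close>.
\<close>

lemma generic_symmetric:
  assumes B: "A \<subseteq> B" "B \<subseteq> univ M" "small B"
    and b: "generic B b" and f: "generic (B \<union> set b) f"
  shows "generic (B \<union> set f) b"
  unfolding realizes_def
proof (intro conjI ballI)
  show b_tup: "b \<in> tuples M n" using b by (rule generic_tuple)
  have f_tup: "f \<in> tuples M n" using f by (rule generic_tuple)
  fix q
  assume q: "q \<in> restrict_type p (B \<union> set f)"
  obtain \<phi> c' where [simp]: "q = (\<phi>, c')" by force
  have c': "set c' \<subseteq> B \<union> set f" "(\<phi>, c') \<in> p" "\<phi> \<in> fms L (n + length c')"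
    using q p_subset by (auto simp: restrict_type_def pfms_def)
  define c where "c = filter (\<lambda>z. z \<in> B) c'"
  have c: "set c \<subseteq> B" "set c' \<subseteq> set (f @ c)" "set (f @ c) \<subseteq> univ M"
    using c'(1) B f_tup by (auto simp: c_def tuples_def)
  obtain \<chi> where \<chi>: "\<chi> \<in> fms L (n + length (f @ c))"
    "\<And>x. x \<in> tuples M n \<Longrightarrow> holds M \<chi> (x @ f @ c) \<longleftrightarrow> holds M \<phi> (x @ c')"
    using pfm_recode[OF c'(3) c(2,3)] by blast
  have \<chi>fc: "(\<chi>, f @ c) \<in> p"
    by (rule p_closed[of "{(\<phi>, c')}"]) (use c' \<chi> c(3) in \<open>auto simp: pfms_def realizes_def\<close>)
  have "holds M \<phi> (b @ c')"
  proof (rule ccontr)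
    assume "\<not> holds M \<phi> (b @ c')"
    then have nb: "\<not> holds M \<chi> (b @ f @ c)" using \<chi>(2) b_tup by blast
    obtain g where g: "generic_seq B g" using exists_generic_seq B by blast
    have gu: "set (g i) \<subseteq> univ M" for i
      using generic_seqD[OF g] generic_set by blast
    have "B \<union> (\<Union>i. set (g i)) \<subseteq> univ M"
      using B gu by blast
    moreover have "small (B \<union> (\<Union>i. set (g i)))"
      by (intro small_Un B small_range_generic_seq)
    ultimately obtain y where y: "generic (B \<union> (\<Union>i. set (g i))) y"
      using exists_generic by blast
    \<comment> \<open>Each pair \<open>(g i, y)\<close> is conjugate to \<open>(b, f)\<close> over \<open>B\<close>.\<close>
    have conj: "\<exists>\<rho> \<in> aut_fixing B. map \<rho> b = g i \<and> map \<rho> f = y" for i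
    proof -
      obtain \<sigma> where \<sigma>: "\<sigma> \<in> aut_fixing B" "map \<sigma> b = g i"
        using generic_conjugate[OF b generic_seqD[OF g] B(2,3)] by blast
      then have \<sigma>A: "\<sigma> \<in> aut_fixing A" using aut_fixing_antimono B(1) by blast
      have "B \<union> set b \<subseteq> univ M" using B generic_set[OF b] by blast
      from generic_aut[OF \<sigma>A f this] have "generic (\<sigma> ` (B \<union> set b)) (map \<sigma> f)" .
      moreover have "\<sigma> ` (B \<union> set b) = B \<union> set (g i)"
        using \<sigma> by (auto simp: image_Un aut_fixing_def simp flip: \<sigma>(2))
      ultimately have "generic (B \<union> set (g i)) (map \<sigma> f)" by simp
      moreover have "generic (B \<union> set (g i)) y"
        using y by (rule generic_mono) blast
      moreover have "B \<union> set (g i) \<subseteq> univ M" using B gu by blast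
      moreover have "small (B \<union> set (g i))"
        by (intro small_Un B small_finite finite_set)
      ultimately obtain \<tau> where \<tau>: "\<tau> \<in> aut_fixing (B \<union> set (g i))" "map \<tau> (map \<sigma> f) = y"
        using generic_conjugate by blast
      have "map \<tau> (g i) = g i"
        using \<tau>(1) by (rule aut_fixing_map) simp
      with \<sigma>(2) \<tau>(2) have "map (\<tau> \<circ> \<sigma>) b = g i" "map (\<tau> \<circ> \<sigma>) f = y"
        by (simp_all flip: map_map)
      moreover have "\<tau> \<circ> \<sigma> \<in> aut_fixing B"
        using \<tau>(1) \<sigma>(1) aut_fixing_antimono[of B "B \<union> set (g i)"] by (blast intro: comp_aut)
      ultimately show ?thesis by blast
    qed
    have ng: "\<not> holds M \<chi> (g i @ y @ c)" for i
    proof -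
      obtain \<rho> where \<rho>: "\<rho> \<in> aut_fixing B" "map \<rho> b = g i" "map \<rho> f = y"
        using conj by blast
      have "map \<rho> (b @ f @ c) = g i @ y @ c"
        using \<rho> aut_fixing_map[OF \<rho>(1) c(1)] by simp
      moreover have "holds M \<chi> (map \<rho> (b @ f @ c)) \<longleftrightarrow> holds M \<chi> (b @ f @ c)"
        by (rule aut_holds[OF \<rho>(1)]) (use \<chi>(1) b_tup c(3) in \<open>auto simp: tuples_def\<close>)
      ultimately show ?thesis using nb by simp
    qed
    have \<chi>p: "(\<chi>, y @ c) \<in> pfms L n (univ M)" "(\<chi>, y @ c) \<in> p"
    proof -
      obtain \<rho> where \<rho>: "\<rho> \<in> aut_fixing B" "map \<rho> f = y"
        using conj by blast
      have "(\<chi>, map \<rho> (f @ c)) \<in> p \<longleftrightarrow> (\<chi>, f @ c) \<in> p"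
        using \<rho>(1) aut_fixing_antimono[OF B(1)] p_subset \<chi>fc by (intro p_invariant) auto
      then show "(\<chi>, y @ c) \<in> p"
        using \<rho> aut_fixing_map[OF \<rho>(1) c(1)] \<chi>fc by simp
      then show "(\<chi>, y @ c) \<in> pfms L n (univ M)" using p_subset by blast
    qed
    have "(Neg \<chi>, y @ c) \<in> p"
    proof (rule average)
      show "generic_seq A g" using g B(1) by (rule generic_seq_mono)
      show "(Neg \<chi>, y @ c) \<in> pfms L n (univ M)"
        using \<chi>p(1) by (auto simp: pfms_def fms_def)
      have "holds M (Neg \<chi>) (g i @ y @ c)" for i
        using ng[of i] by (simp add: holds_def)
      then show "infinite {i. holds M (Neg \<chi>) (g i @ y @ c)}" by simp
    qed
    with \<chi>p show False using Neg_in_p by blast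
  qed
  then show "case q of (\<phi>, c') \<Rightarrow> holds M \<phi> (b @ c')" by simp
qed

definition conjugates :: "'a list \<Rightarrow> 'a list set" where
  "conjugates d = {map \<sigma> d | \<sigma>. \<sigma> \<in> aut_fixing A}"

lemma conjugates_map: "\<sigma> \<in> aut_fixing A \<Longrightarrow> D \<subseteq> conjugates d \<Longrightarrow> map \<sigma> ` D \<subseteq> conjugates d"
proof
  fix d'
  assume \<sigma>: "\<sigma> \<in> aut_fixing A" and "D \<subseteq> conjugates d" "d' \<in> map \<sigma> ` D"
  then obtain \<tau> where "\<tau> \<in> aut_fixing A" "d' = map \<sigma> (map \<tau> d)"
    unfolding conjugates_def by blast
  then have "\<sigma> \<circ> \<tau> \<in> aut_fixing A" "d' = map (\<sigma> \<circ> \<tau>) d"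
    using comp_aut[OF \<sigma>] by auto
  then show "d' \<in> conjugates d" unfolding conjugates_def by blast
qed

text \<open>
  The type \<open>p\<close> restricted to \<open>B\<close> implies the disjunction of the \<open>\<theta>(x, d)\<close> for \<open>d\<close> in \<open>D\<close>.
  Naming the single formula that is responsible allows the implication to be moved by automorphisms.
\<close>

definition covers :: "('f, 'r) fm \<Rightarrow> 'a set \<Rightarrow> 'a list set \<Rightarrow> bool" where
  "covers \<theta> B D \<longleftrightarrow> (\<exists>\<chi> c. (\<chi>, c) \<in> restrict_type p B \<and>
     (\<forall>x \<in> tuples M n. holds M \<chi> (x @ c) \<longrightarrow> (\<exists>d \<in> D. holds M \<theta> (x @ d))))"

text \<open>
  As \<open>p\<close> is closed under conjunction, consistency with \<open>\<Sigma>\<close> needs to be tested on single formulas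
  of \<open>p\<close> only. In the applications \<open>\<Sigma>\<close> consists of negations, and the test succeeds because
  nothing covers.
\<close>

lemma exists_avoiding:
  assumes B: "B \<subseteq> univ M" "small B" and \<Sigma>: "\<Sigma> \<subseteq> pfms L n B'" "B' \<subseteq> univ M" "small B'"
    and con: "\<And>F \<rho> c. finite F \<Longrightarrow> F \<subseteq> \<Sigma> \<Longrightarrow> (\<rho>, c) \<in> restrict_type p B \<Longrightarrow>
      \<exists>x \<in> tuples M n. holds M \<rho> (x @ c) \<and> realizes M n F x"
  shows "\<exists>x. generic B x \<and> realizes M n \<Sigma> x"
proof -
  have "\<exists>x. realizes M n (restrict_type p B \<union> \<Sigma>) x"
  proof (rule realizes_partial_type[of _ _ "B \<union> B'"])
    show "restrict_type p B \<union> \<Sigma> \<subseteq> pfms L n (B \<union> B')"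
      using restrict_subset \<Sigma>(1) by (auto simp: pfms_def)
    show "consistent M n (restrict_type p B \<union> \<Sigma>)"
      unfolding consistent_def
    proof (intro allI impI)
      fix F
      assume F: "finite F \<and> F \<subseteq> restrict_type p B \<union> \<Sigma>"
      obtain \<rho> c where \<rho>: "(\<rho>, c) \<in> restrict_type p B"
        "\<forall>x \<in> tuples M n. holds M \<rho> (x @ c) \<longrightarrow> realizes M n (F \<inter> restrict_type p B) x"
        using p_conj[of "F \<inter> restrict_type p B" B] F B by auto
      obtain x where "x \<in> tuples M n" "holds M \<rho> (x @ c)" "realizes M n (F \<inter> \<Sigma>) x"
        using con[of "F \<inter> \<Sigma>", OF _ _ \<rho>(1)] F by auto
      moreover from this have "realizes M n (F \<inter> restrict_type p B) x" using \<rho>(2) by blast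
      ultimately have "realizes M n F x"
        using F unfolding realizes_def by fast
      then show "\<exists>x. realizes M n F x" ..
    qed
  qed (use B \<Sigma> small_Un in auto)
  then show ?thesis
    by (auto simp: realizes_def)
qed

text \<open>
  Let \<open>\<chi>(x, e, c)\<close> be the formula of \<open>p\<close> that is covered. For every realization \<open>f\<close> of \<open>p\<close> over
  \<open>B\<close>, invariance puts \<open>\<chi>(x, f, c)\<close> into \<open>p\<close>, and it is again covered by finitely many conjugates.
  Suppose that \<open>p\<close> over \<open>B\<close> is not covered. Then some \<open>b\<close> realizes it and violates all formulas
  \<open>\<chi>(x, g j, c)\<close> for a sequence \<open>g\<close> that \<open>p\<close> generates over \<open>B\<close>. By \<open>average\<close>, \<open>b\<close> violates
  \<open>\<chi>(x, f, c)\<close> for \<open>f\<close> realizing \<open>p\<close> over \<open>B\<close> and \<open>b\<close>. But by symmetry \<open>b\<close> realizes \<open>p\<close> over \<open>B\<close>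
  and \<open>f\<close>, so that \<open>\<chi>(b, f, c)\<close> holds.
\<close>

lemma covers_without_generic:
  assumes \<theta>: "\<theta> \<in> fms L (n + length d)" and d: "set d \<subseteq> univ M"
    and B: "A \<subseteq> B" "B \<subseteq> univ M" "small B"
    and e: "generic B e" and D: "finite D" "D \<subseteq> conjugates d" and cov: "covers \<theta> (B \<union> set e) D"
  shows "\<exists>D'. finite D' \<and> D' \<subseteq> conjugates d \<and> covers \<theta> B D'"
proof (rule ccontr)
  assume none: "\<nexists>D'. finite D' \<and> D' \<subseteq> conjugates d \<and> covers \<theta> B D'"
  have e_tup: "e \<in> tuples M n" using e by (rule generic_tuple)
  then have eu: "set e \<subseteq> univ M" and e_len: "length e = n"
    by (simp_all add: tuples_def)
  have Dtup: "length d' = length d \<and> set d' \<subseteq> univ M" if "d' \<in> conjugates d" for d'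
    using that d by (auto simp: conjugates_def aut_in_univ subset_eq)
  obtain \<chi>\<^sub>0 c\<^sub>0 where \<chi>\<^sub>0: "(\<chi>\<^sub>0, c\<^sub>0) \<in> restrict_type p (B \<union> set e)"
    "\<And>x. x \<in> tuples M n \<Longrightarrow> holds M \<chi>\<^sub>0 (x @ c\<^sub>0) \<Longrightarrow> \<exists>d \<in> D. holds M \<theta> (x @ d)"
    using cov unfolding covers_def by blast
  have c\<^sub>0: "set c\<^sub>0 \<subseteq> B \<union> set e" "(\<chi>\<^sub>0, c\<^sub>0) \<in> p" "\<chi>\<^sub>0 \<in> fms L (n + length c\<^sub>0)"
    using \<chi>\<^sub>0(1) p_subset by (auto simp: restrict_type_def pfms_def)
  define c where "c = filter (\<lambda>z. z \<in> B) c\<^sub>0"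
  have c: "set c \<subseteq> B" "set c\<^sub>0 \<subseteq> set (e @ c)" "set (e @ c) \<subseteq> univ M"
    using c\<^sub>0(1) B eu by (auto simp: c_def)
  have c_tup: "c \<in> tuples M (length c)" using c by (auto simp: tuples_def)
  obtain \<chi> where \<chi>: "\<chi> \<in> fms L (n + length (e @ c))"
    "\<And>x. x \<in> tuples M n \<Longrightarrow> holds M \<chi> (x @ e @ c) \<longleftrightarrow> holds M \<chi>\<^sub>0 (x @ c\<^sub>0)"
    using pfm_recode[OF c\<^sub>0(3) c(2,3)] by blast
  have \<chi>ec: "(\<chi>, e @ c) \<in> p"
    by (rule p_closed[of "{(\<chi>\<^sub>0, c\<^sub>0)}"]) (use c\<^sub>0 \<chi> c(3) in \<open>auto simp: pfms_def realizes_def\<close>)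
  have \<chi>': "(\<chi>, f @ c) \<in> p" if f: "generic B f" for f
  proof -
    obtain \<sigma> where \<sigma>: "\<sigma> \<in> aut_fixing B" "map \<sigma> e = f"
      using generic_conjugate[OF e f B(2,3)] by blast
    have "(\<chi>, map \<sigma> (e @ c)) \<in> p \<longleftrightarrow> (\<chi>, e @ c) \<in> p"
      using \<sigma>(1) aut_fixing_antimono[OF B(1)] p_subset \<chi>ec by (intro p_invariant) auto
    then show ?thesis using \<sigma> aut_fixing_map[OF \<sigma>(1) c(1)] \<chi>ec by simp
  qed
  obtain g where g: "generic_seq B g" using exists_generic_seq B by blast
  have gB: "generic B (g j)" for j using g by (rule generic_seqD)
  have g_tup: "g j \<in> tuples M n" for j using gB by (rule generic_tuple)
  then have gu: "set (g j) \<subseteq> univ M" and g_len: "length (g j) = n" for j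
    by (simp_all add: tuples_def)
  have "\<exists>\<sigma>. \<sigma> \<in> aut_fixing B \<and> map \<sigma> e = g j" for j
    using generic_conjugate[OF e gB B(2,3)] by blast
  then obtain \<sigma> where \<sigma>: "\<And>j. \<sigma> j \<in> aut_fixing B" "\<And>j. map (\<sigma> j) e = g j"
    by metis
  have \<sigma>A: "\<sigma> j \<in> aut_fixing A" for j
    using \<sigma>(1) aut_fixing_antimono[OF B(1)] by blast
  have cov_g: "\<exists>d' \<in> map (\<sigma> j) ` D. holds M \<theta> (x @ d')"
    if x: "x \<in> tuples M n" "holds M \<chi> (x @ g j @ c)" for j x
  proof -
    obtain \<tau> where \<tau>: "\<tau> \<in> aut_fixing B" "\<And>a. a \<in> univ M \<Longrightarrow> \<tau> (\<sigma> j a) = a" "\<And>a. a \<in> univ M \<Longrightarrow> \<sigma> j (\<tau> a) = a"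
      using inverse_aut[OF \<sigma>(1) B(2)] by blast
    have \<tau>x: "map \<tau> x \<in> tuples M n" using aut_tuples[OF \<tau>(1) x(1)] .
    have \<sigma>\<tau>x: "map (\<sigma> j) (map \<tau> x) = x"
      using \<tau>(3) x(1) by (auto simp: tuples_def map_idI subset_eq)
    have "map (\<sigma> j) (map \<tau> x @ e @ c) = x @ g j @ c"
      using \<sigma>\<tau>x \<sigma>(2)[of j] aut_fixing_map[OF \<sigma>(1) c(1)] by simp
    moreover have "holds M \<chi> (map (\<sigma> j) (map \<tau> x @ e @ c)) \<longleftrightarrow> holds M \<chi> (map \<tau> x @ e @ c)"
      by (rule aut_holds[OF \<sigma>(1)]) (use \<chi>(1) \<tau>x c(3) in \<open>auto simp: tuples_def\<close>)
    ultimately have "holds M \<chi> (map \<tau> x @ e @ c)" using x(2) by simp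
    then obtain d' where d': "d' \<in> D" "holds M \<theta> (map \<tau> x @ d')"
      using \<chi>\<^sub>0(2) \<chi>(2) \<tau>x by blast
    have "holds M \<theta> (map (\<sigma> j) (map \<tau> x @ d')) \<longleftrightarrow> holds M \<theta> (map \<tau> x @ d')"
      by (rule aut_holds[OF \<sigma>(1)]) (use \<theta> Dtup D(2) d'(1) \<tau>x in \<open>auto simp: tuples_def\<close>)
    with d' \<sigma>\<tau>x show ?thesis by auto
  qed
  define \<Sigma> where "\<Sigma> = range (\<lambda>j. (Neg \<chi>, g j @ c))"
  have "\<exists>b. generic B b \<and> realizes M n \<Sigma> b"
  proof (rule exists_avoiding[OF B(2,3)])
    show "\<Sigma> \<subseteq> pfms L n (B \<union> (\<Union>j. set (g j)))"
      using \<chi>(1) c(1) e_len g_len by (auto simp: \<Sigma>_def pfms_def fms_def)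
    show "B \<union> (\<Union>j. set (g j)) \<subseteq> univ M" using B gu by blast
    show "small (B \<union> (\<Union>j. set (g j)))"
      by (intro small_Un B small_range_generic_seq)
    fix F \<rho> c'
    assume F: "finite F" "F \<subseteq> \<Sigma>" and \<rho>: "(\<rho>, c') \<in> restrict_type p B"
    then obtain J where J: "finite J" "F = (\<lambda>j. (Neg \<chi>, g j @ c)) ` J"
      unfolding \<Sigma>_def by (meson finite_subset_image)
    define D' where "D' = (\<Union>j \<in> J. map (\<sigma> j) ` D)"
    have "finite D'" "D' \<subseteq> conjugates d"
      using J(1) D conjugates_map[OF \<sigma>A D(2)] by (auto simp: D'_def)
    with none have "\<not> covers \<theta> B D'" by blast
    with \<rho> obtain x where x: "x \<in> tuples M n" "holds M \<rho> (x @ c')" "\<not> (\<exists>d \<in> D'. holds M \<theta> (x @ d))"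
      unfolding covers_def by blast
    have "\<not> holds M \<chi> (x @ g j @ c)" if "j \<in> J" for j
      using cov_g[OF x(1)] x(3) that unfolding D'_def by blast
    then have "realizes M n F x"
      using x(1) by (auto simp: realizes_def J holds_def)
    with x show "\<exists>x \<in> tuples M n. holds M \<rho> (x @ c') \<and> realizes M n F x" by blast
  qed
  then obtain b where b: "generic B b" "\<And>j. \<not> holds M \<chi> (b @ g j @ c)"
    unfolding \<Sigma>_def realizes_def by (auto simp: holds_def)
  have b_tup: "b \<in> tuples M n" using b(1) by (rule generic_tuple)
  then have b_len: "length b = n" and bu: "set b \<subseteq> univ M"
    by (simp_all add: tuples_def)
  have "\<chi> \<in> fms L (n + (n + length c))" using \<chi>(1) e_len by simp
  then obtain \<chi>'' where \<chi>'': "\<chi>'' \<in> fms L (n + (n + length c))"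
    "\<And>x y. x \<in> tuples M n \<Longrightarrow> y \<in> tuples M n \<Longrightarrow> holds M \<chi>'' (y @ x @ c) \<longleftrightarrow> holds M \<chi> (x @ y @ c)"
    using pfm_swap c_tup by blast
  have pf: "(Neg \<chi>'', b @ c) \<in> pfms L n (univ M)"
    using \<chi>''(1) b_len bu c(3) by (auto simp: pfms_def fms_def)
  have neg: "(Neg \<chi>'', b @ c) \<in> p"
  proof (rule average)
    show "generic_seq A g" using g B(1) by (rule generic_seq_mono)
    have "holds M (Neg \<chi>'') (g j @ b @ c)" for j
      using b(2)[of j] \<chi>''(2)[OF b_tup g_tup] by (simp add: holds_def)
    then show "infinite {j. holds M (Neg \<chi>'') (g j @ b @ c)}" by simp
  qed (rule pf)
  have "B \<union> set b \<subseteq> univ M" using B bu by blast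
  moreover have "small (B \<union> set b)"
    by (rule small_Un[OF B(3) small_finite[OF finite_set]])
  ultimately obtain f where f: "generic (B \<union> set b) f" using exists_generic by blast
  have "holds M (Neg \<chi>'') (f @ b @ c)"
    using generic_holds[OF f pf] neg c(1) by auto
  then have "\<not> holds M \<chi> (b @ f @ c)"
    using \<chi>''(2)[OF b_tup generic_tuple[OF f]] by (simp add: holds_def)
  moreover have "generic (B \<union> set f) b"
    using generic_symmetric[OF B b(1) f] .
  moreover have fB: "(\<chi>, f @ c) \<in> p"
    using f by (intro \<chi>' generic_mono[OF f]) blast
  then have "(\<chi>, f @ c) \<in> pfms L n (univ M)" using p_subset by blast
  ultimately show False
    using generic_holds fB c(1) by (metis UnCI le_sup_iff set_append sup_ge2 sup.coboundedI1)
qed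

text \<open>
  If no finite set of conjugates covers over \<open>A\<close>, then by \<open>covers_without_generic\<close> none does over \<open>A\<close>
  and finitely many successive realizations of \<open>p\<close>. So there always is a further realization that
  violates \<open>\<theta>(x, d)\<close>, and the sequence obtained in this way contradicts \<open>average\<close>.
\<close>

theorem covered_by_conjugates:
  assumes \<theta>: "(\<theta>, d) \<in> p"
  shows "\<exists>D. finite D \<and> D \<subseteq> conjugates d \<and> (\<forall>x. generic A x \<longrightarrow> (\<exists>d' \<in> D. holds M \<theta> (x @ d')))"
proof (rule ccontr)
  assume no: "\<not> ?thesis"
  have \<theta>': "\<theta> \<in> fms L (n + length d)" "set d \<subseteq> univ M"
    using \<theta> p_subset by (auto simp: pfms_def)
  define N where "N B \<longleftrightarrow> (\<forall>D. finite D \<and> D \<subseteq> conjugates d \<longrightarrow> \<not> covers \<theta> B D)" for B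
  have N0: "N A"
    unfolding N_def
  proof (intro allI impI notI)
    fix D
    assume D: "finite D \<and> D \<subseteq> conjugates d" and "covers \<theta> A D"
    then obtain \<chi> c where \<chi>: "(\<chi>, c) \<in> restrict_type p A"
      "\<And>x. x \<in> tuples M n \<Longrightarrow> holds M \<chi> (x @ c) \<Longrightarrow> \<exists>d \<in> D. holds M \<theta> (x @ d)"
      unfolding covers_def by blast
    have "\<exists>d \<in> D. holds M \<theta> (x @ d)" if "generic A x" for x
      using \<chi> that by (auto simp: realizes_def)
    with D no show False by blast
  qed
  have "\<exists>b. \<forall>k :: nat. generic (A \<union> (\<Union>i<k. set (b i))) (b k) \<and> \<not> holds M \<theta> (b k @ d)"
  proof (rule exists_seq[of "\<lambda>X x. generic (A \<union> X) x \<and> \<not> holds M \<theta> (x @ d)"])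
    fix k and b :: "nat \<Rightarrow> 'a list"
    assume b: "\<And>j. j < k \<Longrightarrow> generic (A \<union> (\<Union>i<j. set (b i))) (b j) \<and> \<not> holds M \<theta> (b j @ d)"
    have B: "A \<subseteq> A \<union> (\<Union>i<j. set (b i))" "A \<union> (\<Union>i<j. set (b i)) \<subseteq> univ M"
      "small (A \<union> (\<Union>i<j. set (b i)))" if "j \<le> k" for j
    proof -
      have "(\<Union>i<j. set (b i)) \<subseteq> univ M"
        using b generic_set that by (meson UN_least less_le_trans lessThan_iff)
      then show "A \<union> (\<Union>i<j. set (b i)) \<subseteq> univ M" using A by blast
      show "small (A \<union> (\<Union>i<j. set (b i)))"
        by (intro small_Un A small_finite) simp
    qed blast
    have "N (A \<union> (\<Union>i<j. set (b i)))" if "j \<le> k" for j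
      using that
    proof (induction j)
      case 0
      then show ?case using N0 by simp
    next
      case (Suc j)
      show ?case
        unfolding N_def
      proof (intro allI impI notI)
        fix D
        assume D: "finite D \<and> D \<subseteq> conjugates d" and cov: "covers \<theta> (A \<union> (\<Union>i<Suc j. set (b i))) D"
        have "A \<union> (\<Union>i<Suc j. set (b i)) = (A \<union> (\<Union>i<j. set (b i))) \<union> set (b j)"
          by (auto simp: less_Suc_eq)
        then have "covers \<theta> ((A \<union> (\<Union>i<j. set (b i))) \<union> set (b j)) D"
          using cov by simp
        then have "\<exists>D'. finite D' \<and> D' \<subseteq> conjugates d \<and> covers \<theta> (A \<union> (\<Union>i<j. set (b i))) D'"
          using Suc.prems D b[of j] by (intro covers_without_generic[OF \<theta>' B]) auto
        with Suc show False unfolding N_def by auto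
      qed
    qed
    then have Nk: "N (A \<union> (\<Union>i<k. set (b i)))" by simp
    have d: "d \<in> conjugates d"
      unfolding conjugates_def using id_aut by (metis (mono_tags, lifting) list.map_id mem_Collect_eq)
    have "\<exists>x. generic (A \<union> (\<Union>i<k. set (b i))) x \<and> realizes M n {(Neg \<theta>, d)} x"
    proof (rule exists_avoiding[OF B(2,3)[OF order_refl]])
      show "{(Neg \<theta>, d)} \<subseteq> pfms L n (set d)" "set d \<subseteq> univ M" "small (set d)"
        using \<theta>' by (auto simp: pfms_def fms_def intro: small_finite[OF finite_set])
      fix F \<rho> c
      assume F: "finite F" "F \<subseteq> {(Neg \<theta>, d)}" and \<rho>: "(\<rho>, c) \<in> restrict_type p (A \<union> (\<Union>i<k. set (b i)))"
      have "\<not> covers \<theta> (A \<union> (\<Union>i<k. set (b i))) {d}"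
        using Nk d unfolding N_def by blast
      with \<rho> obtain x where "x \<in> tuples M n" "holds M \<rho> (x @ c)" "\<not> holds M \<theta> (x @ d)"
        unfolding covers_def by blast
      with F(2) show "\<exists>x \<in> tuples M n. holds M \<rho> (x @ c) \<and> realizes M n F x"
        by (intro bexI[of _ x]) (auto simp: realizes_def holds_def)
    qed
    then show "\<exists>x. generic (A \<union> (\<Union>i<k. set (b i))) x \<and> \<not> holds M \<theta> (x @ d)"
      by (auto simp: realizes_def holds_def)
  qed
  then obtain b where b: "\<And>k :: nat. generic (A \<union> (\<Union>i<k. set (b i))) (b k)" "\<And>k. \<not> holds M \<theta> (b k @ d)"
    by blast
  have "(Neg \<theta>, d) \<in> p"
  proof (rule average)
    show "generic_seq A b" using b(1) by (simp add: generic_seq_def)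
    show "(Neg \<theta>, d) \<in> pfms L n (univ M)" using \<theta>' by (auto simp: pfms_def fms_def)
    have "holds M (Neg \<theta>) (b k @ d)" for k using b(2)[of k] by (simp add: holds_def)
    then show "infinite {k. holds M (Neg \<theta>) (b k @ d)}" by simp
  qed
  with \<theta> p_subset show False using Neg_in_p by blast
qed

end

section \<open>Homogeneous subsequences\<close>

text \<open>
  Ramsey's theorem is applied to one predicate after the other, each time within the homogeneous set
  found before.
\<close>

lemma Ramsey_increasing_lists:
  fixes \<P> :: "(nat \<times> (nat list \<Rightarrow> bool)) set"
  assumes "finite \<P>"
  shows "\<exists>h :: nat \<Rightarrow> nat. strict_mono h \<and> (\<forall>(k, \<Phi>) \<in> \<P>. \<forall>u v. sorted_wrt (<) u \<and> sorted_wrt (<) v \<and>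
    length u = k \<and> length v = k \<longrightarrow> (\<Phi> (map h u) \<longleftrightarrow> \<Phi> (map h v)))"
  using assms
proof (induction \<P>)
  case empty
  then show ?case by (intro exI[of _ id]) (auto simp: strict_mono_def)
next
  case (insert q \<P>)
  obtain k \<Phi> where q: "q = (k, \<Phi>)" by force
  obtain h :: "nat \<Rightarrow> nat" where h: "strict_mono h" and hom0: "\<forall>(k, \<Phi>) \<in> \<P>. \<forall>u v. sorted_wrt (<) u \<and> sorted_wrt (<) v \<and>
    length u = k \<and> length v = k \<longrightarrow> (\<Phi> (map h u) \<longleftrightarrow> \<Phi> (map h v))"
    using insert.IH by (elim exE conjE)
  have hom: "\<Phi> (map h u) \<longleftrightarrow> \<Phi> (map h v)" if "(k, \<Phi>) \<in> \<P>" "sorted_wrt (<) u"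
    "sorted_wrt (<) v" "length u = k" "length v = k" for k \<Phi> u v
    using bspec[OF hom0 that(1), unfolded prod.case, rule_format, of u v] that(2-) by fast
  define f where "f X = (if \<Phi> (map h (sorted_list_of_set X)) then 1 else 0 :: nat)" for X
  have "\<exists>Y t. Y \<subseteq> UNIV \<and> infinite Y \<and> t < 2 \<and> (\<forall>X. X \<subseteq> Y \<and> finite X \<and> card X = k \<longrightarrow> f X = t)"
    by (rule Ramsey) (auto simp: f_def)
  then obtain Y t where Y: "infinite Y" and t: "\<And>X. X \<subseteq> Y \<Longrightarrow> finite X \<Longrightarrow> card X = k \<Longrightarrow> f X = t"
    by auto
  define g where "g = enumerate Y"
  have g: "strict_mono g" using Y strict_mono_enumerate unfolding g_def by blast
  have sorted: "sorted_wrt (<) (map g u)" if "sorted_wrt (<) u" for u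
    using that g by (simp add: sorted_wrt_map strict_mono_less)
  have new: "\<Phi> (map (h \<circ> g) u) \<longleftrightarrow> t = 1" if u: "sorted_wrt (<) u" "length u = k" for u
  proof -
    have "sorted_list_of_set (set (map g u)) = map g u"
      using sorted[OF u(1)] by (metis sorted_list_of_set.idem_if_sorted_distinct strict_sorted_iff)
    moreover have "card (set (map g u)) = k"
      using sorted[OF u(1)] u(2) by (metis distinct_card length_map strict_sorted_iff)
    moreover have "set (map g u) \<subseteq> Y"
      using Y by (auto simp: g_def enumerate_in_set)
    ultimately show ?thesis
      using t[of "set (map g u)"] by (auto simp: f_def split: if_splits)
  qed
  have all: "\<Psi> (map (h \<circ> g) u) \<longleftrightarrow> \<Psi> (map (h \<circ> g) v)"
    if "(l, \<Psi>) \<in> insert q \<P>" "sorted_wrt (<) u" "sorted_wrt (<) v" "length u = l" "length v = l" for l \<Psi> u v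
  proof (cases "(l, \<Psi>) = q")
    case True
    then show ?thesis using new[of u] new[of v] that q by simp
  next
    case False
    then have "(l, \<Psi>) \<in> \<P>" using that(1) by blast
    from hom[OF this sorted sorted, of u v] that show ?thesis by simp
  qed
  have "\<forall>(k, \<Phi>) \<in> insert q \<P>. \<forall>u v. sorted_wrt (<) u \<and> sorted_wrt (<) v \<and>
    length u = k \<and> length v = k \<longrightarrow> (\<Phi> (map (h \<circ> g) u) \<longleftrightarrow> \<Phi> (map (h \<circ> g) v))"
  proof
    fix z
    assume z: "z \<in> insert q \<P>"
    obtain l \<Psi> where "z = (l, \<Psi>)" by (cases z)
    with z all show "case z of (k, \<Phi>) \<Rightarrow> \<forall>u v. sorted_wrt (<) u \<and> sorted_wrt (<) v \<and>
      length u = k \<and> length v = k \<longrightarrow> (\<Phi> (map (h \<circ> g) u) \<longleftrightarrow> \<Phi> (map (h \<circ> g) v))"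
      by blast
  qed
  moreover have "strict_mono (h \<circ> g)" using h g by (simp add: strict_mono_def)
  ultimately show ?case by blast
qed

text \<open>
  An arbitrary list arises from the increasing list of its entries by a pattern of positions. There are
  only finitely many patterns for lists of a given length, and each of them gives a predicate of
  increasing lists.
\<close>

lemma Ramsey_order_isomorphic_lists:
  fixes \<P> :: "(nat \<times> (nat list \<Rightarrow> bool)) set"
  assumes "finite \<P>"
  obtains h :: "nat \<Rightarrow> nat" where "strict_mono h" "\<And>k \<Phi> u (f :: nat \<Rightarrow> nat). (k, \<Phi>) \<in> \<P> \<Longrightarrow> length u = k \<Longrightarrow> strict_mono_on (set u) f \<Longrightarrow>
    \<Phi> (map h u) \<longleftrightarrow> \<Phi> (map h (map f u))"
proof -
  define \<Q> where "\<Q> = (\<Union>(k, \<Phi>) \<in> \<P>. \<Union>j \<in> {..k}. (\<lambda>pat. (j, \<lambda>w. \<Phi> (map ((!) w) pat))) ` {pat. set pat \<subseteq> {..<j} \<and> length pat = k})"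
  have "finite \<Q>"
    unfolding \<Q>_def using assms by (auto intro!: finite_lists_length_eq)
  from Ramsey_increasing_lists[OF this] obtain h :: "nat \<Rightarrow> nat" where h: "strict_mono h"
    and hom0: "\<forall>(k, \<Phi>) \<in> \<Q>. \<forall>u v. sorted_wrt (<) u \<and> sorted_wrt (<) v \<and>
      length u = k \<and> length v = k \<longrightarrow> (\<Phi> (map h u) \<longleftrightarrow> \<Phi> (map h v))"
    by (elim exE conjE)
  have hom: "\<Phi> (map h u) \<longleftrightarrow> \<Phi> (map h v)" if "(k, \<Phi>) \<in> \<Q>" "sorted_wrt (<) u"
    "sorted_wrt (<) v" "length u = k" "length v = k" for k \<Phi> u v
    using bspec[OF hom0 that(1), unfolded prod.case, rule_format, of u v] that(2-) by fast
  have "\<Phi> (map h u) \<longleftrightarrow> \<Phi> (map h (map f u))"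
    if P: "(k, \<Phi>) \<in> \<P>" "length u = k" and f: "strict_mono_on (set u) f"
    for k \<Phi> u and f :: "nat \<Rightarrow> nat"
  proof -
    define w where "w = sorted_list_of_set (set u)"
    have w: "sorted_wrt (<) w" "set w = set u" by (auto simp: w_def)
    have len: "length w \<le> k" using P(2) card_length[of u] by (simp add: w_def)
    have "\<exists>i. i < length w \<and> w ! i = z" if "z \<in> set u" for z
      using that unfolding w(2)[symmetric] by (simp add: in_set_conv_nth)
    then have "\<forall>z \<in> set u. \<exists>i. i < length w \<and> w ! i = z" by blast
    then obtain pos where pos: "\<forall>z \<in> set u. pos z < length w \<and> w ! pos z = z"
      by (meson bchoice)
    define pat where "pat = map pos u"
    have pat: "set pat \<subseteq> {..<length w}" "length pat = k"
      using pos P by (auto simp: pat_def)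
    have u: "map ((!) (map g w)) pat = map g u" for g :: "nat \<Rightarrow> nat"
      using pos by (auto simp: pat_def)
    have "(length w, \<lambda>w. \<Phi> (map ((!) w) pat)) \<in> \<Q>"
      unfolding \<Q>_def using P(1) len pat by force
    moreover have "sorted_wrt (<) (map f w)"
      unfolding sorted_wrt_map using w(1)
      by (rule sorted_wrt_mono_rel[rotated]) (use f w(2) in \<open>auto simp: strict_mono_on_def\<close>)
    ultimately have "\<Phi> (map ((!) (map h w)) pat) \<longleftrightarrow> \<Phi> (map ((!) (map h (map f w))) pat)"
      using w(1) hom[of "length w" "\<lambda>w. \<Phi> (map ((!) w) pat)" w "map f w"] by simp
    then show ?thesis
      using u[of h] u[of "h \<circ> f"] by simp
  qed
  with h that show thesis by blast
qed

text \<open>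
  By Ramsey's theorem for pairs, an injective sequence has a subsequence on which the order of the
  values either always agrees with that of the indices or never does.
\<close>

lemma infinite_linear_order_monotone_sequence:
  assumes "Linear_order r" "infinite (Field r)"
  obtains \<iota> :: "nat \<Rightarrow> 'i" where "range \<iota> \<subseteq> Field r"
    "(\<forall>i j. i < j \<longrightarrow> (\<iota> i, \<iota> j) \<in> r \<and> \<iota> i \<noteq> \<iota> j) \<or> (\<forall>i j. i < j \<longrightarrow> (\<iota> j, \<iota> i) \<in> r \<and> \<iota> i \<noteq> \<iota> j)"
proof -
  obtain \<iota> :: "nat \<Rightarrow> 'i" where \<iota>: "inj \<iota>" "range \<iota> \<subseteq> Field r"
    using infinite_countable_subset[OF assms(2)] by blast
  have "\<exists>h :: nat \<Rightarrow> nat. strict_mono h \<and> (\<forall>(k, \<Phi>) \<in> {(2, \<lambda>u. (\<iota> (u ! 0), \<iota> (u ! 1)) \<in> r)}. \<forall>u v. sorted_wrt (<) u \<and>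
    sorted_wrt (<) v \<and> length u = k \<and> length v = k \<longrightarrow> (\<Phi> (map h u) \<longleftrightarrow> \<Phi> (map h v)))"
    by (rule Ramsey_increasing_lists) simp
  then obtain h :: "nat \<Rightarrow> nat" where h: "strict_mono h" and
    hom: "\<forall>u v. sorted_wrt (<) u \<and> sorted_wrt (<) v \<and> length u = 2 \<and> length v = 2 \<longrightarrow>
      (((\<iota> (map h u ! 0), \<iota> (map h u ! 1)) \<in> r) \<longleftrightarrow> ((\<iota> (map h v ! 0), \<iota> (map h v ! 1)) \<in> r))"
    unfolding ball_simps prod.case by blast
  have iff: "(\<iota> (h i), \<iota> (h j)) \<in> r \<longleftrightarrow> (\<iota> (h 0), \<iota> (h 1)) \<in> r" if "i < j" for i j
    using hom[rule_format, of "[i, j]" "[0, 1]"] that by simp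
  have ne: "\<iota> (h i) \<noteq> \<iota> (h j)" if "i < j" for i j
    using \<iota>(1) h that by (metis inj_eq less_irrefl strict_mono_less)
  have tot: "(\<iota> (h i), \<iota> (h j)) \<in> r \<or> (\<iota> (h j), \<iota> (h i)) \<in> r" if "i < j" for i j
    using assms(1) \<iota>(2) ne[OF that] unfolding linear_order_on_def total_on_def by blast
  show thesis
  proof (rule that[of "\<iota> \<circ> h"])
    show "range (\<iota> \<circ> h) \<subseteq> Field r" using \<iota>(2) by auto
    show "(\<forall>i j. i < j \<longrightarrow> ((\<iota> \<circ> h) i, (\<iota> \<circ> h) j) \<in> r \<and> (\<iota> \<circ> h) i \<noteq> (\<iota> \<circ> h) j) \<or>
      (\<forall>i j. i < j \<longrightarrow> ((\<iota> \<circ> h) j, (\<iota> \<circ> h) i) \<in> r \<and> (\<iota> \<circ> h) i \<noteq> (\<iota> \<circ> h) j)"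
    proof (cases "(\<iota> (h 0), \<iota> (h 1)) \<in> r")
      case True
      then show ?thesis unfolding comp_apply using iff ne by metis
    next
      case False
      then show ?thesis unfolding comp_apply using iff ne tot by metis
    qed
  qed
qed

lemma increasing_enumeration:
  assumes r: "Linear_order r" and "finite S" "S \<subseteq> Field r"
  shows "\<exists>u. increasing r u \<and> set u = S"
  using assms(2,3)
proof (induction "card S" arbitrary: S)
  case 0
  then show ?case by (intro exI[of _ "[]"]) (auto simp: increasing_def)
next
  case (Suc k)
  have "\<exists>z \<in> S. \<forall>w \<in> S. (w, z) \<in> r"
  proof -
    have "S \<noteq> {}" using Suc.hyps(2) by auto
    from \<open>finite S\<close> this \<open>S \<subseteq> Field r\<close> show ?thesis
    proof (induction S rule: finite_ne_induct)
      case (singleton x)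
      then show ?case using r by (auto simp: order_on_defs refl_on_def)
    next
      case (insert x S)
      then obtain z where z: "z \<in> S" "\<forall>w \<in> S. (w, z) \<in> r" by blast
      have tr: "trans r" and tot: "total_on (Field r) r" and rf: "refl_on (Field r) r"
        using r by (auto simp: order_on_defs)
      consider "(x, z) \<in> r" | "(z, x) \<in> r"
        using tot rf insert.prems z(1) unfolding total_on_def refl_on_def by (metis insert_subset subsetD)
      then show ?case
      proof cases
        case 1
        then show ?thesis using z by blast
      next
        case 2
        then have "(w, x) \<in> r" if "w \<in> S" for w using z(2) that tr by (meson transD)
        moreover have "(x, x) \<in> r" using rf insert.prems by (auto simp: refl_on_def)
        ultimately show ?thesis by blast
      qed
    qed
  qed
  then obtain z where z: "z \<in> S" "\<forall>w \<in> S. (w, z) \<in> r" by blast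
  have "k = card (S - {z})" using Suc.hyps(2) Suc.prems z(1) by simp
  then obtain u where u: "increasing r u" "set u = S - {z}"
    using Suc.hyps(1)[of "S - {z}"] Suc.prems by auto
  have "increasing r (u @ [z])"
    using u z Suc.prems by (auto simp: increasing_def sorted_wrt_append)
  moreover have "set (u @ [z]) = S" using u z by auto
  ultimately show ?case by blast
qed

text \<open>
  The pattern \<open>t\<close> describes one index in a formula about several sequences: \<open>Inl k\<close> is the entry \<open>k\<close>
  of an index tuple of sequence \<open>\<alpha>\<close>, \<open>Inr (Some (\<beta>, i))\<close> is the index \<open>i\<close> of sequence \<open>\<beta>\<close>, and
  \<open>Inr None\<close> stands in for an argument that depends on no index. The function \<open>g\<close> is the choice of
  subsequences.
\<close>

definition substituted :: "('k \<Rightarrow> 'i \<Rightarrow> 'i) \<Rightarrow> 'k \<Rightarrow> 'i list \<Rightarrow> nat + ('k \<times> 'i) option \<Rightarrow> 'i" where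
  "substituted g \<alpha> is t = (case t of Inl k \<Rightarrow> g \<alpha> (is ! k) | Inr None \<Rightarrow> undefined | Inr (Some (\<beta>, i)) \<Rightarrow> g \<beta> i)"

lemma order_isomorphism_of_same_order:
  fixes c c' :: "'t \<Rightarrow> nat"
  assumes "\<And>t t'. t \<in> X \<Longrightarrow> t' \<in> X \<Longrightarrow> c t < c t' \<longleftrightarrow> c' t < c' t'"
  obtains f where "strict_mono_on (c ` X) f" "\<And>t. t \<in> X \<Longrightarrow> f (c t) = c' t"
proof -
  define f where "f z = c' (SOME t. t \<in> X \<and> c t = z)" for z
  have f: "f (c t) = c' t" if t: "t \<in> X" for t
  proof -
    define t' where "t' = (SOME t'. t' \<in> X \<and> c t' = c t)"
    have "t' \<in> X \<and> c t' = c t"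
      unfolding t'_def by (rule someI[of _ t]) (use t in simp)
    then have "c' t' = c' t"
      using assms[of t t'] assms[of t' t] t by (metis less_irrefl linorder_neqE_nat)
    then show ?thesis by (simp add: f_def t'_def)
  qed
  then have "strict_mono_on (c ` X) f"
    using assms by (auto simp: strict_mono_on_def)
  with f that show thesis by blast
qed

text \<open>
  The subsequences are all cut out of one homogeneous set of natural numbers, each from an interval of
  its own. Passing from \<open>is\<close> to \<open>js\<close> affects the numbers in one interval only and keeps their order,
  hence it keeps the order type of all numbers that are involved. A sequence whose index order contains
  a descending but perhaps no ascending chain is read from right to left.
\<close>

lemma Ramsey_mutual:
  fixes r :: "'k \<Rightarrow> 'i rel"
    and \<Q> :: "('k \<times> 'i list \<times> 'i list \<times> (nat + ('k \<times> 'i) option) list \<times> ('i list \<Rightarrow> bool)) set"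
  assumes S: "finite S" "\<And>\<beta>. \<beta> \<in> S \<Longrightarrow> Linear_order (r \<beta>)" "\<And>\<beta>. \<beta> \<in> S \<Longrightarrow> infinite (Field (r \<beta>))"
    and Y: "\<And>\<beta>. \<beta> \<in> S \<Longrightarrow> finite (Y \<beta>)" "\<And>\<beta>. \<beta> \<in> S \<Longrightarrow> Y \<beta> \<subseteq> Field (r \<beta>)"
    and \<Q>: "finite \<Q>" "\<And>\<alpha> is js ts \<Phi>. (\<alpha>, is, js, ts, \<Phi>) \<in> \<Q> \<Longrightarrow>
      \<alpha> \<in> S \<and> increasing (r \<alpha>) is \<and> increasing (r \<alpha>) js \<and> length is = length js \<and>
      set is \<union> set js \<subseteq> Y \<alpha> \<and> (\<forall>k. Inl k \<in> set ts \<longrightarrow> k < length is) \<and>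
      (\<forall>\<beta> i. Inr (Some (\<beta>, i)) \<in> set ts \<longrightarrow> \<beta> \<in> S \<and> \<beta> \<noteq> \<alpha> \<and> i \<in> Y \<beta>)"
  obtains g where "\<And>\<beta> i. \<beta> \<in> S \<Longrightarrow> i \<in> Y \<beta> \<Longrightarrow> g \<beta> i \<in> Field (r \<beta>)"
    "\<And>\<beta> i i'. \<beta> \<in> S \<Longrightarrow> i \<in> Y \<beta> \<Longrightarrow> i' \<in> Y \<beta> \<Longrightarrow> (i, i') \<in> r \<beta> \<Longrightarrow> i \<noteq> i' \<Longrightarrow>
      (g \<beta> i, g \<beta> i') \<in> r \<beta> \<and> g \<beta> i \<noteq> g \<beta> i'"
    "\<And>\<alpha> is js ts \<Phi>. (\<alpha>, is, js, ts, \<Phi>) \<in> \<Q> \<Longrightarrow>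
      \<Phi> (map (substituted g \<alpha> is) ts) \<longleftrightarrow> \<Phi> (map (substituted g \<alpha> js) ts)"
proof -
  have "\<forall>\<beta> \<in> S. \<exists>\<iota> :: nat \<Rightarrow> 'i. range \<iota> \<subseteq> Field (r \<beta>) \<and>
    ((\<forall>i j. i < j \<longrightarrow> (\<iota> i, \<iota> j) \<in> r \<beta> \<and> \<iota> i \<noteq> \<iota> j) \<or> (\<forall>i j. i < j \<longrightarrow> (\<iota> j, \<iota> i) \<in> r \<beta> \<and> \<iota> i \<noteq> \<iota> j))"
  proof
    fix \<beta>
    assume \<beta>: "\<beta> \<in> S"
    from infinite_linear_order_monotone_sequence[OF S(2)[OF \<beta>] S(3)[OF \<beta>]]
    show "\<exists>\<iota> :: nat \<Rightarrow> 'i. range \<iota> \<subseteq> Field (r \<beta>) \<and>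
      ((\<forall>i j. i < j \<longrightarrow> (\<iota> i, \<iota> j) \<in> r \<beta> \<and> \<iota> i \<noteq> \<iota> j) \<or> (\<forall>i j. i < j \<longrightarrow> (\<iota> j, \<iota> i) \<in> r \<beta> \<and> \<iota> i \<noteq> \<iota> j))"
      by metis
  qed
  then obtain \<iota> :: "'k \<Rightarrow> nat \<Rightarrow> 'i" where \<iota>: "\<forall>\<beta> \<in> S. range (\<iota> \<beta>) \<subseteq> Field (r \<beta>) \<and>
    ((\<forall>i j. i < j \<longrightarrow> (\<iota> \<beta> i, \<iota> \<beta> j) \<in> r \<beta> \<and> \<iota> \<beta> i \<noteq> \<iota> \<beta> j) \<or>
     (\<forall>i j. i < j \<longrightarrow> (\<iota> \<beta> j, \<iota> \<beta> i) \<in> r \<beta> \<and> \<iota> \<beta> i \<noteq> \<iota> \<beta> j))"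
    by (rule bchoice[THEN exE])
  define up where "up \<beta> \<longleftrightarrow> (\<forall>i j. i < j \<longrightarrow> (\<iota> \<beta> i, \<iota> \<beta> j) \<in> r \<beta> \<and> \<iota> \<beta> i \<noteq> \<iota> \<beta> j)" for \<beta>
  have up: "(\<iota> \<beta> i, \<iota> \<beta> j) \<in> r \<beta> \<and> \<iota> \<beta> i \<noteq> \<iota> \<beta> j" if "up \<beta>" "i < j" for \<beta> i j
    using that by (simp add: up_def)
  have down: "(\<iota> \<beta> j, \<iota> \<beta> i) \<in> r \<beta> \<and> \<iota> \<beta> i \<noteq> \<iota> \<beta> j" if "\<beta> \<in> S" "\<not> up \<beta>" "i < j" for \<beta> i j
    using \<iota> that unfolding up_def by blast
  have "\<forall>\<beta> \<in> S. \<exists>u. increasing (r \<beta>) u \<and> set u = Y \<beta>"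
    using increasing_enumeration[OF S(2) Y] by (intro ballI)
  then obtain u where u: "\<forall>\<beta> \<in> S. increasing (r \<beta>) (u \<beta>) \<and> set (u \<beta>) = Y \<beta>"
    by (rule bchoice[THEN exE])
  define rk where "rk \<beta> i = (SOME k. k < length (u \<beta>) \<and> u \<beta> ! k = i)" for \<beta> i
  have rk: "rk \<beta> i < length (u \<beta>)" "u \<beta> ! rk \<beta> i = i" if "\<beta> \<in> S" "i \<in> Y \<beta>" for \<beta> i
  proof -
    have "i \<in> set (u \<beta>)" using that u by blast
    then have "\<exists>k. k < length (u \<beta>) \<and> u \<beta> ! k = i"
      unfolding in_set_conv_nth .
    from someI_ex[OF this] show "rk \<beta> i < length (u \<beta>)" "u \<beta> ! rk \<beta> i = i"
      unfolding rk_def by blast+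
  qed
  have rk_mono: "rk \<beta> i < rk \<beta> i'" if "\<beta> \<in> S" "i \<in> Y \<beta>" "i' \<in> Y \<beta>" "(i, i') \<in> r \<beta>" "i \<noteq> i'" for \<beta> i i'
  proof (rule ccontr)
    assume "\<not> rk \<beta> i < rk \<beta> i'"
    then have "rk \<beta> i' < rk \<beta> i"
      using rk[OF that(1,2)] rk[OF that(1,3)] that(5) by (metis linorder_neqE_nat)
    moreover have "\<forall>k k'. k < k' \<longrightarrow> k' < length (u \<beta>) \<longrightarrow> (u \<beta> ! k, u \<beta> ! k') \<in> r \<beta>"
      using u that(1) unfolding increasing_def sorted_wrt_iff_nth_less by blast
    ultimately have "(u \<beta> ! rk \<beta> i', u \<beta> ! rk \<beta> i) \<in> r \<beta>"
      using rk(1)[OF that(1,2)] by blast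
    then have "(i', i) \<in> r \<beta>"
      using rk(2)[OF that(1,2)] rk(2)[OF that(1,3)] by simp
    moreover have "antisym (r \<beta>)" using S(2)[OF that(1)] by (simp add: order_on_defs)
    ultimately show False using that(4,5) by (meson antisymD)
  qed
  define N where "N = Suc (\<Sum>\<beta>\<in>S. length (u \<beta>))"
  have N: "rk \<beta> i < N" if "\<beta> \<in> S" "i \<in> Y \<beta>" for \<beta> i
  proof -
    have "length (u \<beta>) \<le> (\<Sum>\<beta>\<in>S. length (u \<beta>))"
      using S(1) that(1) by (intro member_le_sum) auto
    with rk(1)[OF that] show ?thesis by (simp add: N_def)
  qed
  obtain s :: "'k \<Rightarrow> nat" where s: "inj_on s S"
    using finite_imp_inj_to_nat_seg[OF S(1)] by blast
  \<comment> \<open>The number \<open>0\<close> is reserved for arguments without index; the intervals have length \<open>N\<close>.\<close>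
  define pos where "pos \<beta> i = (if up \<beta> then rk \<beta> i else N - 1 - rk \<beta> i)" for \<beta> i
  define code where "code \<beta> i = Suc (s \<beta> * N + pos \<beta> i)" for \<beta> i
  have pos: "pos \<beta> i < N" if "\<beta> \<in> S" "i \<in> Y \<beta>" for \<beta> i
    using N[OF that] by (auto simp: pos_def)
  have same_block: "code \<beta> i < code \<beta> i' \<longleftrightarrow> (if up \<beta> then rk \<beta> i < rk \<beta> i' else rk \<beta> i' < rk \<beta> i)"
    if "\<beta> \<in> S" "i \<in> Y \<beta>" "i' \<in> Y \<beta>" for \<beta> i i'
    using N[OF that(1,2)] N[OF that(1,3)] by (auto simp: code_def pos_def)
  have other_block: "code \<beta> i < code \<beta>' i' \<longleftrightarrow> s \<beta> < s \<beta>'"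
    if "\<beta> \<in> S" "\<beta>' \<in> S" "\<beta> \<noteq> \<beta>'" "i \<in> Y \<beta>" "i' \<in> Y \<beta>'" for \<beta> \<beta>' i i'
  proof -
    have less: "a * N + p < b * N + q" if "a < b" "p < N" for a b p q :: nat
    proof -
      have "a * N + p < a * N + N" using that by simp
      also have "\<dots> = Suc a * N" by simp
      also have "\<dots> \<le> b * N" using that(1) by (intro mult_le_mono1) simp
      finally show ?thesis by simp
    qed
    have "s \<beta> \<noteq> s \<beta>'" using s that by (meson inj_on_eq_iff)
    then consider "s \<beta> < s \<beta>'" | "s \<beta>' < s \<beta>" by linarith
    then show ?thesis
    proof cases
      case 1
      then show ?thesis using less[OF 1 pos[OF that(1,4)], of "pos \<beta>' i'"] by (simp add: code_def)
    next
      case 2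
      then show ?thesis using less[OF 2 pos[OF that(2,5)], of "pos \<beta> i"] by (simp add: code_def)
    qed
  qed
  define tcode where "tcode \<alpha> is t = (case t of Inl k \<Rightarrow> code \<alpha> (is ! k) | Inr None \<Rightarrow> 0 | Inr (Some (\<beta>, i)) \<Rightarrow> code \<beta> i)"
    for \<alpha> "is" and t :: "nat + ('k \<times> 'i) option"
  define decode where "decode \<alpha> t z = (case t of Inl k \<Rightarrow> \<iota> \<alpha> z | Inr None \<Rightarrow> undefined | Inr (Some (\<beta>, i)) \<Rightarrow> \<iota> \<beta> z)"
    for \<alpha> and t :: "nat + ('k \<times> 'i) option" and z
  define \<P> where "\<P> = (\<lambda>(\<alpha>, is, js, ts, \<Phi>). (length ts, \<lambda>w. \<Phi> (map2 (decode \<alpha>) ts w))) ` \<Q>"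
  have "finite \<P>" using \<Q>(1) by (simp add: \<P>_def)
  then obtain h :: "nat \<Rightarrow> nat" where h: "strict_mono h" and hom: "\<And>k \<Phi> u f. (k, \<Phi>) \<in> \<P> \<Longrightarrow>
    length u = k \<Longrightarrow> strict_mono_on (set u) f \<Longrightarrow> \<Phi> (map h u) \<longleftrightarrow> \<Phi> (map h (map f u))"
    by (rule Ramsey_order_isomorphic_lists) (rule that)
  define g where "g \<beta> i = \<iota> \<beta> (h (code \<beta> i))" for \<beta> i
  show thesis
  proof (rule that[of g])
    show "g \<beta> i \<in> Field (r \<beta>)" if "\<beta> \<in> S" "i \<in> Y \<beta>" for \<beta> i
      using \<iota> that(1) unfolding g_def by blast
    show "(g \<beta> i, g \<beta> i') \<in> r \<beta> \<and> g \<beta> i \<noteq> g \<beta> i'"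
      if i: "\<beta> \<in> S" "i \<in> Y \<beta>" "i' \<in> Y \<beta>" "(i, i') \<in> r \<beta>" "i \<noteq> i'" for \<beta> i i'
    proof (cases "up \<beta>")
      case True
      then have "h (code \<beta> i) < h (code \<beta> i')"
        using rk_mono[OF i] same_block[OF i(1-3)] h by (simp add: strict_mono_less)
      with up[OF True] show ?thesis by (simp add: g_def)
    next
      case False
      then have "h (code \<beta> i') < h (code \<beta> i)"
        using rk_mono[OF i] same_block[OF i(1,3,2)] h by (simp add: strict_mono_less)
      with down[OF i(1) False] show ?thesis by (metis g_def)
    qed
    fix \<alpha> "is" js ts \<Phi>
    assume q: "(\<alpha>, is, js, ts, \<Phi>) \<in> \<Q>"
    note Q = \<Q>(2)[OF q]
    have \<alpha>: "\<alpha> \<in> S" using Q by blast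
    have nth: "is ! k \<in> Y \<alpha>" "js ! k \<in> Y \<alpha>" if "k < length is" for k
      using Q that by (metis UnCI nth_mem subsetD)+
    have ts: "\<And>k. Inl k \<in> set ts \<Longrightarrow> k < length is"
      "\<And>\<beta> i. Inr (Some (\<beta>, i)) \<in> set ts \<Longrightarrow> \<beta> \<in> S \<and> \<beta> \<noteq> \<alpha> \<and> i \<in> Y \<beta>"
      using Q by blast+
    have rk_nth: "rk \<alpha> (v ! k) < rk \<alpha> (v ! k') \<longleftrightarrow> k < k'"
      if "k < length v" "k' < length v" "increasing (r \<alpha>) v" "set v \<subseteq> Y \<alpha>" for v k k'
    proof -
      have lt: "rk \<alpha> (v ! a) < rk \<alpha> (v ! b)" if "a < b" "b < length v" for a b
        using rk_mono[OF \<alpha>, of "v ! a" "v ! b"] \<open>increasing (r \<alpha>) v\<close> \<open>set v \<subseteq> Y \<alpha>\<close> that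
        unfolding increasing_def sorted_wrt_iff_nth_less by (metis nth_mem order.strict_trans subsetD)
      show ?thesis using lt[of k k'] lt[of k' k] that(1,2) by (metis less_irrefl linorder_neqE_nat order_less_trans)
    qed
    have same: "tcode \<alpha> is t < tcode \<alpha> is t' \<longleftrightarrow> tcode \<alpha> js t < tcode \<alpha> js t'"
      if t: "t \<in> set ts" "t' \<in> set ts" for t t'
    proof -
      have pos_code: "0 < code \<beta> i" for \<beta> i by (simp add: code_def)
      consider (kk) k k' where "t = Inl k" "t' = Inl k'"
        | (kN) k where "t = Inl k" "t' = Inr None"
        | (kS) k \<beta> i where "t = Inl k" "t' = Inr (Some (\<beta>, i))"
        | (Nk) k where "t = Inr None" "t' = Inl k"
        | (Sk) k \<beta> i where "t = Inr (Some (\<beta>, i))" "t' = Inl k"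
        | (rr) o1 o2 where "t = Inr o1" "t' = Inr o2"
        by (metis option.exhaust old.sum.exhaust surj_pair)
      then show ?thesis
      proof cases
        case kk
        then have k: "k < length is" "k' < length is" using ts(1) t by blast+
        show ?thesis
          unfolding tcode_def kk old.sum.case
          using same_block[OF \<alpha> nth(1)[OF k(1)] nth(1)[OF k(2)]] same_block[OF \<alpha> nth(2)[OF k(1)] nth(2)[OF k(2)]]
            rk_nth[of k "is" k'] rk_nth[of k js k'] rk_nth[of k' "is" k] rk_nth[of k' js k] Q k by auto
      next
        case kS
        then have "k < length is" "\<beta> \<in> S" "\<beta> \<noteq> \<alpha>" "i \<in> Y \<beta>" using ts t by blast+
        then show ?thesis
          using other_block[OF \<alpha>, of \<beta> _ i] nth by (simp add: tcode_def kS)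
      next
        case Sk
        then have "k < length is" "\<beta> \<in> S" "\<beta> \<noteq> \<alpha>" "i \<in> Y \<beta>" using ts t by blast+
        then show ?thesis
          using other_block[of \<beta> \<alpha> i] \<alpha> nth by (simp add: tcode_def Sk)
      qed (simp_all add: tcode_def pos_code)
    qed
    obtain f where f: "strict_mono_on (tcode \<alpha> is ` set ts) f" "\<And>t. t \<in> set ts \<Longrightarrow> f (tcode \<alpha> is t) = tcode \<alpha> js t"
      using order_isomorphism_of_same_order[of "set ts" "tcode \<alpha> is" "tcode \<alpha> js"] same by blast
    have P: "(length ts, \<lambda>w. \<Phi> (map2 (decode \<alpha>) ts w)) \<in> \<P>"
      unfolding \<P>_def using q by force
    have eq: "map2 (decode \<alpha>) ts (map h (map (tcode \<alpha> v) ts)) = map (substituted g \<alpha> v) ts" for v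
      by (induction ts) (auto simp: decode_def substituted_def tcode_def g_def split: sum.split option.split)
    have "map f (map (tcode \<alpha> is) ts) = map (tcode \<alpha> js) ts" using f(2) by simp
    with hom[OF P, of "map (tcode \<alpha> is) ts" f] f(1) show
      "\<Phi> (map (substituted g \<alpha> is) ts) \<longleftrightarrow> \<Phi> (map (substituted g \<alpha> js) ts)"
      unfolding eq by (simp only: length_map set_map eq)
  qed
qed

section \<open>The independence property\<close>

lemma pfmsD: "q \<in> pfms L n B \<Longrightarrow> set (snd q) \<subseteq> B \<and> fst q \<in> fms L (n + length (snd q))"
  by (auto simp: pfms_def)

lemma definable_const: "definable L V (\<lambda>M e. b)"
  using definable_True[of L V] definable_not[OF definable_True[of L V]] by (cases b) simp_all

lemma map_case_sum_tuple: "y \<in> tuples M m \<Longrightarrow> map (case_sum e ((!) y)) (map Inr [0..<m] @ map Inl zs) = y @ map e zs"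
  by (auto simp: tuples_def comp_def map_nth)

text \<open>
  That some \<open>y\<close> realizes a given pattern on an initial segment of the sequence is a definable condition
  on the entries of the sequence. Hence the sequence is obtained from compactness.
\<close>

lemma (in monster) has_IP_if_finitely:
  assumes \<Sigma>: "\<Sigma> \<subseteq> pfms L n B" and B: "B \<subseteq> univ M" "small B" and \<phi>: "\<phi> \<in> fms L (m + n)"
    and fin: "\<And>(N :: nat) \<Sigma>0. finite \<Sigma>0 \<Longrightarrow> \<Sigma>0 \<subseteq> \<Sigma> \<Longrightarrow> \<exists>a. (\<forall>i<N. realizes M n \<Sigma>0 (a i)) \<and>
      (\<forall>s. \<exists>y \<in> tuples M m. \<forall>i<N. holds M \<phi> (y @ a i) \<longleftrightarrow> i \<in> s)"
  shows "has_IP L M n \<Sigma>"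
proof -
  define V :: "(nat \<times> nat + 'a) set" where "V = (UNIV \<times> {..<n}) <+> B"
  define xs :: "nat \<Rightarrow> (nat \<times> nat + 'a) list" where "xs i = map (\<lambda>l. Inl (i, l)) [0..<n]" for i
  have xsV: "set (xs i) \<subseteq> V" and len_xs: "length (xs i) = n" for i
    by (auto simp: xs_def V_def)
  define P1 where "P1 = (\<lambda>(i, q) (M :: ('f, 'r, 'a) struct) e. holds M (fst q) (map e (xs i @ map Inr (snd q))))"
  define P2 where "P2 = (\<lambda>(N, s) (M :: ('f, 'r, 'a) struct) e. \<exists>y \<in> tuples M m. \<forall>i \<in> {..<N :: nat}.
    holds M \<phi> (map (case_sum e ((!) y)) (map Inr [0..<m] @ map Inl (xs i))) \<longleftrightarrow> i \<in> s)"
  have "\<exists>e. e ` V \<subseteq> univ M \<and> (\<forall>v \<in> Inr ` B. e v = case_sum undefined id v) \<and>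
      (\<forall>P \<in> P1 ` (UNIV \<times> \<Sigma>) \<union> range P2. P M e)"
  proof (rule compactness[of V "Inr ` B" "case_sum undefined id" "P1 ` (UNIV \<times> \<Sigma>) \<union> range P2"])
    show "small V"
      unfolding V_def by (intro small_Plus B small_countable) simp
    show "Inr ` B \<subseteq> V" "case_sum undefined id ` Inr ` B \<subseteq> univ M"
      using B by (auto simp: V_def)
    fix P
    assume "P \<in> P1 ` (UNIV \<times> \<Sigma>) \<union> range P2"
    then consider i q where "q \<in> \<Sigma>" "P = P1 (i, q)" | N s where "P = P2 (N, s)"
      by (elim UnE imageE SigmaE) (auto split: prod.splits)
    then show "definable L V P"
    proof cases
      case (1 i q)
      then have "fst q \<in> fms L (n + length (snd q))" "set (snd q) \<subseteq> B"
        using \<Sigma> pfmsD by blast+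
      then show ?thesis
        unfolding 1(2) P1_def prod.case using xsV[of i] len_xs[of i]
        by (intro definable_holds) (auto simp: V_def)
    next
      case (2 N s)
      show ?thesis
        unfolding 2 P2_def prod.case
      proof (intro definable_exists_tuple definable_Ball definable_iff definable_const definable_holds)
        fix i
        show "\<phi> \<in> fms L (length (map Inr [0..<m] @ map Inl (xs i)))"
          using \<phi> by (simp add: len_xs)
        show "set (map Inr [0..<m] @ map Inl (xs i)) \<subseteq> V <+> {..<m}"
          using xsV[of i] by auto
      qed simp
    qed
  next
    fix F0
    assume F0: "finite F0" "F0 \<subseteq> P1 ` (UNIV \<times> \<Sigma>) \<union> range P2"
    then have "finite (F0 \<inter> P1 ` (UNIV \<times> \<Sigma>))" "F0 \<inter> P1 ` (UNIV \<times> \<Sigma>) \<subseteq> P1 ` (UNIV \<times> \<Sigma>)"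
      "finite (F0 \<inter> range P2)" "F0 \<inter> range P2 \<subseteq> range P2" by auto
    then obtain I0 J0 where I0: "finite I0" "I0 \<subseteq> UNIV \<times> \<Sigma>" "F0 \<inter> P1 ` (UNIV \<times> \<Sigma>) = P1 ` I0"
      and J0: "finite J0" "F0 \<inter> range P2 = P2 ` J0"
      by (meson finite_subset_image)
    define N where "N = Suc (Max (insert 0 (fst ` I0 \<union> fst ` J0)))"
    have N: "i < N" if "i \<in> fst ` I0 \<union> fst ` J0" for i
      unfolding N_def using that I0(1) J0(1) by (intro le_imp_less_Suc Max_ge) auto
    have N0: "0 < N" by (simp add: N_def)
    have "finite (snd ` I0)" "snd ` I0 \<subseteq> \<Sigma>" using I0 by auto
    from fin[OF this, of N] obtain a where a: "\<forall>i<N. realizes M n (snd ` I0) (a i)"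
      and sh: "\<forall>s. \<exists>y \<in> tuples M m. \<forall>i<N. holds M \<phi> (y @ a i) \<longleftrightarrow> i \<in> s" by blast
    have a_tup: "a i \<in> tuples M n" if "i < N" for i using a that by (simp add: realizes_def)
    define e where "e = case_sum (\<lambda>(i, l). a (if i < N then i else 0) ! l) id"
    have xs: "map e (xs i) = a i" if "i < N" for i
      using that a_tup[OF that] by (auto simp: e_def xs_def tuples_def comp_def map_nth)
    have "e ` V \<subseteq> univ M"
    proof
      fix z
      assume "z \<in> e ` V"
      then obtain v where v: "v \<in> V" "z = e v" by blast
      show "z \<in> univ M"
      proof (cases v)
        case (Inl w)
        obtain i l where w: "w = (i, l)" by (cases w)
        then have l: "l < n" using v Inl by (auto simp: V_def)
        define j where "j = (if i < N then i else 0)"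
        have "j < N" using N0 by (simp add: j_def)
        with a_tup[OF this] l have "a j ! l \<in> univ M"
          by (auto simp: tuples_def)
        then show ?thesis using v Inl w by (simp add: e_def j_def)
      qed (use v B in \<open>auto simp: V_def e_def\<close>)
    qed
    moreover have "\<forall>v \<in> Inr ` B. e v = case_sum undefined id v" by (auto simp: e_def)
    moreover have "P M e" if "P \<in> F0" for P
    proof -
      have "P \<in> P1 ` I0 \<or> P \<in> P2 ` J0"
        using that F0(2) I0(3) J0(2) by blast
      then consider i q where "(i, q) \<in> I0" "P = P1 (i, q)" | K s where "(K, s) \<in> J0" "P = P2 (K, s)"
        by (elim disjE imageE) auto
      then show ?thesis
      proof cases
        case (1 i q)
        then have i: "i < N" by (intro N) force
        have "map e (map Inr (snd q)) = snd q" by (simp add: e_def comp_def)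
        moreover have "q \<in> snd ` I0" using 1(1) by force
        then have "holds M (fst q) (a i @ snd q)"
          using a i unfolding realizes_def by (auto split: prod.splits)
        ultimately show ?thesis
          unfolding 1(2) P1_def prod.case map_append xs[OF i] by simp
      next
        case (2 K s)
        then have K: "K < N" by (intro N) force
        obtain y where y: "y \<in> tuples M m" "\<forall>i<N. holds M \<phi> (y @ a i) \<longleftrightarrow> i \<in> s"
          using sh by blast
        show ?thesis
          unfolding 2(2) P2_def prod.case map_case_sum_tuple[OF y(1)]
        proof (intro bexI[of _ y] ballI)
          show "holds M \<phi> (map (case_sum e ((!) y)) (map Inr [0..<m] @ map Inl (xs i))) \<longleftrightarrow> i \<in> s"
            if "i \<in> {..<K}" for i
            unfolding map_case_sum_tuple[OF y(1)] using xs[of i] y(2) that K by simp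
        qed (rule y(1))
      qed
    qed
    ultimately show "\<exists>e. e ` V \<subseteq> univ M \<and> (\<forall>v \<in> Inr ` B. e v = case_sum undefined id v) \<and> (\<forall>P \<in> F0. P M e)"
      by blast
  qed
  then obtain e where e: "e ` V \<subseteq> univ M" "\<forall>v \<in> Inr ` B. e v = case_sum undefined id v"
    "\<forall>P \<in> P1 ` (UNIV \<times> \<Sigma>) \<union> range P2. P M e"
    by blast
  define a where "a i = map e (xs i)" for i
  have "realizes M n \<Sigma> (a i)" for i
    unfolding realizes_def
  proof (intro conjI ballI)
    show "a i \<in> tuples M n"
      using e(1) xsV[of i] by (auto simp: a_def tuples_def len_xs)
    fix q
    assume q: "q \<in> \<Sigma>"
    then have "set (snd q) \<subseteq> B" using \<Sigma> pfmsD by blast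
    then have "map e (map Inr (snd q)) = snd q"
      using e(2) by (auto simp: map_idI subset_eq)
    moreover have "P1 (i, q) M e" using e(3) q by blast
    ultimately show "case q of (\<phi>, b) \<Rightarrow> holds M \<phi> (a i @ b)"
      by (cases q) (simp add: P1_def a_def)
  qed
  moreover have "consistent M m (range (\<lambda>i. (if i \<in> s then \<phi> else Neg \<phi>, a i)))" for s
    unfolding consistent_def
  proof (intro allI impI)
    fix F
    assume F: "finite F \<and> F \<subseteq> range (\<lambda>i. (if i \<in> s then \<phi> else Neg \<phi>, a i))"
    then obtain J where J: "finite J" "F = (\<lambda>i. (if i \<in> s then \<phi> else Neg \<phi>, a i)) ` J"
      by (meson finite_subset_image)
    obtain N where N: "J \<subseteq> {..<N}" using J(1) finite_nat_iff_bounded by blast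
    have "P2 (N, s) M e" using e(3) by blast
    then obtain y where y: "y \<in> tuples M m" "\<forall>i \<in> {..<N}. holds M \<phi> (y @ a i) \<longleftrightarrow> i \<in> s"
      unfolding P2_def prod.case a_def using map_case_sum_tuple by (metis (no_types, lifting))
    then have "realizes M m F y"
      using N by (auto simp: realizes_def J(2) holds_def)
    then show "\<exists>a. realizes M m F a" ..
  qed
  ultimately show ?thesis
    unfolding has_IP_def using \<phi> by blast
qed

locale generically_stable_extension =
  generically_stable_type L T \<mu> C A n p + Ext: monster L T \<mu>' C'
  for L :: "('f, 'r) lang" and T :: "('f, 'r) fm set" and \<mu> :: "'m rel" and C :: "('f, 'r, 'a) struct"
    and A :: "'a set" and n :: nat and p :: "('f, 'r, 'a) pfm set" and \<mu>' :: "'n rel"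
    and C' :: "('f, 'r, 'a) struct" +
  assumes elem: "elem_sub L C C'" and univ_small: "|univ C| <o \<mu>'"
begin

lemma univ_subset: "univ C \<subseteq> univ C'"
  using elem by (simp add: elem_sub_def)

lemma holds_extension: "set as \<subseteq> univ C \<Longrightarrow> \<phi> \<in> fms L (length as) \<Longrightarrow> holds C' \<phi> as \<longleftrightarrow> holds C \<phi> as"
  using elem by (simp add: elem_sub_def)

lemma tuples_extension: "tuples C k \<subseteq> tuples C' k"
  using univ_subset by (auto simp: tuples_def)

lemma realizes_extension:
  assumes "realizes C k \<Sigma> x" "\<Sigma> \<subseteq> pfms L k (univ C)"
  shows "realizes C' k \<Sigma> x"
  unfolding realizes_def
proof (intro conjI ballI)
  have x: "x \<in> tuples C k" using assms(1) by (simp add: realizes_def)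
  then show "x \<in> tuples C' k" using tuples_extension by blast
  fix q
  assume q: "q \<in> \<Sigma>"
  obtain \<phi> b where [simp]: "q = (\<phi>, b)" by force
  have "holds C \<phi> (x @ b)" using q assms(1) by (auto simp: realizes_def)
  moreover have "set (x @ b) \<subseteq> univ C" "\<phi> \<in> fms L (length (x @ b))"
    using q assms(2) x by (auto simp: pfms_def tuples_def)
  ultimately show "case q of (\<phi>, b) \<Rightarrow> holds C' \<phi> (x @ b)"
    using holds_extension by simp
qed

text \<open>
  A sequence of realizations of the restriction that is shattered by \<open>\<phi>\<close> is thinned out and moved over
  \<open>A\<close> so that all its members satisfy a given formula \<open>\<theta>(x, d)\<close> of \<open>p\<close>; it remains shattered by
  \<open>\<phi>\<close>.
\<close>

theorem NIP_restrict:
  assumes "NIP L C' n p"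
  shows "NIP L C n (restrict_type p A)"
  unfolding NIP_def
proof
  assume "has_IP L C n (restrict_type p A)"
  then obtain m \<phi> and a :: "nat \<Rightarrow> 'a list" where \<phi>: "\<phi> \<in> fms L (m + n)"
    and a: "\<And>i. generic A (a i)"
    and con: "\<And>s. consistent C m (range (\<lambda>i. (if i \<in> s then \<phi> else Neg \<phi>, a i)))"
    unfolding has_IP_def by blast
  have "has_IP L C' n p"
  proof (rule Ext.has_IP_if_finitely[OF p_subset univ_subset univ_small \<phi>])
    fix N \<Sigma>0
    assume \<Sigma>0: "finite \<Sigma>0" "\<Sigma>0 \<subseteq> p"
    have "\<Sigma>0 \<subseteq> restrict_type p (univ C)"
      using \<Sigma>0(2) p_subset by (fastforce simp: restrict_type_def pfms_def)
    then obtain \<theta> d where \<theta>: "(\<theta>, d) \<in> p" "\<And>x. x \<in> tuples C n \<Longrightarrow> holds C \<theta> (x @ d) \<Longrightarrow> realizes C n \<Sigma>0 x"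
      using p_conj[OF \<Sigma>0(1) _ order_refl] restrict_subset(2) by blast
    have d: "set d \<subseteq> univ C" "\<theta> \<in> fms L (n + length d)"
      using \<theta>(1) p_subset by (auto simp: pfms_def)
    obtain D where D: "finite D" "D \<subseteq> conjugates d" "\<And>x. generic A x \<Longrightarrow> \<exists>d' \<in> D. holds C \<theta> (x @ d')"
      using covered_by_conjugates[OF \<theta>(1)] by blast
    \<comment> \<open>Infinitely many members of the shattered sequence satisfy the same conjugate of \<open>\<theta>(x, d)\<close>.\<close>
    have "\<exists>d' \<in> D. infinite {i. holds C \<theta> (a i @ d')}"
    proof (rule ccontr)
      assume "\<not> ?thesis"
      then have "finite (\<Union>d' \<in> D. {i. holds C \<theta> (a i @ d')})" using D(1) by blast
      moreover have "(\<Union>d' \<in> D. {i. holds C \<theta> (a i @ d')}) = UNIV" using D(3)[OF a] by blast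
      ultimately show False by simp
    qed
    then obtain d' where d': "d' \<in> D" and inf: "infinite {i. holds C \<theta> (a i @ d')}" by blast
    obtain \<sigma> where \<sigma>: "\<sigma> \<in> aut_fixing A" "d' = map \<sigma> d"
      using d' D(2) by (auto simp: conjugates_def)
    obtain \<tau> where \<tau>: "\<tau> \<in> aut_fixing A" "\<And>z. z \<in> univ C \<Longrightarrow> \<tau> (\<sigma> z) = z"
      using inverse_aut[OF \<sigma>(1) A(1)] by blast
    have \<tau>d: "map \<tau> d' = d" using \<sigma>(2) \<tau>(2) d(1) by (auto simp: map_idI subset_eq)
    have d'u: "set d' \<subseteq> univ C" using \<sigma> d(1) aut_in_univ by auto
    have len: "length d' = length d" using \<sigma>(2) by simp
    define h where "h = enumerate {i. holds C \<theta> (a i @ d')}"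
    have h: "inj h" "\<And>k. holds C \<theta> (a (h k) @ d')"
      using inf enumerate_in_set[OF inf] strict_mono_enumerate[OF inf]
      by (auto simp: h_def strict_mono_imp_inj_on)
    define a' where "a' k = map \<tau> (a (h k))" for k
    have a_tup: "a i \<in> tuples C n" for i using a by (rule generic_tuple)
    have a'_tup: "a' k \<in> tuples C n" for k
      unfolding a'_def using aut_tuples[OF \<tau>(1)] a_tup by blast
    have "realizes C n \<Sigma>0 (a' k)" for k
    proof (rule \<theta>(2)[OF a'_tup])
      have "holds C \<theta> (map \<tau> (a (h k) @ d')) \<longleftrightarrow> holds C \<theta> (a (h k) @ d')"
        by (rule aut_holds[OF \<tau>(1)]) (use d(2) a_tup d'u len in \<open>auto simp: tuples_def\<close>)
      then show "holds C \<theta> (a' k @ d)"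
        using h(2)[of k] \<tau>d by (simp add: a'_def)
    qed
    then have "realizes C' n \<Sigma>0 (a' k)" for k
      using realizes_extension \<Sigma>0(2) p_subset by (meson subset_trans)
    moreover have "\<exists>y \<in> tuples C' m. \<forall>k<N. holds C' \<phi> (y @ a' k) \<longleftrightarrow> k \<in> s" for s
    proof -
      let ?F = "(\<lambda>i. (if i \<in> h ` s then \<phi> else Neg \<phi>, a i)) ` h ` {..<N}"
      have "finite ?F \<and> ?F \<subseteq> range (\<lambda>i. (if i \<in> h ` s then \<phi> else Neg \<phi>, a i))" by auto
      then obtain y where y: "realizes C m ?F y"
        using con[of "h ` s"] unfolding consistent_def by meson
      then have y_tup: "y \<in> tuples C m" by (simp add: realizes_def)
      have iff: "holds C \<phi> (y @ a (h k)) \<longleftrightarrow> k \<in> s" if "k < N" for k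
      proof -
        have "holds C (if h k \<in> h ` s then \<phi> else Neg \<phi>) (y @ a (h k))"
          using y that by (auto simp: realizes_def)
        moreover have "h k \<in> h ` s \<longleftrightarrow> k \<in> s" using h(1) by (simp add: inj_image_mem_iff)
        ultimately show ?thesis by (auto simp: holds_def split: if_splits)
      qed
      have "holds C' \<phi> (map \<tau> y @ a' k) \<longleftrightarrow> k \<in> s" if "k < N" for k
      proof -
        have "holds C \<phi> (map \<tau> (y @ a (h k))) \<longleftrightarrow> holds C \<phi> (y @ a (h k))"
          by (rule aut_holds[OF \<tau>(1)]) (use \<phi> y_tup a_tup in \<open>auto simp: tuples_def\<close>)
        moreover have "holds C' \<phi> (map \<tau> y @ a' k) \<longleftrightarrow> holds C \<phi> (map \<tau> y @ a' k)"
          by (rule holds_extension) (use \<phi> aut_tuples[OF \<tau>(1) y_tup] a'_tup[of k] in \<open>auto simp: tuples_def\<close>)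
        ultimately show ?thesis using iff[OF that] by (simp add: a'_def)
      qed
      moreover have "map \<tau> y \<in> tuples C' m"
        using aut_tuples[OF \<tau>(1) y_tup] tuples_extension by blast
      ultimately show ?thesis by blast
    qed
    ultimately show "\<exists>a. (\<forall>i<N. realizes C' n \<Sigma>0 (a i)) \<and>
      (\<forall>s. \<exists>y \<in> tuples C' m. \<forall>i<N. holds C' \<phi> (y @ a i) \<longleftrightarrow> i \<in> s)"
      by blast
  qed
  with assms show False by (simp add: NIP_def)
qed

end

section \<open>Mutually indiscernible sequences\<close>

lemma map_map_eq_of_concat:
  assumes "map f (concat xss) = concat yss" "length xss = length yss"
    and "\<And>xs ys. (xs, ys) \<in> set (zip xss yss) \<Longrightarrow> length xs = length ys"
  shows "map (map f) xss = yss"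
proof (rule concat_injective)
  show "concat (map (map f) xss) = concat yss" using assms(1) by (simp add: map_concat)
  show "\<forall>(x, y) \<in> set (zip (map (map f) xss) yss). length x = length y"
    using assms(3) by (auto simp: zip_map1)
qed (use assms(2) in simp)

lemma increasing_subset: "increasing r is \<Longrightarrow> set is \<subseteq> Field r"
  by (simp add: increasing_def)

context monster
begin

lemma is_seqD: "is_seq M m r I \<Longrightarrow> i \<in> Field r \<Longrightarrow> I i \<in> tuples M m"
  by (simp add: is_seq_def)

lemma length_concat_tuples:
  "(\<And>i. i \<in> set is \<Longrightarrow> I i \<in> tuples M m) \<Longrightarrow> length (concat (map I is)) = length is * m"
  by (induction "is") (auto simp: tuples_def)

lemma concat_tuples:
  "(\<And>i. i \<in> set is \<Longrightarrow> I i \<in> tuples M m) \<Longrightarrow> concat (map I is) \<in> tuples M (length is * m)"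
  using length_concat_tuples[of "is" I m] by (fastforce simp: tuples_def)

lemma indiscernible_aut:
  assumes ind: "indiscernible L M B r I" and seq: "is_seq M m r I"
    and inc: "increasing r is" "increasing r js" "length is = length js"
    and B0: "B0 \<subseteq> B" "B0 \<subseteq> univ M" "small B0"
  obtains \<sigma> where "\<sigma> \<in> aut_fixing B0" "map (map \<sigma>) (map I is) = map I js"
proof -
  have t: "I i \<in> tuples M m" if "i \<in> set is \<or> i \<in> set js" for i
    using that is_seqD[OF seq] inc(1,2)[THEN increasing_subset] by blast
  have x: "concat (map I is) \<in> tuples M (length is * m)"
    and y: "concat (map I js) \<in> tuples M (length is * m)"
    using concat_tuples[of "is" I m] concat_tuples[of js I m] t inc(3) by auto
  have tp: "tp L M (concat (map I is)) B = tp L M (concat (map I js)) B"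
    using ind inc unfolding indiscernible_def by blast
  obtain \<sigma> where \<sigma>: "\<sigma> \<in> aut_fixing B0" "map \<sigma> (concat (map I is)) = concat (map I js)"
  proof (rule aut_of_same_tuple_type[OF B0(2,3) x y])
    fix \<phi> b
    assume b: "(\<phi>, b) \<in> pfms L (length is * m) B0" "holds M \<phi> (concat (map I is) @ b)"
    then have "(\<phi>, b) \<in> tp L M (concat (map I is)) B"
      using x B0(1) by (auto simp: tp_def pfms_def tuples_def)
    then show "holds M \<phi> (concat (map I js) @ b)"
      unfolding tp by (simp add: tp_def)
  qed (rule that)
  have "length xs = length ys" if z: "(xs, ys) \<in> set (zip (map I is) (map I js))" for xs ys
  proof -
    have "xs \<in> set (map I is)" "ys \<in> set (map I js)"
      using z by (auto dest: set_zip_leftD set_zip_rightD)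
    then have "xs \<in> tuples M m" "ys \<in> tuples M m" using t by auto
    then show ?thesis by (simp add: tuples_def)
  qed
  then have "map (map \<sigma>) (map I is) = map I js"
    using map_map_eq_of_concat[OF \<sigma>(2)] inc(3) by simp
  with \<sigma>(1) show thesis by (rule that)
qed

text \<open>
  The sequences are moved one at a time. The last one is moved over the initial positions of the
  others, which its indiscernibility permits; the others are then moved over its final position.
\<close>

lemma mutually_indiscernible_aut:
  assumes mut: "mutually_indiscernible L M B K r I"
    and seq: "\<And>\<alpha>. \<alpha> \<in> K \<Longrightarrow> is_seq M (m \<alpha>) (r \<alpha>) (I \<alpha>)"
    and S: "finite S" "S \<subseteq> K"
    and inc: "\<And>\<alpha>. \<alpha> \<in> S \<Longrightarrow> increasing (r \<alpha>) (x \<alpha>) \<and> increasing (r \<alpha>) (y \<alpha>) \<and> length (x \<alpha>) = length (y \<alpha>)"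
    and B0: "B0 \<subseteq> B \<union> (\<Union>\<beta> \<in> K - S. entries (I \<beta>) (Field (r \<beta>)))" "B0 \<subseteq> univ M" "small B0"
  shows "\<exists>\<sigma> \<in> aut_fixing B0. \<forall>\<alpha> \<in> S. map (map \<sigma>) (map (I \<alpha>) (x \<alpha>)) = map (I \<alpha>) (y \<alpha>)"
  using S inc B0
proof (induction S arbitrary: B0 rule: finite_induct)
  case empty
  then show ?case using id_aut by auto
next
  case (insert \<beta> S)
  have \<beta>K: "\<beta> \<in> K" and SK: "S \<subseteq> K" using insert.prems(1) by auto
  have incS: "increasing (r \<alpha>) (x \<alpha>)" "increasing (r \<alpha>) (y \<alpha>)" "length (x \<alpha>) = length (y \<alpha>)"
    if "\<alpha> \<in> insert \<beta> S" for \<alpha>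
    using insert.prems(2)[OF that] by auto
  have Iu: "set (I \<alpha> i) \<subseteq> univ M" if "\<alpha> \<in> K" "i \<in> Field (r \<alpha>)" for \<alpha> i
    using is_seqD[OF seq[OF that(1)] that(2)] by (simp add: tuples_def)
  define B1 where "B1 = B0 \<union> (\<Union>\<alpha> \<in> S. entries (I \<alpha>) (set (x \<alpha>)))"
  define B2 where "B2 = B0 \<union> entries (I \<beta>) (set (y \<beta>))"
  have fin: "finite (\<Union>\<alpha> \<in> S. entries (I \<alpha>) (set (x \<alpha>)))" "finite (entries (I \<beta>) (set (y \<beta>)))"
    using insert.hyps(1) by (auto simp: entries_def)
  have xF: "set (x \<alpha>) \<subseteq> Field (r \<alpha>)" "set (y \<alpha>) \<subseteq> Field (r \<alpha>)" if "\<alpha> \<in> insert \<beta> S" for \<alpha>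
    using incS[OF that] increasing_subset by blast+
  have B1: "B1 \<subseteq> B \<union> (\<Union>\<gamma> \<in> K - {\<beta>}. entries (I \<gamma>) (Field (r \<gamma>)))"
  proof -
    have "B0 \<subseteq> B \<union> (\<Union>\<gamma> \<in> K - {\<beta>}. entries (I \<gamma>) (Field (r \<gamma>)))"
      using insert.prems(3) by blast
    moreover have "(\<Union>\<alpha> \<in> S. entries (I \<alpha>) (set (x \<alpha>))) \<subseteq> (\<Union>\<gamma> \<in> K - {\<beta>}. entries (I \<gamma>) (Field (r \<gamma>)))"
    proof (rule UN_mono)
      show "S \<subseteq> K - {\<beta>}" using SK insert.hyps(2) by blast
      show "entries (I \<alpha>) (set (x \<alpha>)) \<subseteq> entries (I \<alpha>) (Field (r \<alpha>))" if "\<alpha> \<in> S" for \<alpha>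
        unfolding entries_def using xF(1)[of \<alpha>] that by blast
    qed
    ultimately show ?thesis unfolding B1_def by blast
  qed
  have B1u: "B1 \<subseteq> univ M"
  proof -
    have "entries (I \<alpha>) (set (x \<alpha>)) \<subseteq> univ M" if "\<alpha> \<in> S" for \<alpha>
      unfolding entries_def using Iu[of \<alpha>] xF(1)[of \<alpha>] SK that by blast
    then show ?thesis unfolding B1_def using insert.prems(4) by blast
  qed
  have smallB1: "small B1"
    unfolding B1_def by (rule small_Un[OF insert.prems(5) small_finite[OF fin(1)]])
  have "indiscernible L M (B \<union> (\<Union>\<gamma> \<in> K - {\<beta>}. entries (I \<gamma>) (Field (r \<gamma>)))) (r \<beta>) (I \<beta>)"
    using mut \<beta>K unfolding mutually_indiscernible_def by blast
  from indiscernible_aut[OF this seq[OF \<beta>K] incS[OF insertI1] B1 B1u smallB1]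
  obtain \<sigma> where \<sigma>: "\<sigma> \<in> aut_fixing B1" "map (map \<sigma>) (map (I \<beta>) (x \<beta>)) = map (I \<beta>) (y \<beta>)"
    by blast
  have "\<exists>\<tau> \<in> aut_fixing B2. \<forall>\<alpha> \<in> S. map (map \<tau>) (map (I \<alpha>) (x \<alpha>)) = map (I \<alpha>) (y \<alpha>)"
  proof (rule insert.IH[OF SK])
    show "increasing (r \<alpha>) (x \<alpha>) \<and> increasing (r \<alpha>) (y \<alpha>) \<and> length (x \<alpha>) = length (y \<alpha>)" if "\<alpha> \<in> S" for \<alpha>
      using incS[of \<alpha>] that by blast
    have "entries (I \<beta>) (set (y \<beta>)) \<subseteq> entries (I \<beta>) (Field (r \<beta>))"
      unfolding entries_def using xF(2)[OF insertI1] by blast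
    moreover have "\<beta> \<in> K - S" using \<beta>K insert.hyps(2) by blast
    ultimately show "B2 \<subseteq> B \<union> (\<Union>\<gamma> \<in> K - S. entries (I \<gamma>) (Field (r \<gamma>)))"
      unfolding B2_def using insert.prems(3) by blast
    show "B2 \<subseteq> univ M"
      unfolding B2_def entries_def using insert.prems(4) Iu[OF \<beta>K] xF(2)[OF insertI1] by blast
    show "small B2"
      unfolding B2_def by (rule small_Un[OF insert.prems(5) small_finite[OF fin(2)]])
  qed
  then obtain \<tau> where \<tau>: "\<tau> \<in> aut_fixing B2"
    "\<And>\<alpha>. \<alpha> \<in> S \<Longrightarrow> map (map \<tau>) (map (I \<alpha>) (x \<alpha>)) = map (I \<alpha>) (y \<alpha>)"
    by blast
  have fix\<sigma>: "map (map \<sigma>) (map (I \<alpha>) (x \<alpha>)) = map (I \<alpha>) (x \<alpha>)" if "\<alpha> \<in> S" for \<alpha>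
  proof -
    have "map \<sigma> (I \<alpha> i) = I \<alpha> i" if "i \<in> set (x \<alpha>)" for i
      by (rule aut_fixing_map[OF \<sigma>(1)]) (use that \<open>\<alpha> \<in> S\<close> in \<open>auto simp: B1_def entries_def\<close>)
    then show ?thesis by simp
  qed
  have fix\<tau>: "map (map \<tau>) (map (I \<beta>) (y \<beta>)) = map (I \<beta>) (y \<beta>)"
  proof -
    have "map \<tau> (I \<beta> i) = I \<beta> i" if "i \<in> set (y \<beta>)" for i
      by (rule aut_fixing_map[OF \<tau>(1)]) (use that in \<open>auto simp: B2_def entries_def\<close>)
    then show ?thesis by simp
  qed
  have comp: "map (map (\<tau> \<circ> \<sigma>)) xss = map (map \<tau>) (map (map \<sigma>) xss)" for xss
    by simp
  have "map (map (\<tau> \<circ> \<sigma>)) (map (I \<alpha>) (x \<alpha>)) = map (I \<alpha>) (y \<alpha>)" if "\<alpha> \<in> insert \<beta> S" for \<alpha>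
  proof (cases "\<alpha> = \<beta>")
    case True
    then show ?thesis unfolding comp by (simp only: \<sigma>(2) fix\<tau>)
  next
    case False
    then have "\<alpha> \<in> S" using that by blast
    then show ?thesis unfolding comp by (simp only: fix\<sigma> \<tau>(2))
  qed
  moreover have "\<tau> \<circ> \<sigma> \<in> aut_fixing B0"
    using \<tau>(1) \<sigma>(1) aut_fixing_antimono[of B0 B1] aut_fixing_antimono[of B0 B2]
    by (intro comp_aut) (auto simp: B1_def B2_def)
  ultimately show ?case by blast
qed

section \<open>Witnesses for large dp-rank\<close>

text \<open>
  A family that contradicts \<open>dpr(\<Sigma>) < \<kappa>\<close> together with, for each of its sequences, a formula and two
  increasing tuples that show that the sequence is not indiscernible over \<open>b\<close>.
\<close>

definition dpr_witness where
  "dpr_witness n B \<Sigma> K m r I b x y c \<chi> \<longleftrightarrow> realizes M n \<Sigma> b \<and> mutually_indiscernible L M B K r I \<and>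
    (\<forall>\<beta> \<in> K. is_seq M (m \<beta>) (r \<beta>) (I \<beta>) \<and> infinite (Field (r \<beta>)) \<and> countable (Field (r \<beta>)) \<and>
      increasing (r \<beta>) (x \<beta>) \<and> increasing (r \<beta>) (y \<beta>) \<and> length (x \<beta>) = length (y \<beta>) \<and>
      set (c \<beta>) \<subseteq> B \<and> \<chi> \<beta> \<in> fms L (length (x \<beta>) * m \<beta> + (length (c \<beta>) + n)) \<and>
      holds M (\<chi> \<beta>) (concat (map (I \<beta>) (x \<beta>)) @ c \<beta> @ b) \<and>
      \<not> holds M (\<chi> \<beta>) (concat (map (I \<beta>) (y \<beta>)) @ c \<beta> @ b))"

lemma dpr_witnessD:
  assumes "dpr_witness n B \<Sigma> K m r I b x y c \<chi>"
  shows "realizes M n \<Sigma> b" "mutually_indiscernible L M B K r I"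
    "\<beta> \<in> K \<Longrightarrow> is_seq M (m \<beta>) (r \<beta>) (I \<beta>)" "\<beta> \<in> K \<Longrightarrow> infinite (Field (r \<beta>))"
    "\<beta> \<in> K \<Longrightarrow> countable (Field (r \<beta>))" "\<beta> \<in> K \<Longrightarrow> increasing (r \<beta>) (x \<beta>)"
    "\<beta> \<in> K \<Longrightarrow> increasing (r \<beta>) (y \<beta>)" "\<beta> \<in> K \<Longrightarrow> length (x \<beta>) = length (y \<beta>)"
    "\<beta> \<in> K \<Longrightarrow> set (c \<beta>) \<subseteq> B" "\<beta> \<in> K \<Longrightarrow> \<chi> \<beta> \<in> fms L (length (x \<beta>) * m \<beta> + (length (c \<beta>) + n))"
    "\<beta> \<in> K \<Longrightarrow> holds M (\<chi> \<beta>) (concat (map (I \<beta>) (x \<beta>)) @ c \<beta> @ b)"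
    "\<beta> \<in> K \<Longrightarrow> \<not> holds M (\<chi> \<beta>) (concat (map (I \<beta>) (y \<beta>)) @ c \<beta> @ b)"
  using assms unfolding dpr_witness_def by blast+

lemma not_dpr_less_of_witness:
  fixes \<kappa> :: "'j rel" and r :: "'j \<Rightarrow> 'a list rel"
  assumes w: "dpr_witness n B \<Sigma> (Field \<kappa>) m r I b x y c \<chi>"
  shows "\<not> dpr_less L M n B \<Sigma> \<kappa>"
proof
  assume "dpr_less L M n B \<Sigma> \<kappa>"
  then obtain \<beta> where \<beta>: "\<beta> \<in> Field \<kappa>" "indiscernible L M (B \<union> set b) (r \<beta>) (I \<beta>)"
    using dpr_witnessD(1-4)[OF w] unfolding dpr_less_def by blast
  note D = dpr_witnessD(3-)[OF w \<beta>(1)]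
  have b: "length b = n" using dpr_witnessD(1)[OF w] by (simp add: realizes_def tuples_def)
  have len: "length (concat (map (I \<beta>) (x \<beta>))) = length (x \<beta>) * m \<beta>"
    using is_seqD[OF D(1)] increasing_subset[OF D(4)] by (intro length_concat_tuples) blast
  have "(\<chi> \<beta>, c \<beta> @ b) \<in> tp L M (concat (map (I \<beta>) (x \<beta>))) (B \<union> set b)"
    using D len b by (auto simp: tp_def pfms_def)
  moreover have "tp L M (concat (map (I \<beta>) (x \<beta>))) (B \<union> set b) = tp L M (concat (map (I \<beta>) (y \<beta>))) (B \<union> set b)"
    using \<beta>(2) D(4,5,6) unfolding indiscernible_def by blast
  ultimately have "(\<chi> \<beta>, c \<beta> @ b) \<in> tp L M (concat (map (I \<beta>) (y \<beta>))) (B \<union> set b)"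
    by (simp only:)
  then show False using D(10) by (simp add: tp_def)
qed

lemma not_indiscernible_witness:
  assumes not: "\<not> indiscernible L M (B \<union> set b) r I" and seq: "is_seq M m r I"
    and B: "B \<subseteq> univ M" and b: "b \<in> tuples M n"
  shows "\<exists>x y c \<chi>. increasing r x \<and> increasing r y \<and> length x = length y \<and> set c \<subseteq> B \<and>
    \<chi> \<in> fms L (length x * m + (length c + n)) \<and> holds M \<chi> (concat (map I x) @ c @ b) \<and>
    \<not> holds M \<chi> (concat (map I y) @ c @ b)"
proof -
  have "\<exists>x y. increasing r x \<and> increasing r y \<and> length x = length y \<and>
      \<not> tp L M (concat (map I x)) (B \<union> set b) \<subseteq> tp L M (concat (map I y)) (B \<union> set b)"
    using not unfolding indiscernible_def by (metis subset_antisym)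
  then obtain x y where xy: "increasing r x" "increasing r y" "length x = length y"
    and sub: "\<not> tp L M (concat (map I x)) (B \<union> set b) \<subseteq> tp L M (concat (map I y)) (B \<union> set b)"
    by blast
  have x: "concat (map I x) \<in> tuples M (length x * m)" and y: "concat (map I y) \<in> tuples M (length x * m)"
    using is_seqD[OF seq] increasing_subset[OF xy(1)] increasing_subset[OF xy(2)] xy(3)
      concat_tuples[of x I m] concat_tuples[of y I m] by auto
  obtain \<phi> c' where \<phi>: "(\<phi>, c') \<in> tp L M (concat (map I x)) (B \<union> set b)"
    "(\<phi>, c') \<notin> tp L M (concat (map I y)) (B \<union> set b)"
    using sub by (metis subrelI)
  have \<phi>': "\<phi> \<in> fms L (length x * m + length c')" "set c' \<subseteq> B \<union> set b"
    "holds M \<phi> (concat (map I x) @ c')" "\<not> holds M \<phi> (concat (map I y) @ c')"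
    using \<phi> x y by (auto simp: tp_def pfms_def tuples_def)
  define c where "c = filter (\<lambda>z. z \<in> B) c'"
  have c: "set c \<subseteq> B" "set c' \<subseteq> set (c @ b)" "set (c @ b) \<subseteq> univ M"
    using \<phi>'(2) B b by (auto simp: c_def tuples_def)
  obtain \<chi> where "\<chi> \<in> fms L (length x * m + length (c @ b))"
    and \<chi>: "\<forall>z \<in> tuples M (length x * m). holds M \<chi> (z @ c @ b) \<longleftrightarrow> holds M \<phi> (z @ c')"
    using pfm_recode[OF \<phi>'(1) c(2,3)] by blast
  moreover have "length b = n" using b by (simp add: tuples_def)
  ultimately show ?thesis
    using xy c(1) \<phi>'(3,4) x y
    by (intro exI[of _ x] exI[of _ y] exI[of _ c] exI[of _ \<chi>]) simp
qed

end

lemma indiscernible_Restr: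
  assumes "indiscernible L M B r I" "B' \<subseteq> B"
  shows "indiscernible L M B' (Restr r X) I"
proof -
  have inc: "increasing r is" if "increasing (Restr r X) is" for "is"
    using that unfolding increasing_def
    by (auto simp: Field_def intro: sorted_wrt_mono_rel[of "is", rotated])
  have "tp L M a B' = {q \<in> tp L M a B. set (snd q) \<subseteq> B'}" for a
    using assms(2) by (auto simp: tp_def pfms_def)
  note restr = this
  show ?thesis
    unfolding indiscernible_def
  proof (intro allI impI)
    fix "is" js
    assume "increasing (Restr r X) is \<and> increasing (Restr r X) js \<and> length is = length js"
    then have "tp L M (concat (map I is)) B = tp L M (concat (map I js)) B"
      using assms(1) inc unfolding indiscernible_def by blast
    then show "tp L M (concat (map I is)) B' = tp L M (concat (map I js)) B'"
      by (simp only: restr[of "concat (map I is)"] restr[of "concat (map I js)"])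
  qed
qed

text \<open>
  The index sets are cut down to countable ones, which still contain the two tuples that witness the
  failure of indiscernibility. This makes the whole family small if \<open>\<kappa>\<close> is.
\<close>

lemma (in monster) dpr_witness_of_not_less:
  fixes \<kappa> :: "'j rel"
  assumes not: "\<not> dpr_less L M n B \<Sigma> \<kappa>" and B: "B \<subseteq> univ M"
  obtains m and r :: "'j \<Rightarrow> 'a list rel" and I b x y c \<chi> where
    "dpr_witness n B \<Sigma> (Field \<kappa>) m r I b x y c \<chi>"
proof -
  obtain m and r :: "'j \<Rightarrow> 'a list rel" and I b where
    seq: "\<forall>\<alpha> \<in> Field \<kappa>. is_seq M (m \<alpha>) (r \<alpha>) (I \<alpha>) \<and> infinite (Field (r \<alpha>))"
    and mut: "mutually_indiscernible L M B (Field \<kappa>) r I" and b: "realizes M n \<Sigma> b"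
    and no: "\<forall>\<beta> \<in> Field \<kappa>. \<not> indiscernible L M (B \<union> set b) (r \<beta>) (I \<beta>)"
    using not unfolding dpr_less_def by blast
  have b_tup: "b \<in> tuples M n" using b by (simp add: realizes_def)
  define P where "P \<beta> x y c \<chi> \<longleftrightarrow> increasing (r \<beta>) x \<and> increasing (r \<beta>) y \<and> length x = length y \<and> set c \<subseteq> B \<and>
    \<chi> \<in> fms L (length x * m \<beta> + (length c + n)) \<and> holds M \<chi> (concat (map (I \<beta>) x) @ c @ b) \<and>
    \<not> holds M \<chi> (concat (map (I \<beta>) y) @ c @ b)" for \<beta> x y c \<chi>
  have "\<forall>\<beta> \<in> Field \<kappa>. \<exists>q. P \<beta> (fst q) (fst (snd q)) (fst (snd (snd q))) (snd (snd (snd q)))"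
  proof
    fix \<beta>
    assume \<beta>: "\<beta> \<in> Field \<kappa>"
    then obtain x y c \<chi> where "P \<beta> x y c \<chi>"
      using not_indiscernible_witness[of B b "r \<beta>" "I \<beta>" "m \<beta>" n] no seq B b_tup unfolding P_def by blast
    then show "\<exists>q. P \<beta> (fst q) (fst (snd q)) (fst (snd (snd q))) (snd (snd (snd q)))"
      by (intro exI[of _ "(x, y, c, \<chi>)"]) simp
  qed
  then obtain q where q: "\<forall>\<beta> \<in> Field \<kappa>. P \<beta> (fst (q \<beta>)) (fst (snd (q \<beta>))) (fst (snd (snd (q \<beta>)))) (snd (snd (snd (q \<beta>))))"
    by (rule bchoice[THEN exE])
  define x where "x \<beta> = fst (q \<beta>)" for \<beta>
  define y where "y \<beta> = fst (snd (q \<beta>))" for \<beta>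
  define c where "c \<beta> = fst (snd (snd (q \<beta>)))" for \<beta>
  define \<chi> where "\<chi> \<beta> = snd (snd (snd (q \<beta>)))" for \<beta>
  have P: "P \<beta> (x \<beta>) (y \<beta>) (c \<beta>) (\<chi> \<beta>)" if "\<beta> \<in> Field \<kappa>" for \<beta>
    using q that by (simp add: x_def y_def c_def \<chi>_def)
  have "\<exists>X. countable X \<and> infinite X \<and> X \<subseteq> Field (r \<beta>) \<and> set (x \<beta>) \<union> set (y \<beta>) \<subseteq> X" if \<beta>: "\<beta> \<in> Field \<kappa>" for \<beta>
  proof -
    obtain Z where Z: "Z \<subseteq> Field (r \<beta>)" "countable Z" "infinite Z"
      using infinite_countable_subset'[of "Field (r \<beta>)"] seq \<beta> by auto
    show ?thesis
      using Z P[OF \<beta>] increasing_subset unfolding P_def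
      by (intro exI[of _ "Z \<union> set (x \<beta>) \<union> set (y \<beta>)"]) (auto intro: countable_finite)
  qed
  then have "\<forall>\<beta> \<in> Field \<kappa>. \<exists>X. countable X \<and> infinite X \<and> X \<subseteq> Field (r \<beta>) \<and> set (x \<beta>) \<union> set (y \<beta>) \<subseteq> X"
    by blast
  then obtain X where X: "\<forall>\<beta> \<in> Field \<kappa>. countable (X \<beta>) \<and> infinite (X \<beta>) \<and> X \<beta> \<subseteq> Field (r \<beta>) \<and>
      set (x \<beta>) \<union> set (y \<beta>) \<subseteq> X \<beta>"
    by (rule bchoice[THEN exE])
  define r' where "r' \<beta> = Restr (r \<beta>) (X \<beta>)" for \<beta>
  have Field: "Field (r' \<beta>) = X \<beta>" if \<beta>: "\<beta> \<in> Field \<kappa>" for \<beta>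
    unfolding r'_def using seq X \<beta>
    by (intro Refl_Field_Restr2) (auto simp: is_seq_def order_on_defs)
  have inc: "increasing (r' \<beta>) u" if \<beta>: "\<beta> \<in> Field \<kappa>" and u: "increasing (r \<beta>) u" "set u \<subseteq> X \<beta>" for \<beta> u
  proof -
    have "sorted_wrt (\<lambda>i j. (i, j) \<in> r' \<beta> \<and> i \<noteq> j) u"
      using u unfolding increasing_def r'_def by (auto elim!: sorted_wrt_mono_rel[rotated])
    then show ?thesis using u(2) Field[OF \<beta>] by (simp add: increasing_def)
  qed
  have "mutually_indiscernible L M B (Field \<kappa>) r' I"
    unfolding mutually_indiscernible_def
  proof
    fix \<alpha>
    assume \<alpha>: "\<alpha> \<in> Field \<kappa>"
    have "entries (I \<beta>) (Field (r' \<beta>)) \<subseteq> entries (I \<beta>) (Field (r \<beta>))" if "\<beta> \<in> Field \<kappa>" for \<beta>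
      unfolding entries_def Field[OF that] using X that by blast
    then show "indiscernible L M (B \<union> (\<Union>\<beta> \<in> Field \<kappa> - {\<alpha>}. entries (I \<beta>) (Field (r' \<beta>)))) (r' \<alpha>) (I \<alpha>)"
      unfolding r'_def[of \<alpha>] using mut \<alpha> unfolding mutually_indiscernible_def
      by (intro indiscernible_Restr[of _ _ "B \<union> (\<Union>\<beta> \<in> Field \<kappa> - {\<alpha>}. entries (I \<beta>) (Field (r \<beta>)))"]) blast+
  qed
  moreover have seq': "is_seq M (m \<beta>) (r' \<beta>) (I \<beta>)" if \<beta>: "\<beta> \<in> Field \<kappa>" for \<beta>
    unfolding is_seq_def Field[OF \<beta>]
  proof (intro conjI ballI)
    show "linear_order_on (X \<beta>) (r' \<beta>)"
      using seq \<beta> Linear_order_Restr[of "r \<beta>" "X \<beta>"] Field[OF \<beta>] unfolding r'_def is_seq_def by metis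
    show "I \<beta> i \<in> tuples M (m \<beta>)" if "i \<in> X \<beta>" for i
      using seq \<beta> X that unfolding is_seq_def by blast
  qed
  moreover have "increasing (r' \<beta>) (x \<beta>)" "increasing (r' \<beta>) (y \<beta>)" "infinite (Field (r' \<beta>))"
    "countable (Field (r' \<beta>))" if \<beta>: "\<beta> \<in> Field \<kappa>" for \<beta>
    using inc[OF \<beta>] Field[OF \<beta>] X \<beta> P[OF \<beta>, unfolded P_def] by auto
  ultimately have "dpr_witness n B \<Sigma> (Field \<kappa>) m r' I b x y c \<chi>"
    unfolding dpr_witness_def using b P[unfolded P_def] by (intro conjI ballI) blast+
  then show thesis by (rule that)
qed

lemma finite_fibres_card:
  assumes "infinite Y" "f ` X \<subseteq> Y" "\<And>y. y \<in> Y \<Longrightarrow> finite {x \<in> X. f x = y}"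
  shows "|X| \<le>o |Y|"
proof -
  have "X = (\<Union>y \<in> Y. {x \<in> X. f x = y})" using assms(2) by blast
  moreover have "|\<Union>y \<in> Y. {x \<in> X. f x = y}| \<le>o |Y|"
  proof (rule card_of_UNION_ordLeq_infinite[OF assms(1)])
    show "\<forall>y \<in> Y. |{x \<in> X. f x = y}| \<le>o |Y|"
    proof
      fix y
      assume "y \<in> Y"
      then have "|{x \<in> X. f x = y}| <o natLeq"
        using assms(3) finite_iff_ordLess_natLeq by blast
      moreover have "natLeq \<le>o |Y|"
        using assms(1) infinite_iff_natLeq_ordLeq by blast
      ultimately show "|{x \<in> X. f x = y}| \<le>o |Y|"
        by (meson ordLess_imp_ordLeq ordLess_ordLeq_trans)
    qed
  qed (use card_of_refl ordIso_imp_ordLeq in blast)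
  ultimately show ?thesis by simp
qed

text \<open>
  Infinitely many of the sequences fail to be indiscernible over \<open>b\<close> because of one formula \<open>\<phi>\<close>, true
  of a tuple \<open>u t\<close> and false of a tuple \<open>v t\<close>. By mutual indiscernibility, automorphisms over \<open>B\<close> can
  exchange \<open>v t\<close> for \<open>u t\<close> in any finite set of these sequences and fix \<open>u t\<close> in the others. They
  take \<open>b\<close> to realizations of \<open>\<Sigma>\<close> that realize every pattern of \<open>\<phi>\<close> on the tuples \<open>u t\<close>.
\<close>

theorem (in monster) dpr_less_of_NIP:
  fixes \<kappa> :: "'j rel"
  assumes NIP: "NIP L M n \<Sigma>" and \<Sigma>: "\<Sigma> \<subseteq> pfms L n B" and B: "B \<subseteq> univ M" "small B"
    and \<kappa>: "Card_order \<kappa>" "|{\<phi>. wf_fm L \<phi>}| <o \<kappa>"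
  shows "dpr_less L M n B \<Sigma> \<kappa>"
proof (rule ccontr)
  assume "\<not> ?thesis"
  then obtain m and r :: "'j \<Rightarrow> 'a list rel" and I b x y c \<chi> where
    w: "dpr_witness n B \<Sigma> (Field \<kappa>) m r I b x y c \<chi>"
    using dpr_witness_of_not_less[OF _ B(1)] by blast
  define K where "K = Field \<kappa>"
  note w = dpr_witnessD[OF w, folded K_def]
  have b_tup: "b \<in> tuples M n" using w(1) by (simp add: realizes_def)
  define k where "k \<beta> = length (x \<beta>) * m \<beta> + length (c \<beta>)" for \<beta>
  define Fm where "Fm = {\<phi>. wf_fm L \<phi>}"
  have infFm: "infinite Fm"
    unfolding Fm_def by (rule formulas_infinite)
  have Times: "|Fm \<times> (UNIV :: nat set)| \<le>o |Fm|"
    by (rule ordIso_imp_ordLeq, rule card_of_Times_infinite_simps(1))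
      (use infFm infinite_iff_card_of_nat[of Fm] in blast)+
  \<comment> \<open>As \<open>\<kappa>\<close> exceeds the number of formulas, infinitely many sequences share their formula.\<close>
  have "\<exists>v. infinite {\<beta> \<in> K. (\<chi> \<beta>, k \<beta>) = v}"
  proof (rule ccontr)
    assume "\<nexists>v. infinite {\<beta> \<in> K. (\<chi> \<beta>, k \<beta>) = v}"
    moreover have "(\<lambda>\<beta>. (\<chi> \<beta>, k \<beta>)) ` K \<subseteq> Fm \<times> UNIV"
      using w(10) by (auto simp: Fm_def fms_def)
    moreover have "infinite (Fm \<times> (UNIV :: nat set))"
      using infFm by (auto dest: finite_cartesian_productD1)
    ultimately have "|K| \<le>o |Fm \<times> (UNIV :: nat set)|"
      by (intro finite_fibres_card[of _ "\<lambda>\<beta>. (\<chi> \<beta>, k \<beta>)"]) auto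
    then have "|K| \<le>o |Fm|" using Times by (rule ordLeq_transitive)
    moreover have "|K| =o \<kappa>" unfolding K_def using \<kappa>(1) by (rule card_of_Field_ordIso)
    ultimately show False
      using \<kappa>(2) unfolding Fm_def[symmetric] by (meson not_ordLess_ordLeq ordIso_symmetric ordIso_ordLeq_trans)
  qed
  then obtain \<phi> l where inf: "infinite {\<beta> \<in> K. (\<chi> \<beta>, k \<beta>) = (\<phi>, l)}" by auto
  obtain f :: "nat \<Rightarrow> 'j" where f: "inj f" "range f \<subseteq> {\<beta> \<in> K. (\<chi> \<beta>, k \<beta>) = (\<phi>, l)}"
    using infinite_countable_subset[OF inf] by blast
  have fK: "f t \<in> K" and \<chi>f: "\<chi> (f t) = \<phi>" and kf: "k (f t) = l" for t
    using f(2) by auto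
  have \<phi>: "\<phi> \<in> fms L (l + n)"
    using w(10)[OF fK[of 0]] by (simp only: \<chi>f add.assoc[symmetric] k_def[symmetric] kf)
  define u where "u t = concat (map (I (f t)) (x (f t))) @ c (f t)" for t
  define v where "v t = concat (map (I (f t)) (y (f t))) @ c (f t)" for t
  have concats: "concat (map (I (f t)) (x (f t))) \<in> tuples M (length (x (f t)) * m (f t))"
    "concat (map (I (f t)) (y (f t))) \<in> tuples M (length (x (f t)) * m (f t))" for t
    using is_seqD[OF w(3)[OF fK]] increasing_subset[OF w(6)[OF fK]] increasing_subset[OF w(7)[OF fK]]
      w(8)[OF fK[of t]] concat_tuples[of "x (f t)" "I (f t)" "m (f t)"]
      concat_tuples[of "y (f t)" "I (f t)" "m (f t)"] by (metis subsetD)+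
  have u_tup: "u t \<in> tuples M l" and v_tup: "v t \<in> tuples M l" for t
    using concats[of t] w(9)[OF fK[of t]] B(1) kf[of t] by (auto simp: u_def v_def tuples_def k_def)
  have uv: "holds M \<phi> (u t @ b)" "\<not> holds M \<phi> (v t @ b)" for t
    using w(11,12)[OF fK[of t]] \<chi>f[of t] by (auto simp: u_def v_def)
  have pattern: "\<exists>b'. realizes M n \<Sigma> b' \<and> (\<forall>t<N. holds M \<phi> (u t @ b') \<longleftrightarrow> t \<in> s)" for N s
  proof -
    define x' where "x' \<beta> = (if \<beta> \<in> f ` s then x \<beta> else y \<beta>)" for \<beta>
    have x'f: "x' (f t) = (if t \<in> s then x (f t) else y (f t))" for t
      using f(1) by (auto simp: x'_def inj_image_mem_iff)
    have "\<exists>\<sigma> \<in> aut_fixing B. \<forall>\<alpha> \<in> f ` {..<N}. map (map \<sigma>) (map (I \<alpha>) (x' \<alpha>)) = map (I \<alpha>) (x \<alpha>)"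
    proof (rule mutually_indiscernible_aut[OF w(2) w(3)])
      show "increasing (r \<alpha>) (x' \<alpha>) \<and> increasing (r \<alpha>) (x \<alpha>) \<and> length (x' \<alpha>) = length (x \<alpha>)"
        if "\<alpha> \<in> f ` {..<N}" for \<alpha>
        using that w(6,7,8) fK by (auto simp: x'_def)
    qed (use fK B in auto)
    then obtain \<sigma> where \<sigma>: "\<sigma> \<in> aut_fixing B"
      "\<And>t. t < N \<Longrightarrow> map (map \<sigma>) (map (I (f t)) (x' (f t))) = map (I (f t)) (x (f t))"
      by auto
    have "holds M \<phi> (u t @ map \<sigma> b) \<longleftrightarrow> t \<in> s" if "t < N" for t
    proof -
      have \<sigma>u: "map \<sigma> (if t \<in> s then u t else v t) = u t"
      proof -
        have "map \<sigma> (if t \<in> s then u t else v t) = map \<sigma> (concat (map (I (f t)) (x' (f t)))) @ map \<sigma> (c (f t))"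
          by (simp add: x'f u_def v_def)
        also have "\<dots> = concat (map (map \<sigma>) (map (I (f t)) (x' (f t)))) @ c (f t)"
          using aut_fixing_map[OF \<sigma>(1) w(9)[OF fK]] by (simp only: map_concat)
        finally show ?thesis unfolding \<sigma>(2)[OF that] u_def .
      qed
      have "holds M \<phi> (map \<sigma> ((if t \<in> s then u t else v t) @ b)) \<longleftrightarrow> holds M \<phi> ((if t \<in> s then u t else v t) @ b)"
        by (rule aut_holds[OF \<sigma>(1)]) (use \<phi> u_tup v_tup b_tup in \<open>auto simp: tuples_def\<close>)
      then show ?thesis
        unfolding map_append \<sigma>u using uv[of t] by (auto split: if_splits)
    qed
    moreover have "realizes M n \<Sigma> (map \<sigma> b)"
      using realizes_aut[OF \<sigma>(1) \<Sigma> B(1) w(1)] .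
    ultimately show ?thesis by blast
  qed
  \<comment> \<open>Shattering is passed from the parameters to realizations of the type by duality.\<close>
  have "has_IP L M n \<Sigma>"
  proof (rule has_IP_if_finitely[OF \<Sigma> B \<phi>])
    fix N :: nat and \<Sigma>0
    assume \<Sigma>0: "finite \<Sigma>0" "\<Sigma>0 \<subseteq> \<Sigma>"
    \<comment> \<open>The tuple with index \<open>code s\<close> will define \<open>s\<close> on the sequence of realizations.\<close>
    obtain code :: "nat set \<Rightarrow> nat" where code: "inj_on code (Pow {..<N})"
      using finite_imp_inj_to_nat_seg[of "Pow {..<N}"] by auto
    obtain N' where N': "code ` Pow {..<N} \<subseteq> {..<N'}"
      using finite_nat_iff_bounded[of "code ` Pow {..<N}"] by auto
    have "\<forall>i. \<exists>b'. realizes M n \<Sigma> b' \<and> (\<forall>t<N'. holds M \<phi> (u t @ b') \<longleftrightarrow> t \<in> code ` {s \<in> Pow {..<N}. i \<in> s})"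
      using pattern by blast
    then obtain a where a: "\<forall>i. realizes M n \<Sigma> (a i) \<and>
        (\<forall>t<N'. holds M \<phi> (u t @ a i) \<longleftrightarrow> t \<in> code ` {s \<in> Pow {..<N}. i \<in> s})"
      by (rule choice[THEN exE])
    have "\<exists>z \<in> tuples M l. \<forall>i<N. holds M \<phi> (z @ a i) \<longleftrightarrow> i \<in> s" for s
    proof (intro bexI allI impI)
      show "u (code (s \<inter> {..<N})) \<in> tuples M l" by (rule u_tup)
      fix i
      assume i: "i < N"
      have "s \<inter> {..<N} \<in> Pow {..<N}" by blast
      then have "code (s \<inter> {..<N}) < N'" using N' by blast
      then have "holds M \<phi> (u (code (s \<inter> {..<N})) @ a i) \<longleftrightarrow>
          code (s \<inter> {..<N}) \<in> code ` {s \<in> Pow {..<N}. i \<in> s}"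
        using a by blast
      also have "\<dots> \<longleftrightarrow> s \<inter> {..<N} \<in> {s \<in> Pow {..<N}. i \<in> s}"
        using code by (intro inj_on_image_mem_iff) auto
      finally show "holds M \<phi> (u (code (s \<inter> {..<N})) @ a i) \<longleftrightarrow> i \<in> s"
        using i by simp
    qed
    moreover have "realizes M n \<Sigma>0 (a i)" for i
      using a \<Sigma>0(2) unfolding realizes_def by blast
    ultimately show "\<exists>a. (\<forall>i<N. realizes M n \<Sigma>0 (a i)) \<and>
        (\<forall>s. \<exists>y \<in> tuples M l. \<forall>i<N. holds M \<phi> (y @ a i) \<longleftrightarrow> i \<in> s)"
      by blast
  qed
  with NIP show False by (simp add: NIP_def)
qed

section \<open>Comparison of the dp-ranks\<close>

lemma subset_Inl_ImageE:
  fixes zs :: "('v + 'w) list"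
  obtains us where "set us = {v. Inl v \<in> set zs}"
  using finite_list[of "{v. Inl v \<in> set zs}"] finite_vimageI[OF finite_set[of zs], of Inl] by (auto simp: vimage_def)

text \<open>
  A formula over \<open>A\<close> that is true of the family mentions finitely many members. That it has a solution
  is a formula over \<open>A\<close>, which passes from \<open>C'\<close> to its elementary substructure \<open>C\<close>. Compactness in
  \<open>C\<close> does the rest.
\<close>

lemma (in generically_stable_extension) small_family_copy:
  fixes V :: "'v set"
  assumes V: "small V" and e0: "e0 ` V \<subseteq> univ C'"
  obtains e where "e ` V \<subseteq> univ C" "\<And>\<phi> zs. set zs \<subseteq> V <+> A \<Longrightarrow> \<phi> \<in> fms L (length zs) \<Longrightarrow>
    holds C \<phi> (map (case_sum e id) zs) \<longleftrightarrow> holds C' \<phi> (map (case_sum e0 id) zs)"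
proof -
  define v0 where "v0 = case_sum e0 id"
  define X where "X = {(\<phi>, zs). set zs \<subseteq> V <+> A \<and> \<phi> \<in> fms L (length zs) \<and> holds C' \<phi> (map v0 zs)}"
  define Q where "Q = (\<lambda>(\<phi>, zs) (M :: ('f, 'r, 'a) struct) (e :: 'v + 'a \<Rightarrow> 'a). holds M \<phi> (map e zs))"
  have v0: "v0 ` (V <+> A) \<subseteq> univ C'"
    using e0 A univ_subset by (auto simp: v0_def)
  have defQ: "definable L (V <+> A) (Q q)" if "q \<in> X" for q
    using that unfolding Q_def X_def by (cases q) (auto intro: definable_holds)
  have "\<exists>e. e ` (V <+> A) \<subseteq> univ C \<and> (\<forall>v \<in> Inr ` A. e v = case_sum undefined id v) \<and> (\<forall>P \<in> Q ` X. P C e)"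
  proof (rule compactness[of "V <+> A" "Inr ` A" "case_sum undefined id" "Q ` X"])
    show "small (V <+> A)" by (intro small_Plus V A)
    show "definable L (V <+> A) P" if "P \<in> Q ` X" for P
      using that defQ by blast
    fix F0
    assume "finite F0" "F0 \<subseteq> Q ` X"
    then obtain X0 where X0: "X0 \<subseteq> X" "finite X0" "F0 = Q ` X0"
      by (meson finite_subset_image)
    have "definable L (V <+> A) (\<lambda>M e. \<forall>q \<in> X0. Q q M e)"
      using X0 defQ by (intro definable_Ball) auto
    then obtain \<phi> zs where \<phi>: "set zs \<subseteq> V <+> A" "\<phi> \<in> fms L (length zs)"
      "\<And>M e. e ` (V <+> A) \<subseteq> univ M \<Longrightarrow> is_struct L M \<Longrightarrow> (\<forall>q \<in> X0. Q q M e) \<longleftrightarrow> holds M \<phi> (map e zs)"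
      by (rule definableE) (rule that)
    have hv0: "holds C' \<phi> (map v0 zs)"
      using \<phi>(3)[OF v0 Ext.is_struct] X0(1) by (auto simp: Q_def X_def)
    obtain us where us: "set us = {v. Inl v \<in> set zs}" by (rule subset_Inl_ImageE)
    have usV: "set us \<subseteq> V" using us \<phi>(1) by auto
    have "\<forall>v \<in> set us. \<exists>k. k < length us \<and> us ! k = v" by (simp add: in_set_conv_nth)
    then obtain pos where pos: "\<forall>v \<in> set us. pos v < length us \<and> us ! pos v = v"
      by (rule bchoice[THEN exE])
    define f where "f = case_sum (\<lambda>v. Inr (pos v)) (Inl :: 'a \<Rightarrow> 'a + nat)"
    define R where "R = (\<lambda>(M :: ('f, 'r, 'a) struct) (e :: 'a \<Rightarrow> 'a). \<exists>y \<in> tuples M (length us).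
      holds M \<phi> (map (case_sum e ((!) y)) (map f zs)))"
    have fz: "f z \<in> A <+> {..<length us}" if "z \<in> set zs" for z
      by (rule sum.exhaust[of z]) (use that \<phi>(1) pos us in \<open>auto simp: f_def\<close>)
    have "definable L A R"
      unfolding R_def
    proof (intro definable_exists_tuple definable_holds)
      show "set (map f zs) \<subseteq> A <+> {..<length us}" using fz by auto
    qed (use \<phi>(2) in simp)
    then obtain \<psi> ws where \<psi>: "set ws \<subseteq> A" "\<psi> \<in> fms L (length ws)"
      "\<And>M e. e ` A \<subseteq> univ M \<Longrightarrow> is_struct L M \<Longrightarrow> R M e \<longleftrightarrow> holds M \<psi> (map e ws)"
      by (rule definableE) (rule that)
    have "R C' id"
      unfolding R_def
    proof
      show "map e0 us \<in> tuples C' (length us)" using e0 usV by (auto simp: tuples_def)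
      have "map (case_sum id ((!) (map e0 us))) (map f zs) = map v0 zs"
        using us pos by (auto simp: f_def v0_def split: sum.split)
      then show "holds C' \<phi> (map (case_sum id ((!) (map e0 us))) (map f zs))"
        using hv0 by (simp only:)
    qed
    then have "holds C' \<psi> ws"
      using \<psi>(3)[of id C'] A univ_subset Ext.is_struct by simp
    then have "holds C \<psi> ws"
      using holds_extension[of ws \<psi>] \<psi>(1,2) A by simp
    then have "R C id"
      using \<psi>(3)[of id C] A is_struct by simp
    then obtain y where y: "y \<in> tuples C (length us)" "holds C \<phi> (map (case_sum id ((!) y)) (map f zs))"
      unfolding R_def by blast
    obtain c0 where c0: "c0 \<in> univ C" using univ_nonempty by blast
    define e where "e = case_sum (\<lambda>v. if v \<in> set us then y ! pos v else c0) (id :: 'a \<Rightarrow> 'a)"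
    have "e z \<in> univ C" if z: "z \<in> V <+> A" for z
    proof (cases z)
      case (Inl v)
      have "y ! pos v \<in> univ C" if "v \<in> set us"
        using pos that y(1) by (auto simp: tuples_def)
      then show ?thesis using c0 by (simp add: e_def Inl)
    next
      case (Inr a)
      then show ?thesis using A z by (auto simp: e_def)
    qed
    then have eu: "e ` (V <+> A) \<subseteq> univ C" by blast
    have "map (case_sum id ((!) y)) (map f zs) = map e zs"
      using us by (auto simp: f_def e_def split: sum.split)
    then have "holds C \<phi> (map e zs)" using y(2) by (simp only:)
    then have "\<forall>q \<in> X0. Q q C e"
      using \<phi>(3)[OF eu is_struct] by (simp only:)
    with eu show "\<exists>e. e ` (V <+> A) \<subseteq> univ C \<and> (\<forall>v \<in> Inr ` A. e v = case_sum undefined id v) \<and> (\<forall>P \<in> F0. P C e)"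
      using X0(3) by (intro exI[of _ e]) (auto simp: e_def)
  qed (use A in auto)
  then obtain e where e: "e ` (V <+> A) \<subseteq> univ C" "\<forall>v \<in> Inr ` A. e v = case_sum undefined id v"
    "\<forall>P \<in> Q ` X. P C e" by blast
  show thesis
  proof (rule that[of "e \<circ> Inl"])
    show "(e \<circ> Inl) ` V \<subseteq> univ C" using e(1) by auto
    fix \<phi> zs
    assume zs: "set zs \<subseteq> V <+> A" "\<phi> \<in> fms L (length zs)"
    have ez: "case_sum (e \<circ> Inl) id z = e z" if "z \<in> V <+> A" for z
      using that e(2) by (cases z) auto
    then have map_ez: "map (case_sum (e \<circ> Inl) id) zs = map e zs" using zs(1) by auto
    have "holds C' \<psi> (map v0 zs) \<Longrightarrow> holds C \<psi> (map e zs)" if "\<psi> \<in> fms L (length zs)" for \<psi>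
      using e(3) that zs(1) by (force simp: X_def Q_def)
    from this[of \<phi>] this[of "Neg \<phi>"] zs(2)
    show "holds C \<phi> (map (case_sum (e \<circ> Inl) id) zs) \<longleftrightarrow> holds C' \<phi> (map (case_sum e0 id) zs)"
      unfolding map_ez v0_def[symmetric] by (auto simp: holds_def fms_def)
  qed
qed

lemma list_preimage:
  assumes "set bs \<subseteq> f ` X"
  obtains zs where "set zs \<subseteq> X" "map f zs = bs"
proof -
  have "\<forall>b \<in> set bs. \<exists>z. z \<in> X \<and> f z = b" using assms by blast
  then obtain g where "\<forall>b \<in> set bs. g b \<in> X \<and> f (g b) = b"
    by (rule bchoice[THEN exE])
  then have "set (map g bs) \<subseteq> X" "map f (map g bs) = bs"
    by (auto simp: map_idI)
  then show thesis by (rule that)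
qed

definition seq_vars :: "('k \<Rightarrow> nat) \<Rightarrow> 'k \<Rightarrow> 'i \<Rightarrow> ('k \<times> 'i \<times> nat) list" where
  "seq_vars m \<alpha> i = map (\<lambda>l. (\<alpha>, i, l)) [0..<m \<alpha>]"

lemma length_seq_vars: "length (seq_vars m \<alpha> i) = m \<alpha>"
  by (simp add: seq_vars_def)

context generically_stable_extension
begin

text \<open>
  Only the type over \<open>A\<close> of the family is preserved when it is copied to \<open>C\<close>, whereas the witnessing
  formulas have parameters from \<open>C\<close>. Therefore these parameters are first made part of the sequences.
  As they lie in the set over which the family is mutually indiscernible, the extended family is mutually
  indiscernible over \<open>A\<close>.
\<close>

theorem not_dpr_less_restrict:
  fixes \<kappa> :: "'k rel"
  assumes K: "|Field \<kappa>| \<le>o |{\<phi>. wf_fm L \<phi>}|" and not: "\<not> dpr_less L C' n (univ C) p \<kappa>"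
  shows "\<not> dpr_less L C n A (restrict_type p A) \<kappa>"
proof -
  define K where "K = Field \<kappa>"
  obtain m and r :: "'k \<Rightarrow> 'a list rel" and I b x y c \<chi> where
    wit: "Ext.dpr_witness n (univ C) p K m r I b x y c \<chi>"
    using Ext.dpr_witness_of_not_less[OF not univ_subset] unfolding K_def by blast
  note w = Ext.dpr_witnessD[OF wit]
  have b_tup: "b \<in> tuples C' n" using w(1) by (simp add: realizes_def)
  have I_tup: "I \<beta> i \<in> tuples C' (m \<beta>)" if "\<beta> \<in> K" "i \<in> Field (r \<beta>)" for \<beta> i
    using Ext.is_seqD[OF w(3)[OF that(1)] that(2)] .
  define m' where "m' \<beta> = m \<beta> + length (c \<beta>)" for \<beta>
  define J where "J = (\<lambda>\<beta> i. I \<beta> i @ c \<beta>)"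
  have J_tup: "J \<beta> i \<in> tuples C' (m' \<beta>)" if "\<beta> \<in> K" "i \<in> Field (r \<beta>)" for \<beta> i
    using I_tup[OF that] w(9)[OF that(1)] univ_subset by (auto simp: J_def m'_def tuples_def)
  define SV where "SV = (SIGMA \<beta>:K. Field (r \<beta>) \<times> {..<m' \<beta>})"
  define V where "V = SV <+> {..<n}"
  have "small V"
    unfolding V_def SV_def
    by (intro small_Plus small_finite small_Sigma[OF K[folded K_def]] countable_SIGMA countable_finite w(5)) simp_all
  define e0 where "e0 = case_sum (\<lambda>(\<beta>, i, l). J \<beta> i ! l) ((!) b)"
  have "e0 ` V \<subseteq> univ C'"
  proof
    fix z
    assume "z \<in> e0 ` V"
    then obtain v where v: "v \<in> V" "z = e0 v" by blast
    show "z \<in> univ C'"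
    proof (cases v)
      case (Inl s)
      obtain \<beta> i l where s: "s = (\<beta>, i, l)" by (cases s)
      then have "\<beta> \<in> K" "i \<in> Field (r \<beta>)" "l < m' \<beta>"
        using v Inl by (auto simp: V_def SV_def)
      then show ?thesis using J_tup[of \<beta> i] v(2) Inl s by (auto simp: tuples_def e0_def)
    next
      case (Inr l)
      then show ?thesis using v b_tup by (auto simp: V_def tuples_def e0_def)
    qed
  qed
  with \<open>small V\<close> obtain e where e: "e ` V \<subseteq> univ C" and copy: "\<And>\<phi> zs. set zs \<subseteq> V <+> A \<Longrightarrow>
    \<phi> \<in> fms L (length zs) \<Longrightarrow> holds C \<phi> (map (case_sum e id) zs) \<longleftrightarrow> holds C' \<phi> (map (case_sum e0 id) zs)"
    by (rule small_family_copy) (rule that)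
  define val0 where "val0 = case_sum e0 (id :: 'a \<Rightarrow> 'a)"
  define val where "val = case_sum e (id :: 'a \<Rightarrow> 'a)"
  have valu: "val z \<in> univ C" if "z \<in> V <+> A" for z
    by (rule sum.exhaust[of z]) (use that e A in \<open>auto simp: val_def\<close>)
  define jv :: "'k \<Rightarrow> 'a list \<Rightarrow> ((('k \<times> 'a list \<times> nat) + nat) + 'a) list" where "jv \<beta> i = map (Inl \<circ> Inl) (seq_vars m' \<beta> i)" for \<beta> i
  define bv :: "((('k \<times> 'a list \<times> nat) + nat) + 'a) list" where "bv = map (Inl \<circ> Inr) [0..<n]"
  have jvV: "set (jv \<beta> i) \<subseteq> V <+> A" if "\<beta> \<in> K" "i \<in> Field (r \<beta>)" for \<beta> i
    using that by (auto simp: jv_def seq_vars_def V_def SV_def)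
  have bvV: "set bv \<subseteq> V <+> A" by (auto simp: bv_def V_def)
  have val0_jv: "map val0 (jv \<beta> i) = J \<beta> i" if "\<beta> \<in> K" "i \<in> Field (r \<beta>)" for \<beta> i
    using J_tup[OF that] by (intro nth_equalityI) (auto simp: jv_def seq_vars_def val0_def e0_def tuples_def)
  have val0_bv: "map val0 bv = b"
    using b_tup by (intro nth_equalityI) (auto simp: bv_def val0_def e0_def tuples_def)
  define J' where "J' = (\<lambda>\<beta> i. map val (jv \<beta> i))"
  define b' where "b' = map val bv"
  have len_jv: "length (jv \<beta> i) = m' \<beta>" for \<beta> i by (simp add: jv_def length_seq_vars)
  have J'_tup: "J' \<beta> i \<in> tuples C (m' \<beta>)" if "\<beta> \<in> K" "i \<in> Field (r \<beta>)" for \<beta> i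
    using jvV[OF that] valu by (auto simp: J'_def tuples_def len_jv)
  have b'_tup: "b' \<in> tuples C n"
    using bvV valu by (auto simp: b'_def tuples_def) (simp add: bv_def)
  have copy': "holds C \<phi> (map val zs) \<longleftrightarrow> holds C' \<phi> (map val0 zs)"
    if "set zs \<subseteq> V <+> A" "\<phi> \<in> fms L (length zs)" for \<phi> zs
    unfolding val_def val0_def using copy that by blast
  have "generic A b'"
    unfolding realizes_def
  proof (intro conjI ballI)
    show "b' \<in> tuples C n" by (rule b'_tup)
    fix q
    assume q: "q \<in> restrict_type p A"
    obtain \<phi> a where [simp]: "q = (\<phi>, a)" by force
    have a: "(\<phi>, a) \<in> p" "set a \<subseteq> A" "\<phi> \<in> fms L (n + length a)"
      using q p_subset by (auto simp: restrict_type_def pfms_def)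
    have "holds C \<phi> (map val (bv @ map Inr a)) \<longleftrightarrow> holds C' \<phi> (map val0 (bv @ map Inr a))"
      using bvV a(2,3) by (intro copy') (auto simp: bv_def)
    moreover have "map val (map Inr a) = a" "map val0 (map Inr a) = a"
      by (simp_all add: val_def val0_def comp_def)
    moreover have "holds C' \<phi> (b @ a)" using w(1) a(1) by (auto simp: realizes_def)
    ultimately show "case q of (\<phi>, a) \<Rightarrow> holds C \<phi> (b' @ a)"
      by (simp only: map_append val0_bv b'_def[symmetric] prod.case \<open>q = (\<phi>, a)\<close>)
  qed
  moreover have mut: "mutually_indiscernible L C A K r J'"
    unfolding mutually_indiscernible_def indiscernible_def
  proof (intro ballI allI impI)
    fix \<alpha> "is" js
    assume \<alpha>: "\<alpha> \<in> K" and inc: "increasing (r \<alpha>) is \<and> increasing (r \<alpha>) js \<and> length is = length js"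
    have isF: "set is \<subseteq> Field (r \<alpha>)" and jsF: "set js \<subseteq> Field (r \<alpha>)"
      using inc increasing_subset by blast+
    define E where "E = A \<union> (\<Union>\<beta> \<in> K - {\<alpha>}. entries (J' \<beta>) (Field (r \<beta>)))"
    define Z :: "((('k \<times> 'a list \<times> nat) + nat) + 'a) set"
      where "Z = Inl ` Inl ` (SIGMA \<beta>:K - {\<alpha>}. Field (r \<beta>) \<times> {..<m' \<beta>}) \<union> Inr ` A"
    have ZV: "Z \<subseteq> V <+> A" by (auto simp: Z_def V_def SV_def)
    have EZ: "E \<subseteq> val ` Z"
    proof
      fix z
      assume "z \<in> E"
      then consider "z \<in> A" | \<beta> i where "\<beta> \<in> K" "\<beta> \<noteq> \<alpha>" "i \<in> Field (r \<beta>)" "z \<in> set (J' \<beta> i)"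
        unfolding E_def entries_def by blast
      then show "z \<in> val ` Z"
      proof cases
        case 1
        then have "Inr z \<in> Z" "val (Inr z) = z" by (auto simp: Z_def val_def)
        then show ?thesis by (metis imageI)
      next
        case (2 \<beta> i)
        then obtain v where "v \<in> set (jv \<beta> i)" "z = val v" by (auto simp: J'_def)
        moreover from this have "v \<in> Z"
          using 2 by (auto simp: Z_def jv_def seq_vars_def)
        ultimately show ?thesis by blast
      qed
    qed
    have lenJ: "length (concat (map (J' \<alpha>) v)) = length v * m' \<alpha>" if "set v \<subseteq> Field (r \<alpha>)" for v
      using J'_tup[OF \<alpha>] that by (intro length_concat_tuples) blast
    have iff: "holds C \<phi> (concat (map (J' \<alpha>) is) @ bb) \<longleftrightarrow> holds C \<phi> (concat (map (J' \<alpha>) js) @ bb)"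
      if \<phi>: "\<phi> \<in> fms L (length is * m' \<alpha> + length bb)" and bb: "set bb \<subseteq> E" for \<phi> bb
    proof -
      obtain bz where bz: "set bz \<subseteq> Z" "map val bz = bb"
        using list_preimage[of bb val Z] bb EZ by blast
      have len: "length bz = length bb" using bz(2) by (metis length_map)
      have trans: "holds C \<phi> (concat (map (J' \<alpha>) v) @ bb) \<longleftrightarrow> holds C' \<phi> (concat (map (J \<alpha>) v) @ map val0 bz)"
        if v: "set v \<subseteq> Field (r \<alpha>)" "length v = length is" for v
      proof -
        have "map val (concat (map (jv \<alpha>) v)) = concat (map (J' \<alpha>) v)"
          by (simp add: J'_def map_concat comp_def)
        moreover have "map (map val0) (map (jv \<alpha>) v) = map (J \<alpha>) v"
          using val0_jv[OF \<alpha>] v(1) by auto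
        then have "map val0 (concat (map (jv \<alpha>) v)) = concat (map (J \<alpha>) v)"
          by (simp only: map_concat)
        moreover have "holds C \<phi> (map val (concat (map (jv \<alpha>) v) @ bz)) \<longleftrightarrow>
            holds C' \<phi> (map val0 (concat (map (jv \<alpha>) v) @ bz))"
        proof (rule copy')
          show "set (concat (map (jv \<alpha>) v) @ bz) \<subseteq> V <+> A"
            using jvV[OF \<alpha>] v(1) bz(1) ZV by auto
          have "length (concat (map (jv \<alpha>) v)) = length v * m' \<alpha>"
            by (induction v) (simp_all add: len_jv)
          then show "\<phi> \<in> fms L (length (concat (map (jv \<alpha>) v) @ bz))"
            using \<phi> v(2) len by simp
        qed
        ultimately show ?thesis by (simp only: map_append bz(2))
      qed
      define B0 where "B0 = set (c \<alpha>) \<union> set (map val0 bz)"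
      have "val0 v \<in> univ C \<union> (\<Union>\<beta> \<in> K - {\<alpha>}. entries (I \<beta>) (Field (r \<beta>)))" if v: "v \<in> Z" for v
      proof -
        from v consider a where "v = Inr a" "a \<in> A"
          | \<beta> i l where "v = Inl (Inl (\<beta>, i, l))" "\<beta> \<in> K" "\<beta> \<noteq> \<alpha>" "i \<in> Field (r \<beta>)" "l < m' \<beta>"
          unfolding Z_def by auto
        then show ?thesis
        proof cases
          case 1
          then show ?thesis using A by (auto simp: val0_def)
        next
          case (2 \<beta> i l)
          have "J \<beta> i ! l \<in> set (I \<beta> i) \<union> set (c \<beta>)"
            using J_tup[OF 2(2,4)] 2(5) nth_mem[of l "J \<beta> i"] by (auto simp: tuples_def J_def)
          moreover have "val0 v = J \<beta> i ! l" by (simp add: 2(1) val0_def e0_def)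
          moreover have "set (I \<beta> i) \<subseteq> (\<Union>\<beta> \<in> K - {\<alpha>}. entries (I \<beta>) (Field (r \<beta>)))"
            using 2(2-4) unfolding entries_def by fastforce
          ultimately show ?thesis
            using subsetD[OF w(9)[OF 2(2)], of "val0 v"] by (elim UnE) (auto simp only: Un_iff)
        qed
      qed
      then have B0: "B0 \<subseteq> univ C \<union> (\<Union>\<beta> \<in> K - {\<alpha>}. entries (I \<beta>) (Field (r \<beta>)))"
        unfolding B0_def using w(9)[OF \<alpha>] bz(1) by auto
      have "entries (I \<beta>) (Field (r \<beta>)) \<subseteq> univ C'" if "\<beta> \<in> K" for \<beta>
        unfolding entries_def using I_tup[OF that] by (auto simp: tuples_def)
      then have B0u: "B0 \<subseteq> univ C'"
        using B0 univ_subset by blast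
      have ind: "indiscernible L C' (univ C \<union> (\<Union>\<beta> \<in> K - {\<alpha>}. entries (I \<beta>) (Field (r \<beta>)))) (r \<alpha>) (I \<alpha>)"
        using w(2) \<alpha> unfolding mutually_indiscernible_def by blast
      have "Ext.small B0" by (rule Ext.small_finite) (simp add: B0_def)
      then obtain \<sigma> where \<sigma>: "\<sigma> \<in> Ext.aut_fixing B0" "map (map \<sigma>) (map (I \<alpha>) is) = map (I \<alpha>) js"
        using Ext.indiscernible_aut[OF ind w(3)[OF \<alpha>] _ _ _ B0 B0u] inc by blast
      have \<sigma>c: "map \<sigma> (c \<alpha>) = c \<alpha>" and \<sigma>bz: "map \<sigma> (map val0 bz) = map val0 bz"
        by (rule Ext.aut_fixing_map[OF \<sigma>(1)]; simp add: B0_def)+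
      have "map (map \<sigma>) (map (J \<alpha>) is) = map (\<lambda>xs. xs @ c \<alpha>) (map (map \<sigma>) (map (I \<alpha>) is))"
        by (simp add: J_def \<sigma>c)
      also have "\<dots> = map (J \<alpha>) js"
        unfolding \<sigma>(2) by (simp add: J_def)
      finally have "map \<sigma> (concat (map (J \<alpha>) is) @ map val0 bz) = concat (map (J \<alpha>) js) @ map val0 bz"
        by (simp only: map_append map_concat \<sigma>bz)
      moreover have "holds C' \<phi> (map \<sigma> (concat (map (J \<alpha>) is) @ map val0 bz)) \<longleftrightarrow>
          holds C' \<phi> (concat (map (J \<alpha>) is) @ map val0 bz)"
      proof (rule Ext.aut_holds[OF \<sigma>(1)])
        have "concat (map (J \<alpha>) is) \<in> tuples C' (length is * m' \<alpha>)"
          using J_tup[OF \<alpha>] isF by (intro Ext.concat_tuples) blast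
        then show "\<phi> \<in> fms L (length (concat (map (J \<alpha>) is) @ map val0 bz))"
          "set (concat (map (J \<alpha>) is) @ map val0 bz) \<subseteq> univ C'"
          using \<phi> len B0u by (auto simp: tuples_def B0_def)
      qed
      ultimately have "holds C' \<phi> (concat (map (J \<alpha>) js) @ map val0 bz) \<longleftrightarrow>
          holds C' \<phi> (concat (map (J \<alpha>) is) @ map val0 bz)"
        by (simp only:)
      moreover have "length js = length is" using inc by simp
      ultimately show ?thesis
        using trans[OF isF refl] trans[OF jsF] by blast
    qed
    have "tp L C (concat (map (J' \<alpha>) is)) E = tp L C (concat (map (J' \<alpha>) js)) E"
      using iff lenJ[OF isF] lenJ[OF jsF] inc by (auto simp: tp_def pfms_def)
    then show "tp L C (concat (map (J' \<alpha>) is)) (A \<union> (\<Union>\<beta> \<in> K - {\<alpha>}. entries (J' \<beta>) (Field (r \<beta>)))) =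
      tp L C (concat (map (J' \<alpha>) js)) (A \<union> (\<Union>\<beta> \<in> K - {\<alpha>}. entries (J' \<beta>) (Field (r \<beta>))))"
      unfolding E_def .
  qed
  moreover have seq: "is_seq C (m' \<beta>) (r \<beta>) (J' \<beta>)" if "\<beta> \<in> K" for \<beta>
    using w(3)[OF that] J'_tup[OF that] unfolding is_seq_def by blast
  moreover have "\<not> indiscernible L C (A \<union> set b') (r \<beta>) (J' \<beta>)" if \<beta>: "\<beta> \<in> K" for \<beta>
  proof
    assume ind: "indiscernible L C (A \<union> set b') (r \<beta>) (J' \<beta>)"
    have x: "x \<beta> \<noteq> []" and y: "y \<beta> \<noteq> []"
      using w(8,11,12)[OF \<beta>] by auto
    have xF: "set (x \<beta>) \<subseteq> Field (r \<beta>)" and yF: "set (y \<beta>) \<subseteq> Field (r \<beta>)"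
      using w(6,7)[OF \<beta>] increasing_subset by blast+
    \<comment> \<open>The parameters can be read off from any one of the extended tuples, here the first.\<close>
    define zs where "zs v = concat (map (\<lambda>i. take (m \<beta>) (jv \<beta> i)) v) @ drop (m \<beta>) (jv \<beta> (hd v)) @ bv" for v
    have zsV: "set (zs v) \<subseteq> V <+> A" if "v \<noteq> []" "set v \<subseteq> Field (r \<beta>)" for v
    proof -
      have "set (take (m \<beta>) (jv \<beta> i)) \<subseteq> V <+> A" "set (drop (m \<beta>) (jv \<beta> i)) \<subseteq> V <+> A" if "i \<in> set v" for i
        using jvV[OF \<beta>, of i] that \<open>set v \<subseteq> Field (r \<beta>)\<close> set_take_subset set_drop_subset by fast+
      then show ?thesis using bvV that(1) by (auto simp: zs_def)
    qed
    have val_zs: "map val (zs v) = concat (map (take (m \<beta>)) (map (J' \<beta>) v)) @ drop (m \<beta>) (hd (map (J' \<beta>) v)) @ b'"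
      if "v \<noteq> []" for v
      using that by (simp add: zs_def b'_def J'_def map_concat comp_def take_map drop_map hd_map)
    have val0_zs: "map val0 (zs v) = concat (map (I \<beta>) v) @ c \<beta> @ b"
      if v: "v \<noteq> []" "set v \<subseteq> Field (r \<beta>)" for v
    proof -
      have J: "map val0 (take (m \<beta>) (jv \<beta> i)) = I \<beta> i" "map val0 (drop (m \<beta>) (jv \<beta> i)) = c \<beta>" if "i \<in> set v" for i
        using val0_jv[OF \<beta>, of i] I_tup[OF \<beta>, of i] that v(2)
        by (auto simp: take_map[symmetric] drop_map[symmetric] J_def tuples_def)
      have eq: "map (\<lambda>i. map val0 (take (m \<beta>) (jv \<beta> i))) v = map (I \<beta>) v"
        using J(1) by simp
      show ?thesis
        using J(2)[of "hd v"] v(1) by (simp add: zs_def map_concat comp_def val0_bv eq)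
    qed
    have len: "length (zs v) = length v * m \<beta> + (length (c \<beta>) + n)" if "v \<noteq> []" "set v \<subseteq> Field (r \<beta>)" for v
    proof -
      have "length (concat (map (I \<beta>) v)) = length v * m \<beta>"
        using I_tup[OF \<beta>] that(2) by (intro Ext.length_concat_tuples) blast
      moreover have "length (zs v) = length (concat (map (I \<beta>) v) @ c \<beta> @ b)"
        by (metis length_map val0_zs[OF that])
      ultimately show ?thesis using b_tup by (simp add: tuples_def)
    qed
    have \<chi>: "\<chi> \<beta> \<in> fms L (length (zs (x \<beta>)))" "\<chi> \<beta> \<in> fms L (length (zs (y \<beta>)))"
      using w(10)[OF \<beta>] w(8)[OF \<beta>] len[OF x xF] len[OF y yF] by simp_all
    have hx: "holds C (\<chi> \<beta>) (map val (zs (x \<beta>)))"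
      using copy'[OF zsV[OF x xF] \<chi>(1)] w(11)[OF \<beta>] unfolding val0_zs[OF x xF] by blast
    have hy: "\<not> holds C (\<chi> \<beta>) (map val (zs (y \<beta>)))"
      using copy'[OF zsV[OF y yF] \<chi>(2)] w(12)[OF \<beta>] unfolding val0_zs[OF y yF] by blast
    have "set b' \<subseteq> univ C" using b'_tup by (simp add: tuples_def)
    then obtain \<sigma> where \<sigma>: "\<sigma> \<in> aut_fixing (set b')" "map (map \<sigma>) (map (J' \<beta>) (x \<beta>)) = map (J' \<beta>) (y \<beta>)"
      using indiscernible_aut[OF ind seq[OF \<beta>] w(6)[OF \<beta>] w(7)[OF \<beta>] w(8)[OF \<beta>], of "set b'"]
        small_finite[OF finite_set, of b'] by blast
    have "map \<sigma> (map val (zs (x \<beta>))) =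
        concat (map (take (m \<beta>)) (map (map \<sigma>) (map (J' \<beta>) (x \<beta>)))) @
        drop (m \<beta>) (hd (map (map \<sigma>) (map (J' \<beta>) (x \<beta>)))) @ map \<sigma> b'"
      unfolding val_zs[OF x] using x by (simp add: map_concat comp_def take_map drop_map hd_map)
    also have "\<dots> = map val (zs (y \<beta>))"
      unfolding \<sigma>(2) val_zs[OF y] using aut_fixing_map[OF \<sigma>(1) subset_refl] by simp
    finally have "map \<sigma> (map val (zs (x \<beta>))) = map val (zs (y \<beta>))" .
    moreover have "holds C (\<chi> \<beta>) (map \<sigma> (map val (zs (x \<beta>)))) \<longleftrightarrow> holds C (\<chi> \<beta>) (map val (zs (x \<beta>)))"
    proof (rule aut_holds[OF \<sigma>(1)])
      show "set (map val (zs (x \<beta>))) \<subseteq> univ C" using valu zsV[OF x xF] by auto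
    qed (use \<chi>(1) in simp)
    ultimately show False using hx hy by simp
  qed
  ultimately show ?thesis
    using w(4) unfolding dpr_less_def K_def[symmetric] by blast
qed

end

text \<open>
  The variables for compactness are of three sorts: one for each entry of each tuple of the family, one
  for each entry of the realization of \<open>p\<close>, and one for each element of the model, whose value is this
  element.
\<close>

abbreviation family_vars :: "('k \<Rightarrow> nat) \<Rightarrow> 'k \<Rightarrow> 'i \<Rightarrow> ((('k \<times> 'i \<times> nat) + nat) + 'a) list" where
  "family_vars m \<alpha> i \<equiv> map (Inl \<circ> Inl) (seq_vars m \<alpha> i)"

abbreviation tuple_vars :: "nat \<Rightarrow> ((('k \<times> 'i \<times> nat) + nat) + 'a) list" where
  "tuple_vars n \<equiv> map (Inl \<circ> Inr) [0..<n]"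

text \<open>
  A single instance of mutual indiscernibility over the whole model: \<open>\<phi>\<close> does not distinguish the index
  tuples \<open>is\<close> and \<open>js\<close> of sequence \<open>\<alpha>\<close>, with further arguments \<open>bz\<close> from the other sequences and the
  model.
\<close>

definition (in monster) indiscernibility_condition ::
    "'j set \<Rightarrow> ('j \<Rightarrow> 'i rel) \<Rightarrow> ('j \<Rightarrow> nat) \<Rightarrow>
     'j \<times> 'i list \<times> 'i list \<times> ('f, 'r) fm \<times> ((('j \<times> 'i \<times> nat) + nat) + 'a) list \<Rightarrow> bool" where
  "indiscernibility_condition K r m = (\<lambda>(\<alpha>, is, js, \<phi>, bz). \<alpha> \<in> K \<and> increasing (r \<alpha>) is \<and>
     increasing (r \<alpha>) js \<and> length is = length js \<and>
     set bz \<subseteq> Inl ` Inl ` (SIGMA \<beta>:K - {\<alpha>}. Field (r \<beta>) \<times> {..<m \<beta>}) \<union> Inr ` univ M \<and>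
     \<phi> \<in> fms L (length is * m \<alpha> + length bz))"

context generically_stable_type
begin

text \<open>
  Let \<open>\<theta>(x, d)\<close> imply \<open>\<Sigma>0\<close>, where \<open>d\<close> also lists the parameters of \<open>Q0\<close>, and let \<open>map \<sigma> d\<close> for
  \<open>\<sigma> \<in> \<Gamma>\<close> be the conjugates that cover. It is not known in advance which of them will be needed, so the
  subsequences \<open>g\<close> are chosen to satisfy \<open>Q0\<close> with respect to every \<open>\<sigma>\<close>. Only then \<open>\<rho>\<close> moves the given
  subsequences to the chosen ones, \<open>\<sigma>\<close> is determined by \<open>map \<rho> b\<close>, and \<open>\<tau>\<close>, the inverse of
  \<open>\<sigma>\<close>, brings the conjugate of \<open>d\<close> back to \<open>d\<close>.
\<close>

lemma finite_part_realized:
  fixes K :: "'j set" and r :: "'j \<Rightarrow> 'a list rel"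
    and Q0 :: "('j \<times> 'a list list \<times> 'a list list \<times> ('f, 'r) fm \<times> ((('j \<times> 'a list \<times> nat) + nat) + 'a) list) set"
  assumes wit: "dpr_witness n A (restrict_type p A) K m r I b x y c \<chi>"
    and S0: "finite S0" "S0 \<subseteq> K" and \<Sigma>0: "finite \<Sigma>0" "\<Sigma>0 \<subseteq> p"
    and Q0: "finite Q0" "\<And>q. q \<in> Q0 \<Longrightarrow> indiscernibility_condition K r m q"
  obtains e :: "((('j \<times> 'a list \<times> nat) + nat) + 'a) \<Rightarrow> 'a" where
    "e ` (UNIV <+> univ M) \<subseteq> univ M" "\<And>a. e (Inr a) = a"
    "\<And>\<theta> d. (\<theta>, d) \<in> \<Sigma>0 \<Longrightarrow> holds M \<theta> (map e (tuple_vars n @ map Inr d))"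
    "\<And>\<alpha> is js \<phi> bz. (\<alpha>, is, js, \<phi>, bz) \<in> Q0 \<Longrightarrow>
      holds M \<phi> (map e (concat (map (family_vars m \<alpha>) is) @ bz)) \<longleftrightarrow>
      holds M \<phi> (map e (concat (map (family_vars m \<alpha>) js) @ bz))"
    "\<And>\<beta>. \<beta> \<in> S0 \<Longrightarrow>
      holds M (\<chi> \<beta>) (map e (concat (map (family_vars m \<beta>) (x \<beta>)) @ map Inr (c \<beta>) @ tuple_vars n)) \<and>
      \<not> holds M (\<chi> \<beta>) (map e (concat (map (family_vars m \<beta>) (y \<beta>)) @ map Inr (c \<beta>) @ tuple_vars n))"
proof -
  note w = dpr_witnessD[OF wit]
  have b_tup: "b \<in> tuples M n" using w(1) by (rule generic_tuple)
  have I_tup: "I \<beta> i \<in> tuples M (m \<beta>)" if "\<beta> \<in> K" "i \<in> Field (r \<beta>)" for \<beta> i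
    using is_seqD[OF w(3)[OF that(1)] that(2)] .
  have Q: "\<alpha> \<in> K" "increasing (r \<alpha>) is" "increasing (r \<alpha>) js" "length is = length js"
    "set bz \<subseteq> Inl ` Inl ` (SIGMA \<beta>:K - {\<alpha>}. Field (r \<beta>) \<times> {..<m \<beta>}) \<union> Inr ` univ M"
    "\<phi> \<in> fms L (length is * m \<alpha> + length bz)"
    if "(\<alpha>, is, js, \<phi>, bz) \<in> Q0" for \<alpha> "is" js \<phi> bz
    using Q0(2)[OF that] unfolding indiscernibility_condition_def prod.case by blast+
  \<comment> \<open>The finitely many elements of the sequences and parameters that are mentioned.\<close>
  define slot :: "((('j \<times> 'a list \<times> nat) + nat) + 'a) \<Rightarrow> ('j \<times> 'a list) option" where
    "slot v = (case v of Inl (Inl (\<beta>, i, l)) \<Rightarrow> Some (\<beta>, i) | _ \<Rightarrow> None)" for v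
  define indices where "indices q = (case q of (\<alpha>, is, js, \<phi>, bz) \<Rightarrow>
    {\<alpha>} \<times> (set is \<union> set js) \<union> the ` (slot ` set bz - {None}))"
    for q :: "'j \<times> 'a list list \<times> 'a list list \<times> ('f, 'r) fm \<times> ((('j \<times> 'a list \<times> nat) + nat) + 'a) list"
  have indicesD: "\<beta> = \<alpha> \<and> i \<in> set is \<union> set js \<or> (\<exists>v \<in> set bz. slot v = Some (\<beta>, i))"
    if "(\<beta>, i) \<in> indices (\<alpha>, is, js, \<phi>, bz)" for \<beta> i \<alpha> "is" js \<phi> bz
    using that unfolding indices_def by force
  have indicesI: "{\<alpha>} \<times> (set is \<union> set js) \<subseteq> indices (\<alpha>, is, js, \<phi>, bz)"
    "v \<in> set bz \<Longrightarrow> slot v = Some z \<Longrightarrow> z \<in> indices (\<alpha>, is, js, \<phi>, bz)" for \<alpha> "is" js \<phi> bz v z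
    unfolding indices_def by (simp, force)
  have "finite (indices q)" for q
    unfolding indices_def by (cases q) simp
  define Zp where "Zp = (\<Union>q \<in> Q0. indices q) \<union> (\<Union>\<beta> \<in> S0. {\<beta>} \<times> (set (x \<beta>) \<union> set (y \<beta>)))"
  have finZ: "finite Zp"
    unfolding Zp_def using Q0(1) S0(1) \<open>\<And>q. finite (indices q)\<close> by simp
  have slotD: "\<beta> \<in> K \<and> \<beta> \<noteq> \<alpha> \<and> i \<in> Field (r \<beta>)"
    if "(\<alpha>, is, js, \<phi>, bz) \<in> Q0" "v \<in> set bz" "slot v = Some (\<beta>, i)" for \<alpha> "is" js \<phi> bz v \<beta> i
    using Q(5)[OF that(1)] that(2,3) by (auto simp: slot_def split: sum.splits)
  have ZK: "\<beta> \<in> K \<and> i \<in> Field (r \<beta>)" if "(\<beta>, i) \<in> Zp" for \<beta> i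
  proof -
    from that consider q where "q \<in> Q0" "(\<beta>, i) \<in> indices q" | "\<beta> \<in> S0" "i \<in> set (x \<beta>) \<union> set (y \<beta>)"
      unfolding Zp_def by blast
    then show ?thesis
    proof cases
      case (1 q)
      obtain \<alpha> "is" js \<phi> bz where q: "q = (\<alpha>, is, js, \<phi>, bz)" by (cases q)
      then consider "\<beta> = \<alpha>" "i \<in> set is \<union> set js" | v where "v \<in> set bz" "slot v = Some (\<beta>, i)"
        using indicesD[of \<beta> i \<alpha> "is" js \<phi> bz] 1(2) by blast
      then show ?thesis
      proof cases
        case 1
        have "(\<alpha>, is, js, \<phi>, bz) \<in> Q0" using \<open>q \<in> Q0\<close> q by simp
        from Q(1-3)[OF this] 1 show ?thesis using increasing_subset[of "r \<alpha>"] by blast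
      next
        case 2
        have "(\<alpha>, is, js, \<phi>, bz) \<in> Q0" using \<open>q \<in> Q0\<close> q by simp
        from slotD[OF this 2] show ?thesis by blast
      qed
    next
      case 2
      have "\<beta> \<in> K" using 2(1) S0(2) by blast
      with w(6,7)[OF this] 2(2) show ?thesis using increasing_subset[of "r \<beta>"] by blast
    qed
  qed
  define S where "S = S0 \<union> fst ` Q0 \<union> fst ` Zp"
  define Y where "Y \<beta> = {i. (\<beta>, i) \<in> Zp}" for \<beta>
  have "fst ` Q0 \<subseteq> K" using Q(1) by auto
  moreover have "fst ` Zp \<subseteq> K" using ZK by auto
  ultimately have S: "finite S" "S \<subseteq> K"
    using finZ S0 Q0(1) by (auto simp: S_def)
  have Y: "finite (Y \<beta>)" "Y \<beta> \<subseteq> Field (r \<beta>)" for \<beta>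
  proof -
    have "Y \<beta> \<subseteq> snd ` Zp" by (force simp: Y_def)
    then show "finite (Y \<beta>)" using finZ finite_surj by blast
    show "Y \<beta> \<subseteq> Field (r \<beta>)" using ZK by (auto simp: Y_def)
  qed
  have YS: "\<beta> \<in> S" if "i \<in> Y \<beta>" for \<beta> i
    using that by (force simp: Y_def S_def)
  have slotY: "i \<in> Y \<beta>" if "(\<alpha>, is, js, \<phi>, bz) \<in> Q0" "v \<in> set bz" "slot v = Some (\<beta>, i)" for \<alpha> "is" js \<phi> bz v \<beta> i
    using indicesI(2)[OF that(2,3)] that(1) unfolding Y_def Zp_def by blast
  have isY: "set is \<union> set js \<subseteq> Y \<alpha>" if "(\<alpha>, is, js, \<phi>, bz) \<in> Q0" for \<alpha> "is" js \<phi> bz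
    using indicesI(1)[of \<alpha> "is" js \<phi> bz] that unfolding Y_def Zp_def by blast
  have xyY: "set (x \<beta>) \<union> set (y \<beta>) \<subseteq> Y \<beta>" if "\<beta> \<in> S0" for \<beta>
    using that unfolding Y_def Zp_def by blast
  define params where "params q = Inr -` set (snd (snd (snd (snd q))))"
    for q :: "'j \<times> 'a list list \<times> 'a list list \<times> ('f, 'r) fm \<times> ((('j \<times> 'a list \<times> nat) + nat) + 'a) list"
  have "finite (params q)" for q
    unfolding params_def by (intro finite_vimageI) auto
  then have "finite (\<Union>q \<in> Q0. params q)" using Q0(1) by blast
  then have "\<exists>d1. set d1 = (\<Union>q \<in> Q0. params q)" by (rule finite_list)
  then obtain d1 where d1: "set d1 = (\<Union>q \<in> Q0. params q)" by blast
  have d1u: "set d1 \<subseteq> univ M"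
  proof
    fix a
    assume "a \<in> set d1"
    then obtain q where q: "q \<in> Q0" "a \<in> params q" unfolding d1 by blast
    obtain \<alpha> "is" js \<phi> bz where "q = (\<alpha>, is, js, \<phi>, bz)" by (cases q)
    with q have "(\<alpha>, is, js, \<phi>, bz) \<in> Q0" "Inr a \<in> set bz" by (simp_all add: params_def)
    from subsetD[OF Q(5)[OF this(1)] this(2)] show "a \<in> univ M" by auto
  qed
  have "\<Sigma>0 \<subseteq> restrict_type p (univ M)"
    using \<Sigma>0(2) p_subset by (fastforce simp: restrict_type_def pfms_def)
  then obtain \<theta>0 d0 where \<theta>0: "(\<theta>0, d0) \<in> p" "\<And>z. z \<in> tuples M n \<Longrightarrow> holds M \<theta>0 (z @ d0) \<Longrightarrow> realizes M n \<Sigma>0 z"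
    using p_conj[OF \<Sigma>0(1) _ order_refl] restrict_subset(2) by blast
  define d where "d = d0 @ d1"
  have d0: "set d0 \<subseteq> univ M" "\<theta>0 \<in> fms L (n + length d0)"
    using \<theta>0(1) p_subset by (auto simp: pfms_def)
  have du: "set d \<subseteq> univ M" "set d0 \<subseteq> set d" using d0 d1u by (auto simp: d_def)
  obtain \<theta> where \<theta>: "\<theta> \<in> fms L (n + length d)"
    "\<And>z. z \<in> tuples M n \<Longrightarrow> holds M \<theta> (z @ d) \<longleftrightarrow> holds M \<theta>0 (z @ d0)"
    using pfm_recode[OF d0(2) du(2,1)] by blast
  have "(\<theta>, d) \<in> p"
    by (rule p_closed[of "{(\<theta>0, d0)}"]) (use \<theta>0(1) \<theta> du in \<open>auto simp: pfms_def realizes_def\<close>)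
  from covered_by_conjugates[OF this] obtain D where D: "finite D" "D \<subseteq> conjugates d"
    "\<And>z. generic A z \<Longrightarrow> \<exists>d' \<in> D. holds M \<theta> (z @ d')"
    by blast
  have "D \<subseteq> (\<lambda>\<sigma>. map \<sigma> d) ` aut_fixing A"
    using D(2) unfolding conjugates_def by blast
  then obtain \<Gamma> where \<Gamma>: "\<Gamma> \<subseteq> aut_fixing A" "finite \<Gamma>" "D = (\<lambda>\<sigma>. map \<sigma> d) ` \<Gamma>"
    using finite_subset_image[OF D(1)] by blast
  \<comment> \<open>Finite subsequences that are mutually indiscernible over all the conjugates of the parameters.\<close>
  define decode where "decode \<sigma> v j = (case v of Inl (Inl (\<beta>, i, l)) \<Rightarrow> I \<beta> j ! l | Inl (Inr l) \<Rightarrow> undefined | Inr a \<Rightarrow> \<sigma> a)"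
    for \<sigma> :: "'a \<Rightarrow> 'a" and v :: "((('j \<times> 'a list \<times> nat) + nat) + 'a)" and j
  define test where "test = (\<lambda>((\<alpha>, is :: 'a list list, js :: 'a list list, \<phi>, bz), \<sigma>).
    (\<alpha>, is, js, map Inl [0..<length is] @ map (Inr \<circ> slot) bz, \<lambda>w. holds M \<phi> (concat (map (I \<alpha>) (take (length is) w)) @
      map2 (decode \<sigma>) bz (drop (length is) w))))"
  obtain g where gF: "\<And>\<beta> i. \<beta> \<in> S \<Longrightarrow> i \<in> Y \<beta> \<Longrightarrow> g \<beta> i \<in> Field (r \<beta>)"
    and g_mono: "\<And>\<beta> i i'. \<beta> \<in> S \<Longrightarrow> i \<in> Y \<beta> \<Longrightarrow> i' \<in> Y \<beta> \<Longrightarrow> (i, i') \<in> r \<beta> \<Longrightarrow> i \<noteq> i' \<Longrightarrow>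
      (g \<beta> i, g \<beta> i') \<in> r \<beta> \<and> g \<beta> i \<noteq> g \<beta> i'"
    and hom: "\<And>\<alpha> is js ts \<Phi>. (\<alpha>, is, js, ts, \<Phi>) \<in> test ` (Q0 \<times> \<Gamma>) \<Longrightarrow>
      \<Phi> (map (substituted g \<alpha> is) ts) \<longleftrightarrow> \<Phi> (map (substituted g \<alpha> js) ts)"
  proof (rule Ramsey_mutual[of S r Y "test ` (Q0 \<times> \<Gamma>)"])
    show "finite S" by (rule S(1))
    show "Linear_order (r \<beta>)" "infinite (Field (r \<beta>))" if "\<beta> \<in> S" for \<beta>
      using w(3,4)[of \<beta>] that S(2) unfolding is_seq_def by blast+
    show "finite (test ` (Q0 \<times> \<Gamma>))" using Q0(1) \<Gamma>(2) by blast
    fix \<alpha> "is" js ts \<Phi>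
    assume "(\<alpha>, is, js, ts, \<Phi>) \<in> test ` (Q0 \<times> \<Gamma>)"
    then obtain q0 \<sigma> where q0: "q0 \<in> Q0" "(\<alpha>, is, js, ts, \<Phi>) = test (q0, \<sigma>)" by blast
    obtain \<alpha>' is' js' \<phi> bz where "q0 = (\<alpha>', is', js', \<phi>, bz)" by (cases q0)
    with q0 have q: "(\<alpha>, is, js, \<phi>, bz) \<in> Q0" and ts: "ts = map Inl [0..<length is] @ map (Inr \<circ> slot) bz"
      by (simp_all add: test_def)
    have "\<alpha> \<in> S" using q by (force simp: S_def)
    moreover have "k < length is" if "Inl k \<in> set ts" for k
      using that by (auto simp: ts)
    moreover have "\<beta> \<in> S \<and> \<beta> \<noteq> \<alpha> \<and> i \<in> Y \<beta>" if "Inr (Some (\<beta>, i)) \<in> set ts" for \<beta> i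
    proof -
      have "Some (\<beta>, i) \<in> slot ` set bz" using that by (auto simp: ts)
      then obtain v where v: "v \<in> set bz" "slot v = Some (\<beta>, i)" by (metis imageE)
      then have "i \<in> Y \<beta>" by (rule slotY[OF q])
      with slotD[OF q v] YS show ?thesis by blast
    qed
    ultimately show "\<alpha> \<in> S \<and> increasing (r \<alpha>) is \<and> increasing (r \<alpha>) js \<and> length is = length js \<and>
      set is \<union> set js \<subseteq> Y \<alpha> \<and> (\<forall>k. Inl k \<in> set ts \<longrightarrow> k < length is) \<and>
      (\<forall>\<beta> i. Inr (Some (\<beta>, i)) \<in> set ts \<longrightarrow> \<beta> \<in> S \<and> \<beta> \<noteq> \<alpha> \<and> i \<in> Y \<beta>)"
      using Q(2-4)[OF q] isY[OF q] by blast
  qed (use Y that in auto)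
  define ev where "ev \<sigma> v = (case v of Inl (Inl (\<beta>, i, l)) \<Rightarrow> I \<beta> (g \<beta> i) ! l | Inl (Inr l) \<Rightarrow> undefined | Inr a \<Rightarrow> \<sigma> a)"
    for \<sigma> :: "'a \<Rightarrow> 'a" and v :: "((('j \<times> 'a list \<times> nat) + nat) + 'a)"
  have hom': "holds M \<phi> (concat (map (I \<alpha>) (map (g \<alpha>) is)) @ map (ev \<sigma>) bz) \<longleftrightarrow>
      holds M \<phi> (concat (map (I \<alpha>) (map (g \<alpha>) js)) @ map (ev \<sigma>) bz)"
    if q: "(\<alpha>, is, js, \<phi>, bz) \<in> Q0" and \<sigma>: "\<sigma> \<in> \<Gamma>" for \<alpha> "is" js \<phi> bz \<sigma>
  proof -
    define ts where "ts = map Inl [0..<length is] @ map (Inr \<circ> slot) bz"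
    define \<Phi> where "\<Phi> = (\<lambda>w. holds M \<phi> (concat (map (I \<alpha>) (take (length is) w)) @
      map2 (decode \<sigma>) bz (drop (length is) w)))"
    have "(\<alpha>, is, js, ts, \<Phi>) = test ((\<alpha>, is, js, \<phi>, bz), \<sigma>)"
      by (simp add: test_def ts_def \<Phi>_def)
    then have "(\<alpha>, is, js, ts, \<Phi>) \<in> test ` (Q0 \<times> \<Gamma>)" using q \<sigma> by blast
    from hom[OF this] have iff: "\<Phi> (map (substituted g \<alpha> is) ts) \<longleftrightarrow> \<Phi> (map (substituted g \<alpha> js) ts)" .
    have "\<Phi> (map (substituted g \<alpha> v) ts) \<longleftrightarrow> holds M \<phi> (concat (map (I \<alpha>) (map (g \<alpha>) v)) @ map (ev \<sigma>) bz)"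
      if v: "length v = length is" for v
    proof -
      have 1: "map (substituted g \<alpha> v) (map Inl [0..<length is]) = map (g \<alpha>) v"
        unfolding v[symmetric] by (intro nth_equalityI) (auto simp: substituted_def)
      have 2: "map2 (decode \<sigma>) bz (map (substituted g \<alpha> v) (map (Inr \<circ> slot) bz)) = map (ev \<sigma>) bz"
        by (induction bz) (auto simp: substituted_def slot_def decode_def ev_def split: sum.split)
      have "map (substituted g \<alpha> v) ts = map (g \<alpha>) v @ map (substituted g \<alpha> v) (map (Inr \<circ> slot) bz)"
        unfolding ts_def map_append 1 ..
      then have "take (length is) (map (substituted g \<alpha> v) ts) = map (g \<alpha>) v"
        "drop (length is) (map (substituted g \<alpha> v) ts) = map (substituted g \<alpha> v) (map (Inr \<circ> slot) bz)"
        using v by simp_all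
      then show ?thesis unfolding \<Phi>_def by (simp only: 2)
    qed
    with iff Q(4)[OF q] show ?thesis by simp
  qed
  have "\<forall>\<beta> \<in> S. \<exists>u. increasing (r \<beta>) u \<and> set u = Y \<beta>"
  proof
    fix \<beta>
    assume "\<beta> \<in> S"
    then have "Linear_order (r \<beta>)" using w(3)[of \<beta>] S(2) unfolding is_seq_def by blast
    then show "\<exists>u. increasing (r \<beta>) u \<and> set u = Y \<beta>"
      by (rule increasing_enumeration[OF _ Y])
  qed
  then obtain u where u: "\<forall>\<beta> \<in> S. increasing (r \<beta>) (u \<beta>) \<and> set (u \<beta>) = Y \<beta>"
    by (rule bchoice[THEN exE])
  \<comment> \<open>The chosen subsequences are conjugate over \<open>A\<close> to the given ones; \<open>b\<close> is moved along.\<close>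
  have "\<exists>\<rho> \<in> aut_fixing A. \<forall>\<beta> \<in> S. map (map \<rho>) (map (I \<beta>) (u \<beta>)) = map (I \<beta>) (map (g \<beta>) (u \<beta>))"
  proof (rule mutually_indiscernible_aut[OF w(2) w(3) S])
    fix \<beta>
    assume \<beta>: "\<beta> \<in> S"
    then have ub: "increasing (r \<beta>) (u \<beta>)" "set (u \<beta>) = Y \<beta>" using u by blast+
    have "sorted_wrt (\<lambda>i j. (g \<beta> i, g \<beta> j) \<in> r \<beta> \<and> g \<beta> i \<noteq> g \<beta> j) (u \<beta>)"
    proof (rule sorted_wrt_mono_rel)
      show "sorted_wrt (\<lambda>i j. (i, j) \<in> r \<beta> \<and> i \<noteq> j) (u \<beta>)"
        using ub(1) by (simp add: increasing_def)
      show "(g \<beta> i, g \<beta> j) \<in> r \<beta> \<and> g \<beta> i \<noteq> g \<beta> j"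
        if "i \<in> set (u \<beta>)" "j \<in> set (u \<beta>)" "(i, j) \<in> r \<beta> \<and> i \<noteq> j" for i j
        using g_mono[OF \<beta>, of i j] that ub(2) by blast
    qed
    then have "increasing (r \<beta>) (map (g \<beta>) (u \<beta>))"
      using gF[OF \<beta>] ub(2) unfolding increasing_def sorted_wrt_map by auto
    with ub(1) show "increasing (r \<beta>) (u \<beta>) \<and> increasing (r \<beta>) (map (g \<beta>) (u \<beta>)) \<and>
      length (u \<beta>) = length (map (g \<beta>) (u \<beta>))" by simp
  qed (use A in auto)
  then obtain \<rho> where \<rho>: "\<rho> \<in> aut_fixing A"
    and \<rho>u: "\<And>\<beta>. \<beta> \<in> S \<Longrightarrow> map (map \<rho>) (map (I \<beta>) (u \<beta>)) = map (I \<beta>) (map (g \<beta>) (u \<beta>))"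
    by blast
  have \<rho>I: "map \<rho> (I \<beta> i) = I \<beta> (g \<beta> i)" if "i \<in> Y \<beta>" for \<beta> i
  proof -
    have "i \<in> set (u \<beta>)" using u YS[OF that] that by blast
    with \<rho>u[OF YS[OF that]] show ?thesis by (simp add: map_eq_conv comp_def)
  qed
  define b1 where "b1 = map \<rho> b"
  have b1: "generic A b1"
    unfolding b1_def by (rule realizes_aut[OF \<rho> restrict_subset(1) A(1) w(1)])
  then have b1_tup: "b1 \<in> tuples M n" by (rule generic_tuple)
  obtain \<sigma> where \<sigma>: "\<sigma> \<in> \<Gamma>" "holds M \<theta> (b1 @ map \<sigma> d)"
    using D(3)[OF b1] \<Gamma>(3) by blast
  have \<sigma>A: "\<sigma> \<in> aut_fixing A" using \<sigma>(1) \<Gamma>(1) by blast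
  obtain \<tau> where \<tau>: "\<tau> \<in> aut_fixing A" "\<And>z. z \<in> univ M \<Longrightarrow> \<tau> (\<sigma> z) = z"
    using inverse_aut[OF \<sigma>A A(1)] by blast
  obtain c0 where c0: "c0 \<in> univ M" using univ_nonempty by blast
  define e where "e v = (case v of Inl (Inl (\<beta>, i, l)) \<Rightarrow> if i \<in> Y \<beta> \<and> l < m \<beta> then \<tau> (I \<beta> (g \<beta> i) ! l) else c0
    | Inl (Inr l) \<Rightarrow> if l < n then \<tau> (b1 ! l) else c0 | Inr a \<Rightarrow> a)" for v
  have gI: "I \<beta> (g \<beta> i) \<in> tuples M (m \<beta>)" if "i \<in> Y \<beta>" for \<beta> i
    using I_tup[of \<beta> "g \<beta> i"] gF[OF YS[OF that] that] YS[OF that] S(2) by blast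
  have e_fam: "map e (family_vars m \<beta> i) = map \<tau> (I \<beta> (g \<beta> i))" if "i \<in> Y \<beta>" for \<beta> i
    using gI[OF that] that by (intro nth_equalityI) (auto simp: seq_vars_def e_def tuples_def)
  have e_tup: "map e (tuple_vars n) = map \<tau> b1"
    using b1_tup by (intro nth_equalityI) (auto simp: e_def tuples_def)
  have e_par: "map e (map Inr a) = a" for a
    by (simp add: e_def comp_def)
  have e_concat: "map e (concat (map (family_vars m \<beta>) v)) = map \<tau> (concat (map (I \<beta>) (map (g \<beta>) v)))"
    if "set v \<subseteq> Y \<beta>" for \<beta> v
  proof -
    have "map (map e) (map (family_vars m \<beta>) v) = map (map \<tau>) (map (I \<beta>) (map (g \<beta>) v))"
      using e_fam that by (auto simp: subset_eq simp del: map_map) (simp add: e_fam)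
    then show ?thesis by (simp only: map_concat)
  qed
  show thesis
  proof (rule that[of e])
    show "e ` (UNIV <+> univ M) \<subseteq> univ M"
    proof
      fix z
      assume "z \<in> e ` (UNIV <+> univ M)"
      then obtain v where v: "v \<in> UNIV <+> univ M" "z = e v" by blast
      consider \<beta> i l where "v = Inl (Inl (\<beta>, i, l))" | l where "v = Inl (Inr l)" | a where "v = Inr a"
        by (metis old.sum.exhaust surj_pair)
      then show "z \<in> univ M"
      proof cases
        case (1 \<beta> i l)
        have "\<tau> (I \<beta> (g \<beta> i) ! l) \<in> univ M" if "i \<in> Y \<beta>" "l < m \<beta>"
          using gI[OF that(1)] that(2) by (intro aut_in_univ[OF \<tau>(1)]) (auto simp: tuples_def)
        then show ?thesis using c0 by (simp add: v(2) 1 e_def)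
      next
        case (2 l)
        have "\<tau> (b1 ! l) \<in> univ M" if "l < n"
          using b1_tup that by (intro aut_in_univ[OF \<tau>(1)]) (auto simp: tuples_def)
        then show ?thesis using c0 by (simp add: v(2) 2 e_def)
      next
        case (3 a)
        then show ?thesis using v by (auto simp: e_def)
      qed
    qed
    show "e (Inr a) = a" for a by (simp add: e_def)
    show "holds M \<psi> (map e (tuple_vars n @ map Inr d'))" if "(\<psi>, d') \<in> \<Sigma>0" for \<psi> d'
    proof -
      have \<tau>d: "map \<tau> (map \<sigma> d) = d" using \<tau>(2) du(1) by (auto simp: map_idI subset_eq)
      have "holds M \<theta> (map \<tau> (b1 @ map \<sigma> d)) \<longleftrightarrow> holds M \<theta> (b1 @ map \<sigma> d)"
        by (rule aut_holds[OF \<tau>(1)])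
          (use \<theta>(1) b1_tup du(1) aut_in_univ[OF \<sigma>A] in \<open>auto simp: tuples_def\<close>)
      then have "holds M \<theta> (map \<tau> b1 @ d)"
        using \<sigma>(2) unfolding map_append \<tau>d by blast
      moreover have \<tau>b: "map \<tau> b1 \<in> tuples M n" by (rule aut_tuples[OF \<tau>(1) b1_tup])
      ultimately have "realizes M n \<Sigma>0 (map \<tau> b1)"
        using \<theta>(2) \<theta>0(2) by blast
      then show ?thesis
        unfolding map_append e_tup e_par using that by (auto simp: realizes_def)
    qed
    show "holds M \<phi> (map e (concat (map (family_vars m \<alpha>) is) @ bz)) \<longleftrightarrow>
      holds M \<phi> (map e (concat (map (family_vars m \<alpha>) js) @ bz))"
      if q: "(\<alpha>, is, js, \<phi>, bz) \<in> Q0" for \<alpha> "is" js \<phi> bz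
    proof -
      have ev: "ev \<sigma> v \<in> univ M \<and> e v = \<tau> (ev \<sigma> v)" if v: "v \<in> set bz" for v
      proof -
        have "v \<in> Inl ` Inl ` (SIGMA \<beta>:K - {\<alpha>}. Field (r \<beta>) \<times> {..<m \<beta>}) \<union> Inr ` univ M"
          using Q(5)[OF q] v by blast
        then consider \<beta> i l where "v = Inl (Inl (\<beta>, i, l))" "l < m \<beta>" | a where "v = Inr a" "a \<in> univ M"
          by auto
        then show ?thesis
        proof cases
          case (1 \<beta> i l)
          have i: "i \<in> Y \<beta>" by (rule slotY[OF q v]) (simp add: slot_def 1)
          then show ?thesis
            using gI[OF i] 1 by (auto simp: ev_def e_def tuples_def)
        next
          case (2 a)
          have "\<sigma> a \<in> univ M" using 2(2) by (rule aut_in_univ[OF \<sigma>A])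
          then show ?thesis using \<tau>(2)[OF 2(2)] by (simp add: 2(1) ev_def e_def)
        qed
      qed
      have e_bz: "map e bz = map \<tau> (map (ev \<sigma>) bz)" using ev by simp
      have moved: "holds M \<phi> (map e (concat (map (family_vars m \<alpha>) v) @ bz)) \<longleftrightarrow>
          holds M \<phi> (concat (map (I \<alpha>) (map (g \<alpha>) v)) @ map (ev \<sigma>) bz)"
        if v: "set v \<subseteq> Y \<alpha>" "length v = length is" for v
      proof -
        have "concat (map (I \<alpha>) (map (g \<alpha>) v)) \<in> tuples M (length (map (g \<alpha>) v) * m \<alpha>)"
          using gI v(1) by (intro concat_tuples) auto
        then have "holds M \<phi> (map \<tau> (concat (map (I \<alpha>) (map (g \<alpha>) v)) @ map (ev \<sigma>) bz)) \<longleftrightarrow>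
            holds M \<phi> (concat (map (I \<alpha>) (map (g \<alpha>) v)) @ map (ev \<sigma>) bz)"
          using Q(6)[OF q] ev v(2) by (intro aut_holds[OF \<tau>(1)]) (auto simp: tuples_def)
        then show ?thesis
          unfolding map_append e_concat[OF v(1)] e_bz .
      qed
      have "set is \<subseteq> Y \<alpha>" "set js \<subseteq> Y \<alpha>" "length js = length is"
        using isY[OF q] Q(4)[OF q] by auto
      then show ?thesis
        using moved[of "is"] moved[of js] hom'[OF q \<sigma>(1)] by blast
    qed
    fix \<beta>
    assume \<beta>: "\<beta> \<in> S0"
    then have \<beta>K: "\<beta> \<in> K" using S0(2) by blast
    have moved: "holds M (\<chi> \<beta>) (map e (concat (map (family_vars m \<beta>) v) @ map Inr (c \<beta>) @ tuple_vars n)) \<longleftrightarrow>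
        holds M (\<chi> \<beta>) (concat (map (I \<beta>) v) @ c \<beta> @ b)"
      if v: "set v \<subseteq> Y \<beta>" "length v = length (x \<beta>)" for v
    proof -
      have "map (map \<rho>) (map (I \<beta>) v) = map (I \<beta>) (map (g \<beta>) v)"
        using \<rho>I v(1) by auto
      then have \<rho>v: "map \<rho> (concat (map (I \<beta>) v)) = concat (map (I \<beta>) (map (g \<beta>) v))"
        by (simp only: map_concat)
      have fix_c: "map \<rho> (c \<beta>) = c \<beta>" "map \<tau> (c \<beta>) = c \<beta>"
        using aut_fixing_map[OF \<rho> w(9)[OF \<beta>K]] aut_fixing_map[OF \<tau>(1) w(9)[OF \<beta>K]] by blast+
      have "concat (map (I \<beta>) v) \<in> tuples M (length v * m \<beta>)"
        using I_tup[OF \<beta>K] v(1) Y(2) by (intro concat_tuples) blast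
      then have fm: "\<chi> \<beta> \<in> fms L (length (concat (map (I \<beta>) v) @ c \<beta> @ b))"
        and um: "set (concat (map (I \<beta>) v) @ c \<beta> @ b) \<subseteq> univ M"
        using w(9,10)[OF \<beta>K] v(2) b_tup A(1) by (auto simp: tuples_def)
      have "map e (concat (map (family_vars m \<beta>) v) @ map Inr (c \<beta>) @ tuple_vars n)
          = map \<tau> (map \<rho> (concat (map (I \<beta>) v) @ c \<beta> @ b))"
        unfolding map_append e_concat[OF v(1)] e_par e_tup \<rho>v fix_c b1_def ..
      moreover have "holds M (\<chi> \<beta>) (map \<tau> (map \<rho> (concat (map (I \<beta>) v) @ c \<beta> @ b))) \<longleftrightarrow>
          holds M (\<chi> \<beta>) (map \<rho> (concat (map (I \<beta>) v) @ c \<beta> @ b))"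
      proof (rule aut_holds[OF \<tau>(1)])
        show "\<chi> \<beta> \<in> fms L (length (map \<rho> (concat (map (I \<beta>) v) @ c \<beta> @ b)))"
          using fm by (simp only: length_map)
        show "set (map \<rho> (concat (map (I \<beta>) v) @ c \<beta> @ b)) \<subseteq> univ M"
          using um aut_in_univ[OF \<rho>] unfolding set_map by blast
      qed
      ultimately show ?thesis
        using aut_holds[OF \<rho> fm um] by (simp only:)
    qed
    show "holds M (\<chi> \<beta>) (map e (concat (map (family_vars m \<beta>) (x \<beta>)) @ map Inr (c \<beta>) @ tuple_vars n)) \<and>
      \<not> holds M (\<chi> \<beta>) (map e (concat (map (family_vars m \<beta>) (y \<beta>)) @ map Inr (c \<beta>) @ tuple_vars n))"
      using moved[of "x \<beta>"] moved[of "y \<beta>"] xyY[OF \<beta>] w(8,11,12)[OF \<beta>K] by simp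
  qed
qed

end

context generically_stable_extension
begin

text \<open>
  The sequences and the realization \<open>b'\<close> of \<open>p\<close> are obtained from compactness in \<open>C'\<close>, with all elements
  of \<open>C\<close> as constants. The formulas that witness the failure of indiscernibility over \<open>b\<close> are kept as
  they are, since their parameters lie in \<open>A\<close>.
\<close>

theorem not_dpr_less_extension:
  fixes \<kappa> :: "'j rel"
  assumes small\<kappa>: "|Field \<kappa>| \<le>o |{\<phi>. wf_fm L \<phi>}|" and not: "\<not> dpr_less L C n A (restrict_type p A) \<kappa>"
  shows "\<not> dpr_less L C' n (univ C) p \<kappa>"
proof -
  define K where "K = Field \<kappa>"
  obtain m and r :: "'j \<Rightarrow> 'a list rel" and I b x y c \<chi> where
    wit: "dpr_witness n A (restrict_type p A) K m r I b x y c \<chi>"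
    using dpr_witness_of_not_less[OF not A(1)] unfolding K_def by blast
  note w = dpr_witnessD[OF wit]
  define V :: "((('j \<times> 'a list \<times> nat) + nat) + 'a) set"
    where "V = ((SIGMA \<beta>:K. Field (r \<beta>) \<times> {..<m \<beta>}) <+> {..<n}) <+> univ C"
  have "Ext.small V"
    unfolding V_def
    by (intro Ext.small_Plus Ext.small_finite univ_small Ext.small_Sigma[OF small\<kappa>[folded K_def]] countable_SIGMA
        countable_finite w(5)) simp_all
  have famV: "set (family_vars m \<beta> i) \<subseteq> V" if "\<beta> \<in> K" "i \<in> Field (r \<beta>)" for \<beta> i
    using that by (auto simp: seq_vars_def V_def)
  have famsV: "set (concat (map (family_vars m \<beta>) v)) \<subseteq> V" if "\<beta> \<in> K" "set v \<subseteq> Field (r \<beta>)" for \<beta> v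
    using famV[OF that(1)] that(2) by auto
  have len_fams: "length (concat (map (family_vars m \<beta>) v)) = length v * m \<beta>" for \<beta> and v :: "'a list list"
    by (induction v) (simp_all add: length_seq_vars)
  have tupV: "set (tuple_vars n) \<subseteq> V" by (auto simp: V_def)
  have parV: "set (map Inr a) \<subseteq> V" if "set a \<subseteq> univ C" for a
    using that by (auto simp: V_def)
  define P1 where "P1 = (\<lambda>(\<theta>, d) (M :: ('f, 'r, 'a) struct) (e :: ((('j \<times> 'a list \<times> nat) + nat) + 'a) \<Rightarrow> 'a). holds M \<theta> (map e (tuple_vars n @ map Inr d)))"
  define P2 where "P2 = (\<lambda>(\<alpha>, is :: 'a list list, js :: 'a list list, \<phi>, bz) (M :: ('f, 'r, 'a) struct) (e :: ((('j \<times> 'a list \<times> nat) + nat) + 'a) \<Rightarrow> 'a).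
    holds M \<phi> (map e (concat (map (family_vars m \<alpha>) is) @ bz)) \<longleftrightarrow>
    holds M \<phi> (map e (concat (map (family_vars m \<alpha>) js) @ bz)))"
  define P3 where "P3 = (\<lambda>\<beta> (M :: ('f, 'r, 'a) struct) (e :: ((('j \<times> 'a list \<times> nat) + nat) + 'a) \<Rightarrow> 'a).
    holds M (\<chi> \<beta>) (map e (concat (map (family_vars m \<beta>) (x \<beta>)) @ map Inr (c \<beta>) @ tuple_vars n)) \<and>
    \<not> holds M (\<chi> \<beta>) (map e (concat (map (family_vars m \<beta>) (y \<beta>)) @ map Inr (c \<beta>) @ tuple_vars n)))"
  define Q where "Q = Collect (indiscernibility_condition K r m)"
  have Q: "\<alpha> \<in> K" "set is \<subseteq> Field (r \<alpha>)" "set js \<subseteq> Field (r \<alpha>)" "length is = length js"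
    "set bz \<subseteq> V" "\<phi> \<in> fms L (length is * m \<alpha> + length bz)"
    if "(\<alpha>, is, js, \<phi>, bz) \<in> Q" for \<alpha> "is" js \<phi> bz
  proof -
    have q: "\<alpha> \<in> K" "increasing (r \<alpha>) is" "increasing (r \<alpha>) js" "length is = length js"
      "set bz \<subseteq> Inl ` Inl ` (SIGMA \<beta>:K - {\<alpha>}. Field (r \<beta>) \<times> {..<m \<beta>}) \<union> Inr ` univ C"
      "\<phi> \<in> fms L (length is * m \<alpha> + length bz)"
      using that unfolding Q_def indiscernibility_condition_def by auto
    from q(1,4,6) show "\<alpha> \<in> K" "length is = length js" "\<phi> \<in> fms L (length is * m \<alpha> + length bz)" .
    from q(2,3) show "set is \<subseteq> Field (r \<alpha>)" "set js \<subseteq> Field (r \<alpha>)" using increasing_subset by blast+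
    have "Inl ` Inl ` (SIGMA \<beta>:K - {\<alpha>}. Field (r \<beta>) \<times> {..<m \<beta>}) \<union> Inr ` univ C \<subseteq> V"
      by (auto simp: V_def)
    with q(5) show "set bz \<subseteq> V" by blast
  qed
  have xy: "set (x \<beta>) \<subseteq> Field (r \<beta>)" "set (y \<beta>) \<subseteq> Field (r \<beta>)" if "\<beta> \<in> K" for \<beta>
    using w(6,7)[OF that] increasing_subset by blast+
  have wit_vars: "set (concat (map (family_vars m \<beta>) v) @ map Inr (c \<beta>) @ tuple_vars n) \<subseteq> V"
    "\<chi> \<beta> \<in> fms L (length (concat (map (family_vars m \<beta>) v) @ map Inr (c \<beta>) @ tuple_vars n))"
    if "\<beta> \<in> K" "v = x \<beta> \<or> v = y \<beta>" for \<beta> v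
  proof -
    have "set v \<subseteq> Field (r \<beta>)" "length v = length (x \<beta>)"
      using that xy w(8) by auto
    then show "set (concat (map (family_vars m \<beta>) v) @ map Inr (c \<beta>) @ tuple_vars n) \<subseteq> V"
      "\<chi> \<beta> \<in> fms L (length (concat (map (family_vars m \<beta>) v) @ map Inr (c \<beta>) @ tuple_vars n))"
      using famsV[OF that(1)] tupV parV[of "c \<beta>"] w(9,10)[OF that(1)] A(1) unfolding length_append len_fams
      by (simp_all add: subset_trans)
  qed
  have P1_vars: "set (tuple_vars n @ map Inr d) \<subseteq> V" "\<theta> \<in> fms L (length (tuple_vars n @ map Inr d))"
    if "(\<theta>, d) \<in> p" for \<theta> d
  proof -
    have "set d \<subseteq> univ C" "\<theta> \<in> fms L (n + length d)" using that p_subset by (auto simp: pfms_def)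
    then show "set (tuple_vars n @ map Inr d) \<subseteq> V" "\<theta> \<in> fms L (length (tuple_vars n @ map Inr d))"
      using tupV parV[of d] by simp_all
  qed
  have P2_vars: "set (concat (map (family_vars m \<alpha>) v) @ bz) \<subseteq> V"
    "\<phi> \<in> fms L (length (concat (map (family_vars m \<alpha>) v) @ bz))"
    if "(\<alpha>, is, js, \<phi>, bz) \<in> Q" "v = is \<or> v = js" for \<alpha> "is" js \<phi> bz v
  proof -
    have "set v \<subseteq> Field (r \<alpha>)" "length v = length is" using Q[OF that(1)] that(2) by auto
    then show "set (concat (map (family_vars m \<alpha>) v) @ bz) \<subseteq> V"
      "\<phi> \<in> fms L (length (concat (map (family_vars m \<alpha>) v) @ bz))"
      using famsV[OF Q(1)[OF that(1)]] Q(5,6)[OF that(1)] unfolding length_append len_fams by simp_all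
  qed
  define F where "F = P1 ` p \<union> P2 ` Q \<union> P3 ` K"
  have "\<exists>e. e ` V \<subseteq> univ C' \<and> (\<forall>v \<in> Inr ` univ C. e v = case_sum undefined id v) \<and> (\<forall>P \<in> F. P C' e)"
  proof (rule Ext.compactness[of V "Inr ` univ C" "case_sum undefined id" F])
    show "Ext.small V" by fact
    show "Inr ` univ C \<subseteq> V" "case_sum undefined id ` Inr ` univ C \<subseteq> univ C'"
      using univ_subset by (auto simp: V_def)
    fix P
    assume "P \<in> F"
    then consider q where "q \<in> p" "P = P1 q" | q where "q \<in> Q" "P = P2 q" | \<beta> where "\<beta> \<in> K" "P = P3 \<beta>"
      unfolding F_def by blast
    then show "definable L V P"
    proof cases
      case (1 q)
      obtain \<theta> d where q: "q = (\<theta>, d)" by (cases q)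
      show ?thesis
        unfolding 1(2) q P1_def prod.case using P1_vars[of \<theta> d] 1(1) q by (intro definable_holds) blast+
    next
      case (2 q)
      obtain \<alpha> "is" js \<phi> bz where q: "q = (\<alpha>, is, js, \<phi>, bz)" by (cases q)
      show ?thesis
        unfolding 2(2) q P2_def prod.case using P2_vars[of \<alpha> "is" js \<phi> bz] 2(1) q
        by (intro definable_iff definable_holds) blast+
    next
      case (3 \<beta>)
      show ?thesis
        unfolding 3(2) P3_def using wit_vars[OF 3(1)]
        by (intro definable_and definable_not definable_holds) blast+
    qed
  next
    fix F0
    assume F0: "finite F0" "F0 \<subseteq> F"
    have "finite (F0 \<inter> P1 ` p)" "finite (F0 \<inter> P2 ` Q)" "finite (F0 \<inter> P3 ` K)"
      using F0(1) by blast+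
    then obtain \<Sigma>0 Q0 S0 where \<Sigma>0: "\<Sigma>0 \<subseteq> p" "finite \<Sigma>0" "F0 \<inter> P1 ` p = P1 ` \<Sigma>0"
      and Q0: "Q0 \<subseteq> Q" "finite Q0" "F0 \<inter> P2 ` Q = P2 ` Q0"
      and S0: "S0 \<subseteq> K" "finite S0" "F0 \<inter> P3 ` K = P3 ` S0"
      by (metis finite_subset_image inf_le2)
    have Q0': "indiscernibility_condition K r m q" if "q \<in> Q0" for q
      using that Q0(1) by (auto simp: Q_def)
    obtain e :: "((('j \<times> 'a list \<times> nat) + nat) + 'a) \<Rightarrow> 'a" where
      e: "e ` (UNIV <+> univ C) \<subseteq> univ C" "\<And>a. e (Inr a) = a"
      and e1: "\<And>\<theta> d. (\<theta>, d) \<in> \<Sigma>0 \<Longrightarrow> holds C \<theta> (map e (tuple_vars n @ map Inr d))"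
      and e2: "\<And>\<alpha> is js \<phi> bz. (\<alpha>, is, js, \<phi>, bz) \<in> Q0 \<Longrightarrow>
        holds C \<phi> (map e (concat (map (family_vars m \<alpha>) is) @ bz)) \<longleftrightarrow>
        holds C \<phi> (map e (concat (map (family_vars m \<alpha>) js) @ bz))"
      and e3: "\<And>\<beta>. \<beta> \<in> S0 \<Longrightarrow>
        holds C (\<chi> \<beta>) (map e (concat (map (family_vars m \<beta>) (x \<beta>)) @ map Inr (c \<beta>) @ tuple_vars n)) \<and>
        \<not> holds C (\<chi> \<beta>) (map e (concat (map (family_vars m \<beta>) (y \<beta>)) @ map Inr (c \<beta>) @ tuple_vars n))"
    proof -
      show thesis
        by (rule finite_part_realized[OF wit S0(2,1) \<Sigma>0(2,1) Q0(2)]) (fact Q0', fact that)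
    qed
    have "V \<subseteq> UNIV <+> univ C" by (auto simp: V_def)
    then have eV: "e ` V \<subseteq> univ C" using e(1) by blast
    have up: "holds C' \<phi> (map e zs) \<longleftrightarrow> holds C \<phi> (map e zs)"
      if "set zs \<subseteq> V" "\<phi> \<in> fms L (length zs)" for \<phi> zs
      using that eV by (intro holds_extension) auto
    have "P C' e" if P: "P \<in> F0" for P
    proof -
      have "P \<in> P1 ` \<Sigma>0 \<or> P \<in> P2 ` Q0 \<or> P \<in> P3 ` S0"
      proof -
        have "P \<in> P1 ` p \<union> P2 ` Q \<union> P3 ` K" using F0(2) P unfolding F_def by (rule subsetD)
        then have "P \<in> F0 \<inter> P1 ` p \<or> P \<in> F0 \<inter> P2 ` Q \<or> P \<in> F0 \<inter> P3 ` K"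
          unfolding Un_iff Int_iff using P by (simp only: simp_thms disj_assoc)
        then show ?thesis unfolding \<Sigma>0(3) Q0(3) S0(3) .
      qed
      then consider q where "q \<in> \<Sigma>0" "P = P1 q" | q where "q \<in> Q0" "P = P2 q" | \<beta> where "\<beta> \<in> S0" "P = P3 \<beta>"
        by (elim disjE imageE) auto
      then show ?thesis
      proof cases
        case (1 q)
        obtain \<theta> d where q: "q = (\<theta>, d)" by (cases q)
        have "(\<theta>, d) \<in> p" using 1(1) q \<Sigma>0(1) by blast
        from up[OF P1_vars[OF this]] e1[of \<theta> d] 1 q show ?thesis
          unfolding P1_def by (simp only: prod.case)
      next
        case (2 q)
        obtain \<alpha> "is" js \<phi> bz where q: "q = (\<alpha>, is, js, \<phi>, bz)" by (cases q)
        have "(\<alpha>, is, js, \<phi>, bz) \<in> Q" using 2(1) q Q0(1) by blast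
        from up[OF P2_vars[OF this disjI1[OF refl]]] up[OF P2_vars[OF this disjI2[OF refl]]]
          e2[of \<alpha> "is" js \<phi> bz] 2 q show ?thesis
          unfolding P2_def by (simp only: prod.case)
      next
        case (3 \<beta>)
        have "\<beta> \<in> K" using 3(1) S0(1) by blast
        from up[OF wit_vars[OF this disjI1[OF refl]]] up[OF wit_vars[OF this disjI2[OF refl]]] e3[OF 3(1)]
        show ?thesis unfolding 3(2) P3_def by blast
      qed
    qed
    then show "\<exists>e. e ` V \<subseteq> univ C' \<and> (\<forall>v \<in> Inr ` univ C. e v = case_sum undefined id v) \<and> (\<forall>P \<in> F0. P C' e)"
      using eV univ_subset e(2) by (intro exI[of _ e]) auto
  qed
  then obtain e where e: "e ` V \<subseteq> univ C'" "\<forall>v \<in> Inr ` univ C. e v = case_sum undefined id v" "\<forall>P \<in> F. P C' e"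
    by blast
  have e_par: "map e (map Inr a) = a" if "set a \<subseteq> univ C" for a
    using e(2) that by (auto simp: map_idI subset_eq)
  define I' where "I' = (\<lambda>\<beta> i. map e (family_vars m \<beta> i))"
  define b' where "b' = map e (tuple_vars n)"
  have e_fams: "map e (concat (map (family_vars m \<beta>) v)) = concat (map (I' \<beta>) v)" for \<beta> v
    by (simp add: I'_def map_concat comp_def)
  have I'_tup: "I' \<beta> i \<in> tuples C' (m \<beta>)" if "\<beta> \<in> K" "i \<in> Field (r \<beta>)" for \<beta> i
    using famV[OF that] e(1) by (auto simp: I'_def tuples_def length_seq_vars)
  have "realizes C' n p b'"
    unfolding realizes_def
  proof (intro conjI ballI)
    show "b' \<in> tuples C' n" using tupV e(1) by (auto simp: b'_def tuples_def)
    fix q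
    assume q: "q \<in> p"
    obtain \<theta> d where [simp]: "q = (\<theta>, d)" by (cases q)
    have "P1 q C' e" using e(3) q unfolding F_def by blast
    moreover have "set d \<subseteq> univ C" using q p_subset by (auto simp: pfms_def)
    ultimately show "case q of (\<theta>, d) \<Rightarrow> holds C' \<theta> (b' @ d)"
      by (simp only: P1_def prod.case \<open>q = (\<theta>, d)\<close> map_append e_par b'_def[symmetric])
  qed
  moreover have "mutually_indiscernible L C' (univ C) K r I'"
    unfolding mutually_indiscernible_def indiscernible_def
  proof (intro ballI allI impI)
    fix \<alpha> "is" js
    assume \<alpha>: "\<alpha> \<in> K" and inc: "increasing (r \<alpha>) is \<and> increasing (r \<alpha>) js \<and> length is = length js"
    have isF: "set is \<subseteq> Field (r \<alpha>)" and jsF: "set js \<subseteq> Field (r \<alpha>)"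
      using inc increasing_subset by blast+
    define E where "E = univ C \<union> (\<Union>\<beta> \<in> K - {\<alpha>}. entries (I' \<beta>) (Field (r \<beta>)))"
    define Z :: "((('j \<times> 'a list \<times> nat) + nat) + 'a) set"
      where "Z = Inl ` Inl ` (SIGMA \<beta>:K - {\<alpha>}. Field (r \<beta>) \<times> {..<m \<beta>}) \<union> Inr ` univ C"
    have EZ: "E \<subseteq> e ` Z"
    proof
      fix z
      assume "z \<in> E"
      then consider "z \<in> univ C" | \<beta> i where "\<beta> \<in> K" "\<beta> \<noteq> \<alpha>" "i \<in> Field (r \<beta>)" "z \<in> set (I' \<beta> i)"
        unfolding E_def entries_def by blast
      then show "z \<in> e ` Z"
      proof cases
        case 1
        then have "Inr z \<in> Z" "e (Inr z) = z" using e(2) by (auto simp: Z_def)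
        then show ?thesis by (metis imageI)
      next
        case (2 \<beta> i)
        then obtain v where "v \<in> set (family_vars m \<beta> i)" "z = e v" by (auto simp: I'_def)
        moreover from this have "v \<in> Z" using 2 by (auto simp: Z_def seq_vars_def)
        ultimately show ?thesis by blast
      qed
    qed
    have len: "length (concat (map (I' \<alpha>) v)) = length v * m \<alpha>" if "set v \<subseteq> Field (r \<alpha>)" for v
      using I'_tup[OF \<alpha>] that by (intro Ext.length_concat_tuples) blast
    have iff: "holds C' \<phi> (concat (map (I' \<alpha>) is) @ bb) \<longleftrightarrow> holds C' \<phi> (concat (map (I' \<alpha>) js) @ bb)"
      if \<phi>: "\<phi> \<in> fms L (length is * m \<alpha> + length bb)" and bb: "set bb \<subseteq> E" for \<phi> bb
    proof -
      obtain bz where bz: "set bz \<subseteq> Z" "map e bz = bb"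
        using list_preimage[of bb e Z] bb EZ by blast
      then have "length bz = length bb" by (metis length_map)
      then have "(\<alpha>, is, js, \<phi>, bz) \<in> Q"
        using \<alpha> inc bz(1) \<phi> unfolding Q_def indiscernibility_condition_def Z_def by simp
      then have "P2 (\<alpha>, is, js, \<phi>, bz) C' e" using e(3) unfolding F_def by blast
      then show ?thesis
        by (simp only: P2_def prod.case map_append e_fams bz(2))
    qed
    have "tp L C' (concat (map (I' \<alpha>) is)) E = tp L C' (concat (map (I' \<alpha>) js)) E"
      using iff len[OF isF] len[OF jsF] inc by (auto simp: tp_def pfms_def)
    then show "tp L C' (concat (map (I' \<alpha>) is)) (univ C \<union> (\<Union>\<beta> \<in> K - {\<alpha>}. entries (I' \<beta>) (Field (r \<beta>)))) =
      tp L C' (concat (map (I' \<alpha>) js)) (univ C \<union> (\<Union>\<beta> \<in> K - {\<alpha>}. entries (I' \<beta>) (Field (r \<beta>))))"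
      unfolding E_def .
  qed
  moreover have "is_seq C' (m \<beta>) (r \<beta>) (I' \<beta>)" if "\<beta> \<in> K" for \<beta>
    using w(3)[OF that] I'_tup[OF that] unfolding is_seq_def by blast
  moreover have "set (c \<beta>) \<subseteq> univ C" if "\<beta> \<in> K" for \<beta>
    using w(9)[OF that] A(1) by blast
  moreover have "holds C' (\<chi> \<beta>) (concat (map (I' \<beta>) (x \<beta>)) @ c \<beta> @ b')"
    "\<not> holds C' (\<chi> \<beta>) (concat (map (I' \<beta>) (y \<beta>)) @ c \<beta> @ b')" if "\<beta> \<in> K" for \<beta>
  proof -
    have "P3 \<beta> C' e" using e(3) that unfolding F_def by blast
    moreover have "set (c \<beta>) \<subseteq> univ C" using w(9)[OF that] A(1) by blast
    ultimately show "holds C' (\<chi> \<beta>) (concat (map (I' \<beta>) (x \<beta>)) @ c \<beta> @ b')"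
      "\<not> holds C' (\<chi> \<beta>) (concat (map (I' \<beta>) (y \<beta>)) @ c \<beta> @ b')"
      by (simp_all only: P3_def map_append e_fams e_par b'_def[symmetric] not_False_eq_True)
  qed
  ultimately have "Ext.dpr_witness n (univ C) p K m r I' b' x y c \<chi>"
    unfolding Ext.dpr_witness_def using w(4-8,10) by (intro conjI ballI) blast+
  then show ?thesis
    unfolding K_def by (rule Ext.not_dpr_less_of_witness)
qed

end

theorem corollary3p17:
  fixes L :: "('f, 'r) lang" and T :: "('f, 'r) fm set"
    and C C' :: "('f, 'r, 'a) struct"
    and \<mu> :: "'m rel" and \<mu>' :: "'n rel"
    and A :: "'a set" and n :: nat and p :: "('f, 'r, 'a) pfm set"
  assumes "complete_theory L T"
    and "monster_model L T \<mu> C"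
    and "monster_model L T \<mu>' C'" and "elem_sub L C C'" and "|univ C| <o \<mu>'"
    and "A \<subseteq> univ C" and "|A| <o \<mu>"
    and "p \<in> complete_types L C n (univ C)"
    and "NIP L C' n p"
    and "generically_stable L C n A p"
  shows "NIP L C n (restrict_type p A) \<and>
    (\<forall>\<kappa> :: 'k rel. Card_order \<kappa> \<longrightarrow>
       (dpr_less L C n A (restrict_type p A) \<kappa> \<longleftrightarrow> dpr_less L C' n (univ C) p \<kappa>))"
proof -
  interpret generically_stable_extension L T \<mu> C A n p \<mu>' C'
    using assms by unfold_locales auto
  have NIP_A: "NIP L C n (restrict_type p A)"
    by (rule NIP_restrict[OF assms(9)])
  moreover have "dpr_less L C n A (restrict_type p A) \<kappa> \<longleftrightarrow> dpr_less L C' n (univ C) p \<kappa>"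
    if \<kappa>: "Card_order \<kappa>" for \<kappa> :: "'k rel"
  proof (cases "|{\<phi>. wf_fm L \<phi>}| <o \<kappa>")
    case True
    have "dpr_less L C n A (restrict_type p A) \<kappa>"
      by (rule dpr_less_of_NIP[OF NIP_A restrict_subset(1) A \<kappa> True])
    moreover have "dpr_less L C' n (univ C) p \<kappa>"
      by (rule Ext.dpr_less_of_NIP[OF assms(9) p_subset univ_subset univ_small \<kappa> True])
    ultimately show ?thesis by blast
  next
    case False
    have "|Field \<kappa>| =o \<kappa>" using \<kappa> by (rule card_of_Field_ordIso)
    moreover have "\<kappa> \<le>o |{\<phi>. wf_fm L \<phi>}|"
      using False \<kappa> by (meson card_of_Well_order card_order_on_well_order_on not_ordLess_iff_ordLeq)
    ultimately have "|Field \<kappa>| \<le>o |{\<phi>. wf_fm L \<phi>}|" by (rule ordIso_ordLeq_trans)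
    then show ?thesis
      using not_dpr_less_restrict not_dpr_less_extension by blast
  qed
  ultimately show ?thesis by blast
qed

end
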